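(* Let $r\geq 2$ be an integer, let $G_1,\dots,G_r$ be non-trivial finitely generated groups of subexponential growth, and let $G=G_1\ast\cdots\ast G_r$ be their free product. For each $i=1,\dots,r$ let $S_i$ be a finite generating set of $G_i$, let $S=\bigcup_{i=1}^{r}S_i$, and let $\ell$ be the word length on $G$ determined by $S$. Suppose that $\mu$ is a probability measure on $G$ whose support generates a pattern-avoiding semigroup, and let $(Y_n)_{n\geq 0}$ be a right random walk on $G$ with increments distributed according to $\mu$. Then: (1) The sequence of random variables $\bigl(\frac{1}{n}\ell(Y_n)\bigr)_{n\geq 1}$ satisfies the weak large deviation principle with a convex rate function $I\colon \mathbb{R}_{\geq 0}\to[0,\infty]$. (2) If $\mu$ has a finite exponential moment, i.e. $\int_G \exp(\tau\ell(g))\,d\mu(g)<\infty$ for some $\tau>0$, then $I$ is a proper function and the sequence $\bigl(\frac{1}{n}\ell(Y_n)\bigr)_{n\geq 1}$ satisfies the full large deviation principle with rate function $I$. (3) If $\mu$ has finite moment-generating function, i.e. $\int_G \exp(\tau\ell(g))\,d\mu(g)<\infty$ for every $\tau>0$, then $I$ is the Fenchel-Legendre transform of the limiting logarithmic moment generating function $\Lambda$ of the sequence $\bigl(\frac{1}{n}\ell(Y_n)\bigr)_{n\geq 1}$, that is, $I(x)=\sup_{z\in\mathbb{R}}\{zx-\Lambda(z)\}$ for every $x\in\mathbb{R}_{\geq 0}$, where $\Lambda(z)=\limsup_{n\to\infty}\frac{1}{n}\log\mathbb{E}[e^{z\ell(Y_n)}]$ for $z\in\mathbb{R}$.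
   Context: Word length: for a group $G$ with finite generating set $S$, $\ell(g)$ is the least $n\in\mathbb{N}$ such that $g=s_1\cdots s_n$ with $s_1,\dots,s_n\in S\cup S^{-1}$, and $\ell(e)=0$. Subexponential growth: a finitely generated group $H$ has subexponential growth if, for the word length determined by a (equivalently, any) finite generating set, the closed balls $B^{H}(n)=\{h\in H:\ell(h)\leq n\}$ satisfy $\lim_{n\to\infty}|B^{H}(n)|^{1/n}=1$. Reduced words: each $G_i$ is identified with its copy in $G=G_1\ast\cdots\ast G_r$. Every non-trivial $g\in G$ can be written uniquely as $g=x_1\cdots x_m$ with $x_j\in G_{i_j}\setminus\{e\}$ and $i_j\neq i_{j+1}$ for $1\leq j\leq m-1$; such a product is called a reduced word of type size $m$, and $g$ is said to have type size $m$. Starting and ending with a word: let $\omega=y_1\cdots y_d$ be a reduced word of type size $d$, let $g=x_1\cdots x_m$ (reduced) have type size $m\geq 2$, and put $q=\min\{d,\lfloor m/2\rfloor\}$. Then $g$ starts with $\omega$ if $x_1\cdots x_q=y_1\cdots y_q$, and $g$ ends with $\omega$ if $x_{m-q+1}\cdots x_m=y_1\cdots y_q$. In the definition of pattern-avoiding below, "$g$ ends with $\omega^{-1}$", for $\omega=y_1\cdots y_D$ and $\omega^{-1}=y_D^{-1}\cdots y_1^{-1}$, means that the terminal segment of length $q=\min\{D,\lfloor m/2\rfloor\}$ of $g$ is the inverse of the initial segment of $\omega$ of the same length: $x_{m-q+1}\cdots x_m=y_q^{-1}\cdots y_1^{-1}$. Pattern-avoiding: a subset $\mathcal{T}\subset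 G$ is pattern-avoiding if there is an integer $D>0$ such that for every reduced word $\omega=y_1\cdots y_D$ of type size $D$ there is $g\in\mathcal{T}$ of type size at least $2$ which does not start with $\omega$ and does not end with $\omega^{-1}$. Random walk: $Y_0=e$ and $Y_n=X_1\cdots X_n$ for $n\geq 1$, where $(X_n)_{n\geq 1}$ are independent $G$-valued random variables with common law $\mu$ on a probability space $(\Omega,\mathcal{F},\mathbb{P})$; $\mathbb{E}$ is expectation with respect to $\mathbb{P}$. The support of $\mu$ is $\{g\in G:\mu(g)>0\}$. Large deviations (conventions $\log 0=-\infty$, $\inf\emptyset=\infty$): let $(Z_n)_{n\geq1}$ be random variables with values in a Hausdorff regular topological space $X$ (here $X=\mathbb{R}_{\geq 0}$), with laws $\mu_n$, and let $I\colon X\to[0,\infty]$ be lower semicontinuous. $(Z_n)$ satisfies the (full) large deviation principle with rate function $I$ if $\liminf_{n}\frac{1}{n}\log\mu_n(V)\geq-\inf_{x\in V}I(x)$ for every open $V\subset X$ and $\limsup_{n}\frac{1}{n}\log\mu_n(F)\leq-\inf_{x\in F}I(x)$ for every closed $F\subset X$. It satisfies the weak large deviation principle with rate function $I$ if the lower bound holds for every open set and the upper bound holds for every compact set. The rate function $I$ is proper if $\{x\in X: I(x)\leq\alpha\}$ is compact for every $\alpha\in[0,\infty)$. *)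

theory Defs
  imports "HOL-Probability.Probability" "HOL-Algebra.Generated_Groups"
begin

section \<open>Word length and growth\<close>

definition word_length :: "('a, 'b) monoid_scheme \<Rightarrow> 'a set \<Rightarrow> 'a \<Rightarrow> nat" where
  "word_length G S g = (LEAST n. \<exists>ws. length ws = n \<and> set ws \<subseteq> S \<union> (\<lambda>s. inv\<^bsub>G\<^esub> s) ` S
     \<and> g = foldr (\<lambda>s h. s \<otimes>\<^bsub>G\<^esub> h) ws \<one>\<^bsub>G\<^esub>)"

definition finite_generating_set :: "('a, 'b) monoid_scheme \<Rightarrow> 'a set \<Rightarrow> bool" where
  "finite_generating_set G S \<longleftrightarrow> finite S \<and> S \<subseteq> carrier G \<and> generate G S = carrier G"

definition word_ball :: "('a, 'b) monoid_scheme \<Rightarrow> 'a set \<Rightarrow> nat \<Rightarrow> 'a set" where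
  "word_ball G S n = {h \<in> carrier G. word_length G S h \<le> n}"

definition subexponential_growth :: "('a, 'b) monoid_scheme \<Rightarrow> bool" where
  "subexponential_growth G \<longleftrightarrow> (\<exists>S. finite_generating_set G S \<and>
     (\<lambda>n. real (card (word_ball G S n)) powr (1 / real n)) \<longlonglongrightarrow> 1)"

section \<open>Free products\<close>

text \<open>
  The free product is realised on reduced words.  A letter \<open>(i, a)\<close> stands for the
  element \<open>a\<close> of the factor \<open>G i\<close>; the empty word is the neutral element, and the
  type size of an element is its length as a list.
\<close>

definition reduced_word :: "'i set \<Rightarrow> ('i \<Rightarrow> ('a, 'b) monoid_scheme) \<Rightarrow> ('i \<times> 'a) list \<Rightarrow> bool" where
  "reduced_word I G w \<longleftrightarrow>
     (\<forall>(i, a) \<in> set w. i \<in> I \<and> a \<in> carrier (G i) - {\<one>\<^bsub>G i\<^esub>}) \<and> distinct_adj (map fst w)"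

text \<open>Left multiplication of a reduced word by one letter, whose group element may be trivial.\<close>

fun letter_mult :: "('i \<Rightarrow> ('a, 'b) monoid_scheme) \<Rightarrow> 'i \<times> 'a \<Rightarrow> ('i \<times> 'a) list \<Rightarrow> ('i \<times> 'a) list" where
  "letter_mult G (i, a) [] = (if a = \<one>\<^bsub>G i\<^esub> then [] else [(i, a)])"
| "letter_mult G (i, a) ((j, b) # w) =
     (if a = \<one>\<^bsub>G i\<^esub> then (j, b) # w
      else if i \<noteq> j then (i, a) # (j, b) # w
      else if a \<otimes>\<^bsub>G i\<^esub> b = \<one>\<^bsub>G i\<^esub> then w
      else (i, a \<otimes>\<^bsub>G i\<^esub> b) # w)"

definition free_product :: "'i set \<Rightarrow> ('i \<Rightarrow> ('a, 'b) monoid_scheme) \<Rightarrow> ('i \<times> 'a) list monoid" where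
  "free_product I G =
     \<lparr>carrier = {w. reduced_word I G w}, mult = (\<lambda>u v. foldr (letter_mult G) u v), one = []\<rparr>"

text \<open>The copy in the free product of an element of a factor.\<close>

definition factor_embed :: "('i \<Rightarrow> ('a, 'b) monoid_scheme) \<Rightarrow> 'i \<Rightarrow> 'a \<Rightarrow> ('i \<times> 'a) list" where
  "factor_embed G i a = (if a = \<one>\<^bsub>G i\<^esub> then [] else [(i, a)])"

lemma reduced_word_Nil [simp]: "reduced_word I G []"
  by (simp add: reduced_word_def)

lemma reduced_word_Cons:
  "reduced_word I G ((i, a) # w) \<longleftrightarrow>
     i \<in> I \<and> a \<in> carrier (G i) \<and> a \<noteq> \<one>\<^bsub>G i\<^esub> \<and> reduced_word I G w \<and> (w = [] \<or> i \<noteq> fst (hd w))"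
  by (cases w) (auto simp: reduced_word_def)

context
  fixes I :: "'i set" and G :: "'i \<Rightarrow> ('a, 'b) monoid_scheme"
  assumes grp: "\<And>i. i \<in> I \<Longrightarrow> group (G i)"
begin

lemma letter_mult_reduced:
  assumes "i \<in> I" "a \<in> carrier (G i)" "reduced_word I G w"
  shows "reduced_word I G (letter_mult G (i, a) w)"
proof (cases w)
  case Nil
  with assms show ?thesis by (auto simp: reduced_word_Cons)
next
  case (Cons p w')
  obtain j b where "p = (j, b)" by (cases p)
  with Cons assms grp show ?thesis
    by (auto simp: reduced_word_Cons intro: monoid.m_closed[OF group.is_monoid])
qed

lemma letter_mult_one: "letter_mult G (i, \<one>\<^bsub>G i\<^esub>) w = w"
  by (cases "(G, (i, \<one>\<^bsub>G i\<^esub>), w)" rule: letter_mult.cases) auto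

lemma letter_mult_mult:
  assumes i: "i \<in> I" and ab: "a \<in> carrier (G i)" "b \<in> carrier (G i)" and w: "reduced_word I G w"
  shows "letter_mult G (i, a) (letter_mult G (i, b) w) = letter_mult G (i, a \<otimes>\<^bsub>G i\<^esub> b) w"
proof -
  interpret group "G i" using grp i .
  show ?thesis
  proof (cases w)
    case Nil
    with ab show ?thesis by auto
  next
    case (Cons p w')
    obtain j c where p: "p = (j, c)" by (cases p)
    show ?thesis
    proof (cases "i = j")
      case False
      with ab Cons p show ?thesis by auto
    next
      case True
      with p have p: "p = (i, c)" by simp
      have c: "c \<in> carrier (G i)" "c \<noteq> \<one>\<^bsub>G i\<^esub>" and w': "w' = [] \<or> i \<noteq> fst (hd w')"
        using w Cons p by (auto simp: reduced_word_Cons)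
      have *: "letter_mult G (i, a) w' = (if a = \<one>\<^bsub>G i\<^esub> then w' else (i, a) # w')"
        using w' by (cases w') auto
      have **: "letter_mult G (i, d) w = (if d \<otimes>\<^bsub>G i\<^esub> c = \<one>\<^bsub>G i\<^esub> then w' else (i, d \<otimes>\<^bsub>G i\<^esub> c) # w')"
        if "d \<in> carrier (G i)" for d
        using Cons p c that by auto
      have ***: "letter_mult G (i, a) ((i, e) # w') =
          (if a \<otimes>\<^bsub>G i\<^esub> e = \<one>\<^bsub>G i\<^esub> then w' else (i, a \<otimes>\<^bsub>G i\<^esub> e) # w')"
        if "e \<in> carrier (G i)" "e \<noteq> \<one>\<^bsub>G i\<^esub>" for e
        using that by auto
      have abc: "a \<otimes>\<^bsub>G i\<^esub> b \<otimes>\<^bsub>G i\<^esub> c = a \<otimes>\<^bsub>G i\<^esub> (b \<otimes>\<^bsub>G i\<^esub> c)"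
        using ab c by (simp add: m_assoc)
      show ?thesis
      proof (cases "b \<otimes>\<^bsub>G i\<^esub> c = \<one>\<^bsub>G i\<^esub>")
        case True
        then show ?thesis using ab abc * **[of b] **[of "a \<otimes>\<^bsub>G i\<^esub> b"] by simp
      next
        case False
        then show ?thesis
          using ab c abc **[of b] **[of "a \<otimes>\<^bsub>G i\<^esub> b"] ***[of "b \<otimes>\<^bsub>G i\<^esub> c"] by simp
      qed
    qed
  qed
qed

lemma foldr_letter_mult_reduced:
  "reduced_word I G u \<Longrightarrow> reduced_word I G v \<Longrightarrow> reduced_word I G (foldr (letter_mult G) u v)"
  by (induction u) (auto simp: reduced_word_Cons letter_mult_reduced)

lemma letter_mult_assoc:
  assumes "i \<in> I" "a \<in> carrier (G i)" "reduced_word I G u" "reduced_word I G v"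
  shows "foldr (letter_mult G) (letter_mult G (i, a) u) v = letter_mult G (i, a) (foldr (letter_mult G) u v)"
proof (cases u)
  case Nil
  then show ?thesis by (simp add: letter_mult_one)
next
  case (Cons p u')
  obtain j b where p: "p = (j, b)" by (cases p)
  have b: "b \<in> carrier (G j)" and u': "reduced_word I G u'"
    using Cons p assms by (auto simp: reduced_word_Cons)
  have r: "reduced_word I G (foldr (letter_mult G) u' v)"
    using u' assms by (intro foldr_letter_mult_reduced)
  show ?thesis
  proof (cases "i = j")
    case False
    with Cons p show ?thesis by (simp add: letter_mult_one)
  next
    case True
    have "letter_mult G (i, a) (foldr (letter_mult G) u v)
        = letter_mult G (i, a \<otimes>\<^bsub>G i\<^esub> b) (foldr (letter_mult G) u' v)"
      using Cons p True letter_mult_mult[OF assms(1,2) _ r] b by simp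
    then show ?thesis
      using Cons p True by (auto simp: letter_mult_one)
  qed
qed

lemma group_free_product: "group (free_product I G)"
proof (rule groupI)
  show "x \<otimes>\<^bsub>free_product I G\<^esub> y \<in> carrier (free_product I G)"
    if "x \<in> carrier (free_product I G)" "y \<in> carrier (free_product I G)" for x y
    using that by (simp add: free_product_def foldr_letter_mult_reduced)
  show "\<one>\<^bsub>free_product I G\<^esub> \<in> carrier (free_product I G)"
    by (simp add: free_product_def)
  show "\<one>\<^bsub>free_product I G\<^esub> \<otimes>\<^bsub>free_product I G\<^esub> x = x" for x
    by (simp add: free_product_def)
  have assoc: "foldr (letter_mult G) (foldr (letter_mult G) x y) z
      = foldr (letter_mult G) x (foldr (letter_mult G) y z)"
    if "reduced_word I G x" "reduced_word I G y" "reduced_word I G z" for x y z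
    using that
    by (induction x) (auto simp: reduced_word_Cons letter_mult_assoc foldr_letter_mult_reduced)
  then show "x \<otimes>\<^bsub>free_product I G\<^esub> y \<otimes>\<^bsub>free_product I G\<^esub> z
      = x \<otimes>\<^bsub>free_product I G\<^esub> (y \<otimes>\<^bsub>free_product I G\<^esub> z)"
    if "x \<in> carrier (free_product I G)" "y \<in> carrier (free_product I G)"
      "z \<in> carrier (free_product I G)" for x y z
    using that by (simp add: free_product_def)
  have "\<exists>y. reduced_word I G y \<and> foldr (letter_mult G) y x = []" if "reduced_word I G x" for x
    using that
  proof (induction x)
    case Nil
    then show ?case by (intro exI[of _ "[]"]) simp
  next
    case (Cons p x)
    obtain i a where p: "p = (i, a)" by (cases p)
    have a: "i \<in> I" "a \<in> carrier (G i)" "a \<noteq> \<one>\<^bsub>G i\<^esub>" and x: "reduced_word I G x"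
      using Cons.prems p by (auto simp: reduced_word_Cons)
    interpret group "G i" using grp a(1) .
    obtain y where y: "reduced_word I G y" "foldr (letter_mult G) y x = []"
      using Cons.IH x by blast
    have s: "reduced_word I G [(i, inv\<^bsub>G i\<^esub> a)]"
      using a by (simp add: reduced_word_Cons)
    have "foldr (letter_mult G) (foldr (letter_mult G) y [(i, inv\<^bsub>G i\<^esub> a)]) (p # x)
        = foldr (letter_mult G) y (letter_mult G (i, inv\<^bsub>G i\<^esub> a) (p # x))"
      using assoc[OF y(1) s Cons.prems] by simp
    also have "letter_mult G (i, inv\<^bsub>G i\<^esub> a) (p # x) = x"
      using a p by simp
    finally show ?case
      using y s foldr_letter_mult_reduced by metis
  qed
  then show "\<exists>y\<in>carrier (free_product I G). y \<otimes>\<^bsub>free_product I G\<^esub> x = \<one>\<^bsub>free_product I G\<^esub>"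
    if "x \<in> carrier (free_product I G)" for x
    using that by (simp add: free_product_def)
qed

lemma factor_embed_hom: "i \<in> I \<Longrightarrow> factor_embed G i \<in> hom (G i) (free_product I G)"
  using grp[of i]
  by (auto simp: hom_def factor_embed_def free_product_def reduced_word_Cons
      group.is_monoid monoid.l_one monoid.r_one)

lemma reduced_word_eq_product:
  "reduced_word I G w \<Longrightarrow>
     foldr (\<lambda>(i, a) h. factor_embed G i a \<otimes>\<^bsub>free_product I G\<^esub> h) w \<one>\<^bsub>free_product I G\<^esub> = w"
proof (induction w)
  case (Cons p w)
  obtain i a where "p = (i, a)" by (cases p)
  with Cons show ?case
    by (cases w) (auto simp: reduced_word_Cons free_product_def factor_embed_def)
qed (simp add: free_product_def)

end

section \<open>Patterns and semigroups\<close>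

definition starts_with :: "('i \<times> 'a) list \<Rightarrow> ('i \<times> 'a) list \<Rightarrow> bool" where
  "starts_with g \<omega> \<longleftrightarrow>
     (let q = min (length \<omega>) (length g div 2) in take q g = take q \<omega>)"

text \<open>
  The terminal segment of \<open>g\<close> is compared with the inverse of the initial segment of
  \<open>\<omega>\<close> of the same length, not with an initial segment of the inverse of \<open>\<omega>\<close>.
\<close>

definition ends_with_inverse ::
    "('i \<Rightarrow> ('a, 'b) monoid_scheme) \<Rightarrow> ('i \<times> 'a) list \<Rightarrow> ('i \<times> 'a) list \<Rightarrow> bool" where
  "ends_with_inverse G g \<omega> \<longleftrightarrow>
     (let q = min (length \<omega>) (length g div 2)
      in drop (length g - q) g = map (\<lambda>(i, a). (i, inv\<^bsub>G i\<^esub> a)) (rev (take q \<omega>)))"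

definition pattern_avoiding ::
    "'i set \<Rightarrow> ('i \<Rightarrow> ('a, 'b) monoid_scheme) \<Rightarrow> ('i \<times> 'a) list set \<Rightarrow> bool" where
  "pattern_avoiding I G T \<longleftrightarrow> T \<subseteq> carrier (free_product I G) \<and>
     (\<exists>D>0. \<forall>\<omega>. reduced_word I G \<omega> \<and> length \<omega> = D \<longrightarrow>
        (\<exists>g\<in>T. length g \<ge> 2 \<and> \<not> starts_with g \<omega> \<and> \<not> ends_with_inverse G g \<omega>))"

inductive_set generated_semigroup :: "('a, 'b) monoid_scheme \<Rightarrow> 'a set \<Rightarrow> 'a set"
  for G :: "('a, 'b) monoid_scheme" and A :: "'a set" where
  incl: "a \<in> A \<Longrightarrow> a \<in> generated_semigroup G A"
| mult: "a \<in> generated_semigroup G A \<Longrightarrow> b \<in> generated_semigroup G A \<Longrightarrow>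
    a \<otimes>\<^bsub>G\<^esub> b \<in> generated_semigroup G A"

section \<open>Random walks\<close>

primrec right_walk :: "('a, 'b) monoid_scheme \<Rightarrow> (nat \<Rightarrow> 'w \<Rightarrow> 'a) \<Rightarrow> nat \<Rightarrow> 'w \<Rightarrow> 'a" where
  "right_walk G \<xi> 0 \<omega> = \<one>\<^bsub>G\<^esub>"
| "right_walk G \<xi> (Suc n) \<omega> = right_walk G \<xi> n \<omega> \<otimes>\<^bsub>G\<^esub> \<xi> (Suc n) \<omega>"

section \<open>Large deviations\<close>

definition ext_log :: "ennreal \<Rightarrow> ereal" where
  "ext_log x = (if x = 0 then -\<infinity> else if x = \<infinity> then \<infinity> else ereal (ln (enn2real x)))"

definition rate_function :: "'x topology \<Rightarrow> ('x \<Rightarrow> ereal) \<Rightarrow> bool" where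
  "rate_function T I \<longleftrightarrow> (\<forall>x\<in>topspace T. 0 \<le> I x) \<and>
     (\<forall>\<alpha>. openin T {x \<in> topspace T. \<alpha> < I x})"

definition proper_rate_function :: "'x topology \<Rightarrow> ('x \<Rightarrow> ereal) \<Rightarrow> bool" where
  "proper_rate_function T I \<longleftrightarrow>
     (\<forall>\<alpha>::real. 0 \<le> \<alpha> \<longrightarrow> compactin T {x \<in> topspace T. I x \<le> ereal \<alpha>})"

text \<open>
  Logarithmic rates of decay of the laws of \<open>Z n\<close>, for \<open>n \<rightarrow> \<infinity>\<close>; the value at
  \<open>n = 0\<close> is irrelevant.
\<close>

definition log_rate :: "'w measure \<Rightarrow> (nat \<Rightarrow> 'w \<Rightarrow> 'x) \<Rightarrow> 'x set \<Rightarrow> nat \<Rightarrow> ereal" where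
  "log_rate M Z A n = ereal (1 / real n) * ext_log (emeasure M {\<omega> \<in> space M. Z n \<omega> \<in> A})"

definition full_LDP ::
    "'w measure \<Rightarrow> 'x topology \<Rightarrow> (nat \<Rightarrow> 'w \<Rightarrow> 'x) \<Rightarrow> ('x \<Rightarrow> ereal) \<Rightarrow> bool" where
  "full_LDP M T Z I \<longleftrightarrow> rate_function T I \<and>
     (\<forall>V. openin T V \<longrightarrow> liminf (log_rate M Z V) \<ge> - (INF x\<in>V. I x)) \<and>
     (\<forall>F. closedin T F \<longrightarrow> limsup (log_rate M Z F) \<le> - (INF x\<in>F. I x))"

definition weak_LDP ::
    "'w measure \<Rightarrow> 'x topology \<Rightarrow> (nat \<Rightarrow> 'w \<Rightarrow> 'x) \<Rightarrow> ('x \<Rightarrow> ereal) \<Rightarrow> bool" where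
  "weak_LDP M T Z I \<longleftrightarrow> rate_function T I \<and>
     (\<forall>V. openin T V \<longrightarrow> liminf (log_rate M Z V) \<ge> - (INF x\<in>V. I x)) \<and>
     (\<forall>K. compactin T K \<longrightarrow> limsup (log_rate M Z K) \<le> - (INF x\<in>K. I x))"

definition ext_convex_on :: "'x::real_vector set \<Rightarrow> ('x \<Rightarrow> ereal) \<Rightarrow> bool" where
  "ext_convex_on A I \<longleftrightarrow> convex A \<and> (\<forall>x\<in>A. \<forall>y\<in>A. \<forall>t::real. 0 \<le> t \<and> t \<le> 1 \<longrightarrow>
     I ((1 - t) *\<^sub>R x + t *\<^sub>R y) \<le> ereal (1 - t) * I x + ereal t * I y)"

definition exponential_moment :: "'g measure \<Rightarrow> ('g \<Rightarrow> nat) \<Rightarrow> real \<Rightarrow> ennreal" where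
  "exponential_moment \<mu> len \<tau> = (\<integral>\<^sup>+ g. ennreal (exp (\<tau> * real (len g))) \<partial>\<mu>)"

definition limiting_log_mgf :: "'w measure \<Rightarrow> (nat \<Rightarrow> 'w \<Rightarrow> nat) \<Rightarrow> real \<Rightarrow> ereal" where
  "limiting_log_mgf M L z =
     limsup (\<lambda>n. ereal (1 / real n) * ext_log (\<integral>\<^sup>+ \<omega>. ennreal (exp (z * real (L n \<omega>))) \<partial>M))"

end

theory Submission
  imports Defs "HOL-Library.Sublist"
begin

text \<open>
  If there were no cancellation between the first \<open>m\<close> and the following \<open>n\<close> increments, word
  lengths would add, and the probability that \<open>len (Y (m + n))\<close> lies in \<open>A + B\<close> would be at
  least the product of the probabilities that \<open>len (Y m)\<close> lies in \<open>A\<close> and \<open>len (Y n)\<close> in \<open>B\<close>.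
  Such a supermultiplicative inequality yields a convex rate function in the manner of Fekete
  and Cramer. The proof shows that cancellation spoils the inequality only by constants.

  The group theoretic core is \<open>finite_separating_set\<close>: the semigroup generated by the support
  contains a finite set \<open>F\<close> such that for all \<open>g\<close> and \<open>h\<close> some \<open>k\<close> in \<open>F\<close> can be inserted with
  \<open>len (g k h) = len g + len h\<close> up to a bounded error. The pattern condition gives, for each single
  pattern, an element that is absorbed by it on neither side. By a compactness argument on
  the tree of reduced words finitely many elements suffice for all patterns
  (\<open>finite_escaping_subset\<close>), and for two different patterns, given by the end of \<open>g\<close> and the
  beginning of \<open>h\<close>, one of the two corresponding elements or their product is good.

  The walk visits each \<open>k\<close> in \<open>F\<close> with positive probability after some time. Sorting pairs
  \<open>(g, h)\<close> by their separating element therefore gives, with constants \<open>a\<close>, \<open>C\<close> and \<open>c > 0\<close>, that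
  \<open>len (Y (m + n + a))\<close> is within \<open>C\<close> of \<open>A + B\<close> with probability at least \<open>c\<close> times the product
  of the two probabilities (\<open>walk_length_almost_superconvolutive\<close>).

  The rest is about sequences of laws on the natural numbers with this property. Repeating a
  cheap walk shows that a speed which is cheap at infinitely many times is cheap at all
  large times (\<open>attainedI_frequently\<close>), so that upper and lower local rates coincide. This is
  the weak large deviation principle; concatenating walks of different speeds gives
  convexity (\<open>rate_convex\<close>). An exponential moment makes the laws exponentially tight, which
  gives properness and the upper bound for closed sets. If all exponential moments are finite,
  the Laplace upper bound holds for every tilt, and together with supporting lines of the
  convex lower semicontinuous rate (\<open>rate_supporting_line\<close>) it identifies the rate with the
  Legendre transform of the limiting logarithmic moment generating function.
\<close>

section \<open>Exponential rates\<close>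

lemma eventually_le_linear:
  fixes q r :: real
  assumes "r > 0"
  shows "\<forall>\<^sub>F n in sequentially. q \<le> r * real n"
proof -
  obtain N :: nat where N: "q / r \<le> real N" using real_arch_simple by blast
  show ?thesis
  proof (rule eventually_sequentiallyI)
    fix n assume "N \<le> n"
    then have "q / r \<le> real n" using N by linarith
    then show "q \<le> r * real n" using assms by (simp add: field_simps)
  qed
qed

lemma ext_log_mono: "x \<le> y \<Longrightarrow> ext_log x \<le> ext_log y"
proof (cases "x = 0 \<or> y = \<infinity>")
  case True
  then show "x \<le> y \<Longrightarrow> ext_log x \<le> ext_log y" by (auto simp: ext_log_def top_unique)
next
  case False
  assume le: "x \<le> y"
  have "enn2real x > 0" using False le
    by (auto simp: enn2real_positive_iff zero_less_iff_neq_zero less_top intro: le_less_trans)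
  moreover have "enn2real x \<le> enn2real y"
    using False le by (simp add: enn2real_mono top.not_eq_extremum)
  ultimately show ?thesis using False le by (auto simp: ext_log_def top_unique)
qed

lemma ext_log_exp [simp]: "ext_log (ennreal (exp t)) = ereal t"
  by (simp add: ext_log_def)

definition exp_rate :: "(nat \<Rightarrow> ennreal) \<Rightarrow> nat \<Rightarrow> ereal" where
  "exp_rate x n = ereal (1 / real n) * ext_log (x n)"

lemma exp_rate_le:
  assumes "n > 0" "x n \<le> ennreal (exp (real n * t))"
  shows "exp_rate x n \<le> ereal t"
proof -
  have "exp_rate x n \<le> ereal (1 / real n) * ereal (real n * t)"
    unfolding exp_rate_def using ext_log_mono[OF assms(2)] by (intro ereal_mult_left_mono) auto
  then show ?thesis using assms(1) by simp
qed

lemma exp_rate_ge: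
  assumes "n > 0" "ennreal (exp (real n * t)) \<le> x n"
  shows "ereal t \<le> exp_rate x n"
proof -
  have "ereal (1 / real n) * ereal (real n * t) \<le> exp_rate x n"
    unfolding exp_rate_def using ext_log_mono[OF assms(2)] by (intro ereal_mult_left_mono) auto
  then show ?thesis using assms(1) by simp
qed

text \<open>
  A constant factor disappears in the exponential rate. This is what allows a compact set to be
  covered by finitely many balls in the upper bounds below.
\<close>

lemma limsup_exp_rate_le:
  assumes "\<forall>\<^sub>F n in sequentially. x n \<le> ennreal (m * exp (real n * t))"
  shows "limsup (exp_rate x) \<le> ereal t"
proof (rule ereal_le_epsilon2)
  fix e :: real assume e: "e > 0"
  define m' where "m' = max m 1"
  have "\<forall>\<^sub>F n in sequentially. exp_rate x n \<le> ereal (t + e)"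
    using assms eventually_le_linear[OF e, of "ln m'"] eventually_gt_at_top[of 0]
  proof eventually_elim
    case (elim n)
    have "m * exp (real n * t) \<le> m' * exp (real n * t)" by (simp add: m'_def)
    also have "m' = exp (ln m')" by (simp add: m'_def)
    also have "\<dots> * exp (real n * t) \<le> exp (real n * (t + e))"
      using elim(2) unfolding mult_exp_exp by (simp add: algebra_simps)
    finally show ?case using elim by (intro exp_rate_le) (auto intro: order_trans ennreal_leI)
  qed
  then show "limsup (exp_rate x) \<le> ereal t + ereal e" by (simp add: Limsup_bounded)
qed

lemma liminf_exp_rate_ge:
  assumes "\<forall>\<^sub>F n in sequentially. ennreal (exp (real n * t)) \<le> x n"
  shows "ereal t \<le> liminf (exp_rate x)"
proof (rule Liminf_bounded)
  show "\<forall>\<^sub>F n in sequentially. ereal t \<le> exp_rate x n"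
    using assms eventually_gt_at_top[of 0] by eventually_elim (rule exp_rate_ge)
qed

section \<open>The rate function of an almost superconvolutive sequence\<close>

lemma pmf_nat_tight: "\<exists>R. measure_pmf.prob (p :: nat pmf) {k. real k \<le> R} \<ge> 1 / 2"
proof -
  have "(\<lambda>i. measure_pmf.prob p {..i}) \<longlonglongrightarrow> measure_pmf.prob p (\<Union>i. {..i})"
    by (rule measure_pmf.finite_Lim_measure_incseq) (auto simp: incseq_def)
  moreover have "(\<Union>i::nat. {..i}) = UNIV" by auto
  ultimately have "(\<lambda>i. measure_pmf.prob p {..i}) \<longlonglongrightarrow> 1" by simp
  then have "\<forall>\<^sub>F i in sequentially. 1/2 < measure_pmf.prob p {..i}"
    by (rule order_tendstoD) simp
  then obtain i where "1/2 < measure_pmf.prob p {..i}"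
    by (auto simp: eventually_sequentially)
  moreover have "{..i} = {k. real k \<le> real i}" by auto
  ultimately show ?thesis by (intro exI[of _ "real i"]) simp
qed

text \<open>
  For \<open>a = 0\<close>, \<open>C = 0\<close>, \<open>c = 1\<close> the inequality holds for the laws of sums of independent
  variables. The three constants measure by how much \<open>Q (m + n + a)\<close> may fall short of
  a convolution: a bounded delay, a bounded error in the position and a bounded loss
  of mass. All three are negligible on the exponential scale, so that existence and
  convexity of a rate function follow as in Cramer's theorem.
\<close>

locale almost_superconvolutive =
  fixes Q :: "nat \<Rightarrow> nat pmf" and a :: nat and C c :: real
  assumes c_pos: "c > 0"
    and superconv: "\<And>m n A B. c * measure_pmf.prob (Q m) A * measure_pmf.prob (Q n) B
      \<le> measure_pmf.prob (Q (m + n + a)) {k. \<exists>u\<in>A. \<exists>v\<in>B. \<bar>real k - (real u + real v)\<bar> \<le> C}"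
begin

definition ball_prob :: "real \<Rightarrow> real \<Rightarrow> nat \<Rightarrow> real" where
  "ball_prob x e n = measure_pmf.prob (Q n) {k. \<bar>real k / real n - x\<bar> < e}"

text \<open>
  The speed \<open>x\<close> has exponential cost at most \<open>s\<close>, along all large times. The rate at \<open>x\<close>
  is the infimum of such \<open>s\<close>; by \<open>attainedI_frequently\<close> it would not change if
  infinitely many times were enough.
\<close>

definition attained :: "real \<Rightarrow> real \<Rightarrow> bool" where
  "attained x s \<longleftrightarrow> (\<forall>e>0. \<forall>\<^sub>F n in sequentially. exp (- (real n * s)) \<le> ball_prob x e n)"

definition rate :: "real \<Rightarrow> ereal" where
  "rate x = Inf (ereal ` {s. attained x s})"

lemma ball_prob_le_1: "ball_prob x e n \<le> 1"
  by (simp add: ball_prob_def)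

lemma ball_prob_mono:
  "\<bar>x - y\<bar> + e \<le> e' \<Longrightarrow> ball_prob x e n \<le> ball_prob y e' n"
  unfolding ball_prob_def by (intro measure_pmf.finite_measure_mono) auto

lemma frequently_nonneg:
  assumes "\<exists>\<^sub>F n in sequentially. exp (- (real n * s)) \<le> ball_prob x e n"
  shows "s \<ge> 0"
proof -
  have "\<exists>\<^sub>F n in sequentially. n > 0 \<and> exp (- (real n * s)) \<le> ball_prob x e n"
    by (rule frequently_mp[OF _ assms])
      (use eventually_gt_at_top[of 0] in eventually_elim, simp)
  then obtain n where n: "n > 0" "exp (- (real n * s)) \<le> ball_prob x e n"
    by (auto dest: frequently_ex)
  then have "exp (- (real n * s)) \<le> 1" using ball_prob_le_1 order_trans by blast
  then show ?thesis using n(1) by (simp add: zero_le_mult_iff)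
qed

lemma attained_nonneg: "attained x s \<Longrightarrow> s \<ge> 0"
  using frequently_nonneg[of s x 1] by (simp add: attained_def eventually_frequently)

text \<open>
  Walking \<open>j\<close> times to distance about \<open>t\<close>, each time paying \<open>c\<close> and the delay \<open>a\<close>, costs the
  \<open>j\<close>-th power of one such walk. The remainder \<open>b\<close>, needed to reach times that are not
  multiples of \<open>n0 + a\<close>, enters through the start of the induction, where the walk stays
  below \<open>R\<close> with probability at least one half.
\<close>

lemma iterate_superconv:
  assumes A: "\<And>k. k \<in> A \<Longrightarrow> \<bar>real k - t\<bar> \<le> w" and n0: "n0 > 0"
    and R: "\<And>b. b < n0 + a \<Longrightarrow> 1 / 2 \<le> measure_pmf.prob (Q b) {k. real k \<le> R}"
    and b: "b < n0 + a"
  shows "(c * measure_pmf.prob (Q n0) A) ^ j / 2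
    \<le> measure_pmf.prob (Q ((n0 + a) * j + b)) {k. \<bar>real k - real j * t\<bar> \<le> real j * (w + C) + R}"
proof (induction j)
  case 0
  have "{k. real k \<le> R} \<subseteq> {k. \<bar>real k - real 0 * t\<bar> \<le> real 0 * (w + C) + R}" by auto
  then show ?case using R[OF b] by simp
next
  case (Suc j)
  let ?U = "{k. \<bar>real k - real j * t\<bar> \<le> real j * (w + C) + R}"
  let ?m = "(n0 + a) * j + b"
  let ?p = "measure_pmf.prob (Q n0) A"
  have "(c * ?p) ^ Suc j / 2 = c * ((c * ?p) ^ j / 2) * ?p" by simp
  also have "\<dots> \<le> c * measure_pmf.prob (Q ?m) ?U * ?p"
    using Suc.IH c_pos by (intro mult_right_mono mult_left_mono) auto
  also have "\<dots> \<le> measure_pmf.prob (Q (?m + n0 + a))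
      {k. \<exists>u\<in>?U. \<exists>v\<in>A. \<bar>real k - (real u + real v)\<bar> \<le> C}"
    by (rule superconv)
  also have "\<dots> \<le> measure_pmf.prob (Q (?m + n0 + a))
      {k. \<bar>real k - real (Suc j) * t\<bar> \<le> real (Suc j) * (w + C) + R}"
  proof (intro measure_pmf.finite_measure_mono subsetI, goal_cases)
    case (1 k)
    then obtain u v where uv: "u \<in> ?U" "v \<in> A" "\<bar>real k - (real u + real v)\<bar> \<le> C" by auto
    then show ?case using A[OF uv(2)] by (auto simp: algebra_simps abs_le_iff)
  qed simp
  also have "?m + n0 + a = (n0 + a) * Suc j + b" by simp
  finally show ?case .
qed

text \<open>
  The analogue of Fekete's lemma, and the reason why a limit exists: one time \<open>n0\<close> at which
  the speed \<open>x\<close> is cheap is enough to make it cheap at all later times, by repeating the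
  walk of length \<open>n0\<close>. The time \<open>n0\<close> has to be so large that the constants of the locale are
  negligible per unit of time, which infinitely many candidates provide.
\<close>

lemma attainedI_frequently:
  assumes x: "x \<ge> 0" and ss: "s < s'"
    and freq: "\<And>e. e > 0 \<Longrightarrow> \<exists>\<^sub>F n in sequentially. exp (- (real n * s)) \<le> ball_prob x e n"
  shows "attained x s'"
  unfolding attained_def
proof (intro allI impI)
  fix e :: real assume e: "e > 0"
  define \<delta> where "\<delta> = s' - s"
  have \<delta>: "\<delta> > 0" using ss by (simp add: \<delta>_def)
  have s: "s \<ge> 0" using frequently_nonneg freq[of 1] by auto
  have e4: "e / 4 > 0" and \<delta>2: "\<delta> / 2 > 0" using e \<delta> by auto
  \<comment> \<open>One block of length \<open>n0\<close> has spatial error \<open>C + x * a\<close> (imprecision and delay) and loses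
    the factor \<open>c\<close>; both are to be small against \<open>n0\<close>.\<close>
  have "\<exists>\<^sub>F n in sequentially. exp (- (real n * s)) \<le> ball_prob x (e/4) n \<and>
     (C + x * real a \<le> e / 4 * real n \<and> - ln c \<le> \<delta> / 2 * real n \<and> n > 0)"
  proof (rule frequently_mp[OF _ freq[OF e4]])
    show "\<forall>\<^sub>F n in sequentially. exp (- (real n * s)) \<le> ball_prob x (e/4) n \<longrightarrow>
      exp (- (real n * s)) \<le> ball_prob x (e/4) n \<and>
      (C + x * real a \<le> e / 4 * real n \<and> - ln c \<le> \<delta> / 2 * real n \<and> n > 0)"
      using eventually_le_linear[OF e4, of "C + x * real a"] eventually_le_linear[OF \<delta>2, of "- ln c"]
        eventually_gt_at_top[of 0]
      by eventually_elim simp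
  qed
  then obtain n0 where n0: "exp (- (real n0 * s)) \<le> ball_prob x (e/4) n0"
     "C + x * real a \<le> e / 4 * real n0" "- ln c \<le> \<delta> / 2 * real n0" "n0 > 0"
    by (auto dest: frequently_ex)
  define A where "A = {k. \<bar>real k / real n0 - x\<bar> < e/4}"
  define t where "t = real n0 * x"
  define w where "w = real n0 * (e/4)"
  define p where "p = measure_pmf.prob (Q n0) A"
  have p: "p \<ge> exp (- (real n0 * s))" using n0(1) by (simp add: ball_prob_def p_def A_def)
  have A: "\<bar>real k - t\<bar> \<le> w" if "k \<in> A" for k
  proof -
    have "\<bar>real k / real n0 - x\<bar> * real n0 \<le> e / 4 * real n0"
      using that by (intro mult_right_mono) (auto simp: A_def)
    also have "\<bar>real k / real n0 - x\<bar> * real n0 = \<bar>(real k / real n0 - x) * real n0\<bar>"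
      by (simp add: abs_mult)
    also have "(real k / real n0 - x) * real n0 = real k - t"
      using n0(4) by (simp add: t_def algebra_simps)
    finally show ?thesis by (simp add: w_def mult.commute)
  qed
  define d where "d = n0 + a"
  have "\<exists>R. \<forall>b. measure_pmf.prob (Q b) {k. real k \<le> R b} \<ge> 1 / 2"
    by (rule choice, rule allI, rule pmf_nat_tight)
  then obtain Rb where Rb: "\<And>b. measure_pmf.prob (Q b) {k. real k \<le> Rb b} \<ge> 1 / 2" by blast
  define R where "R = Max (Rb ` {..<d})"
  have R: "1 / 2 \<le> measure_pmf.prob (Q b) {k. real k \<le> R}" if "b < n0 + a" for b
  proof -
    have "Rb b \<le> R" using that by (auto simp: R_def d_def)
    then have "measure_pmf.prob (Q b) {k. real k \<le> Rb b} \<le> measure_pmf.prob (Q b) {k. real k \<le> R}"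
      by (intro measure_pmf.finite_measure_mono) auto
    then show ?thesis using Rb[of b] by linarith
  qed
  show "\<forall>\<^sub>F n in sequentially. exp (- (real n * s')) \<le> ball_prob x e n"
    using eventually_le_linear[OF e4, of "R + real d * x"]
      eventually_le_linear[OF \<delta>2, of "ln 2"] eventually_gt_at_top[of 0]
  proof eventually_elim
    case (elim N)
    \<comment> \<open>Any time \<open>N\<close> consists of \<open>j\<close> blocks and a bounded remainder.\<close>
    define j where "j = N div d"
    define b where "b = N mod d"
    have N: "N = d * j + b" by (simp add: j_def b_def)
    have b: "b < n0 + a" using n0(4) by (simp add: b_def d_def)
    have jn: "real j * real n0 \<le> real N"
      unfolding N d_def by (simp add: algebra_simps)
    have NN: "real N = real j * real n0 + real j * real a + real b"
      unfolding N d_def by (simp add: algebra_simps)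
    have key: "(c * p) ^ j / 2
      \<le> measure_pmf.prob (Q N) {k. \<bar>real k - real j * t\<bar> \<le> real j * (w + C) + R}"
      using iterate_superconv[where j = j, OF A n0(4) R b] unfolding p_def N d_def by simp
    also have "\<dots> \<le> ball_prob x e N"
      unfolding ball_prob_def
    proof (intro measure_pmf.finite_measure_mono subsetI, goal_cases)
      case (1 k)
      then have k: "\<bar>real k - real j * t\<bar> \<le> real j * (w + C) + R" by simp
      have 1: "real N * x - real j * t = x * (real j * real a) + x * real b"
        unfolding NN t_def by (simp add: algebra_simps)
      have 2: "x * real b \<le> real d * x" using x b by (subst mult.commute, intro mult_right_mono) (auto simp: d_def)
      have 3: "0 \<le> x * (real j * real a) + x * real b" using x by simp
      have "\<bar>real k - real N * x\<bar> \<le> \<bar>real k - real j * t\<bar> + \<bar>real N * x - real j * t\<bar>" by linarith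
      also have "\<dots> \<le> real j * (w + C) + R + (x * (real j * real a) + real d * x)"
        using k 1 2 3 by linarith
      also have "\<dots> = real j * (w + (C + x * real a)) + (R + real d * x)"
        by (simp add: algebra_simps)
      also have "\<dots> \<le> real j * (w + e / 4 * real n0) + e / 4 * real N"
        using n0(2) elim(1) by (intro add_mono mult_left_mono) auto
      also have "\<dots> = (real j * real n0) * (e / 2) + e / 4 * real N"
        by (simp add: w_def algebra_simps)
      also have "\<dots> \<le> real N * (e / 2) + e / 4 * real N"
        using jn e by (intro add_right_mono mult_right_mono) auto
      also have "\<dots> < real N * e" using e elim(3) by simp
      finally have *: "\<bar>real k - real N * x\<bar> < real N * e" .
      have "\<bar>real k / real N - x\<bar> = \<bar>real k - real N * x\<bar> / real N"
      proof -
        have "real k / real N - x = (real k - real N * x) / real N"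
          using elim(3) by (simp add: field_simps)
        then show ?thesis by (simp add: abs_divide)
      qed
      also have "\<dots> < e" using * elim(3) by (simp add: field_simps)
      finally show ?case by simp
    qed simp
    finally have upper: "(c * p) ^ j / 2 \<le> ball_prob x e N" .
    have "exp (- (real N * s')) = exp (- (real N * s + \<delta> / 2 * real N)) * exp (- (\<delta> / 2 * real N))"
      by (simp add: \<delta>_def mult_exp_exp field_simps)
    also have "\<dots> \<le> exp (- (real N * s + \<delta> / 2 * real N)) * exp (- ln 2)"
      using elim(2) by (intro mult_left_mono) auto
    also have "\<dots> = exp (- (real N * s + \<delta> / 2 * real N)) / 2" by (simp add: exp_minus)
    also have "exp (- (real N * s + \<delta> / 2 * real N)) \<le> exp (real j * (ln c - real n0 * s))"
    proof -
      have "real j * (real n0 * s - ln c) \<le> real j * (real n0 * s + \<delta> / 2 * real n0)"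
        using n0(3) by (intro mult_left_mono) auto
      also have "\<dots> = (real j * real n0) * (s + \<delta> / 2)" by (simp add: algebra_simps)
      also have "\<dots> \<le> real N * (s + \<delta> / 2)" using jn s \<delta> by (intro mult_right_mono) auto
      finally show ?thesis by (simp add: algebra_simps)
    qed
    also have "exp (real j * (ln c - real n0 * s)) = exp (ln c + - (real n0 * s)) ^ j"
      by (simp add: exp_of_nat_mult)
    also have "\<dots> = (c * exp (- (real n0 * s))) ^ j"
      using c_pos by (simp only: exp_add exp_ln)
    also have "\<dots> \<le> (c * p) ^ j"
      using p c_pos by (intro power_mono mult_left_mono) auto
    finally show ?case using upper by simp
  qed
qed

text \<open>
  Below the rate there is an upper bound on the probability of a ball at all large times,
  not only at infinitely many: this is the form in which \<open>attainedI_frequently\<close> is used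
  in every upper bound.
\<close>

lemma below_rate:
  assumes "x \<ge> 0" "ereal s < rate x"
  shows "\<exists>e>0. \<forall>\<^sub>F n in sequentially. ball_prob x e n < exp (- (real n * s))"
proof (rule ccontr)
  assume neg: "\<not> ?thesis"
  have freq: "\<exists>\<^sub>F n in sequentially. exp (- (real n * s)) \<le> ball_prob x e n" if "e > 0" for e
    using neg that by (auto simp: frequently_def not_le)
  have "rate x \<le> ereal s + ereal d" if "d > 0" for d
    using attainedI_frequently[OF assms(1) _ freq, of "s + d"] that
    unfolding rate_def by (auto intro!: Inf_lower)
  then have "rate x \<le> ereal s" by (rule ereal_le_epsilon2)
  then show False using assms(2) by simp
qed

lemma rate_le: "attained x s \<Longrightarrow> rate x \<le> ereal s"
  unfolding rate_def by (auto intro: Inf_lower)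

lemma rate_geI: "(\<And>s. attained x s \<Longrightarrow> t \<le> ereal s) \<Longrightarrow> t \<le> rate x"
  unfolding rate_def by (auto intro: Inf_greatest)

lemma rate_nonneg: "0 \<le> rate x"
  by (rule rate_geI) (auto dest: attained_nonneg)

lemma rate_lessD: "rate x < t \<Longrightarrow> \<exists>s. attained x s \<and> ereal s < t"
  unfolding rate_def by (auto simp: Inf_less_iff)

text \<open>
  Lower semicontinuity: a ball around \<open>y\<close> inside a ball around \<open>x\<close> inherits the upper bound
  on its probability.
\<close>

lemma rate_ge_near:
  assumes "x \<ge> 0" "ereal s < rate x"
  shows "\<exists>e>0. \<forall>y. \<bar>x - y\<bar> < e \<longrightarrow> ereal s \<le> rate y"
proof -
  obtain e where e: "e > 0" "\<forall>\<^sub>F n in sequentially. ball_prob x e n < exp (- (real n * s))"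
    using below_rate[OF assms] by auto
  show ?thesis
  proof (intro exI[of _ "e / 2"] conjI allI impI)
    fix y assume y: "\<bar>x - y\<bar> < e / 2"
    show "ereal s \<le> rate y"
    proof (rule rate_geI)
      fix t assume t: "attained y t"
      have e2: "e / 2 > 0" using e by simp
      have "\<forall>\<^sub>F n in sequentially. exp (- (real n * t)) \<le> ball_prob y (e/2) n"
        using t e2 unfolding attained_def by blast
      then have "\<forall>\<^sub>F n in sequentially. - (real n * t) < - (real n * s) \<and> n > 0"
        using e(2) eventually_gt_at_top[of 0]
      proof eventually_elim
        case (elim n)
        have "ball_prob y (e/2) n \<le> ball_prob x e n" using y by (intro ball_prob_mono) linarith
        then have "exp (- (real n * t)) < exp (- (real n * s))" using elim by linarith
        then show ?case using elim by simp
      qed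
      then obtain n where "n > 0" "real n * s < real n * t"
        by (auto simp: eventually_sequentially)
      then show "ereal s \<le> ereal t" by simp
    qed
  qed (use e in auto)
qed

lemma rate_function_rate: "rate_function (top_of_set {0..}) rate"
  unfolding rate_function_def
proof (intro conjI ballI allI)
  fix \<alpha> :: ereal
  have "openin (top_of_set {0..}) {x \<in> {0..}. \<alpha> < rate x}"
  proof (rule iffD2[OF openin_euclidean_subtopology_iff], rule conjI, blast, rule ballI)
    fix x assume x: "x \<in> {x \<in> {0..}. \<alpha> < rate x}"
    then have x0: "x \<ge> 0" and "\<alpha> < rate x" by auto
    from ereal_dense2[OF this(2)] obtain s where s: "\<alpha> < ereal s" "ereal s < rate x" by blast
    from rate_ge_near[OF x0 s(2)] obtain e
      where e: "e > 0" "\<forall>y. \<bar>x - y\<bar> < e \<longrightarrow> ereal s \<le> rate y" by blast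
    have "y \<in> {x \<in> {0..}. \<alpha> < rate x}" if "y \<in> {0..}" "dist y x < e" for y
    proof -
      have "ereal s \<le> rate y" using e(2) that(2) by (simp add: dist_real_def abs_minus_commute)
      then show ?thesis using s(1) that(1) by (auto intro: less_le_trans)
    qed
    then show "\<exists>e>0. \<forall>x'\<in>{0..}. dist x' x < e \<longrightarrow> x' \<in> {x \<in> {0..}. \<alpha> < rate x}"
      using e(1) by blast
  qed
  then show "openin (top_of_set {0..}) {x \<in> topspace (top_of_set {0..}). \<alpha> < rate x}"
    by simp
qed (rule rate_nonneg)

text \<open>
  A walk of length about \<open>(1 - t) * n\<close> at speed \<open>x\<close>, followed by one of length about \<open>t * n\<close> at
  speed \<open>y\<close>, has speed about \<open>(1 - t) * x + t * y\<close>, and its cost is at most the corresponding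
  mean of the costs.
\<close>

lemma rate_convex: "ext_convex_on {0..} rate"
  unfolding ext_convex_on_def
proof (intro conjI ballI allI impI)
  fix x y t :: real
  assume x: "x \<in> {0..}" and y: "y \<in> {0..}" and t: "0 \<le> t \<and> t \<le> 1"
  show "rate ((1 - t) *\<^sub>R x + t *\<^sub>R y) \<le> ereal (1 - t) * rate x + ereal t * rate y"
  proof (cases "t = 0 \<or> t = 1")
    case True
    then show ?thesis by (auto simp: zero_ereal_def[symmetric] one_ereal_def[symmetric])
  next
    case False
    then have t: "0 < t" "t < 1" using t by auto
    then have t1: "1 - t > 0" by simp
    define z where "z = (1 - t) * x + t * y"
    have z_rate: "rate z \<le> ereal ((1 - t) * s1 + t * s2)" if s1: "attained x s1" and s2: "attained y s2" for s1 s2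
    proof (rule ereal_le_epsilon2)
      fix \<delta> :: real assume \<delta>: "\<delta> > 0"
      define s where "s = (1 - t) * s1 + t * s2 + \<delta>"
      have nn: "s1 \<ge> 0" "s2 \<ge> 0" using s1 s2 attained_nonneg by auto
      have "attained z s"
        unfolding attained_def
      proof (intro allI impI)
        fix e :: real assume e: "e > 0"
        then have e3: "e / 3 > 0" by simp
        obtain N1 where N1: "\<And>n. n \<ge> N1 \<Longrightarrow> exp (- (real n * s1)) \<le> ball_prob x (e/3) n"
          using s1 e3 unfolding attained_def eventually_sequentially by blast
        obtain N2 where N2: "\<And>n. n \<ge> N2 \<Longrightarrow> exp (- (real n * s2)) \<le> ball_prob y (e/3) n"
          using s2 e3 unfolding attained_def eventually_sequentially by blast
        define E where "E = C + (1 + real a) * (x + y)"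
        have e33: "2 * e / 3 > 0" using e by simp
        show "\<forall>\<^sub>F n in sequentially. exp (- (real n * s)) \<le> ball_prob z e n"
          using eventually_le_linear[OF t1, of "real N1 + 2 + real a"]
            eventually_le_linear[OF t(1), of "real N2 + 2 + real a"]
            eventually_le_linear[OF \<delta>, of "- ln c + s1 + s2"]
            eventually_le_linear[OF e3, of "E"]
            eventually_ge_at_top[of "Suc a"]
        proof eventually_elim
          case (elim N)
          \<comment> \<open>The delay \<open>a\<close> is set aside first; the remaining time is split in the ratio
            \<open>(1 - t) : t\<close> up to rounding.\<close>
          define N' where "N' = N - a"
          define m where "m = nat \<lfloor>(1 - t) * real N'\<rfloor>"
          define n where "n = N' - m"
          have N: "N = N' + a" using elim(5) by (simp add: N'_def)
          have "(1 - t) * real N' \<ge> 0" using t1 by simp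
          then have m_le: "real m \<le> (1 - t) * real N'" and m_ge: "real m > (1 - t) * real N' - 1"
            unfolding m_def by linarith+
          have "(1 - t) * real N' \<le> 1 * real N'" using t by (intro mult_right_mono) auto
          then have mn: "N' = m + n" and "m \<le> N'" using m_le by (simp_all add: n_def)
          then have nr: "real n = real N' - real m" by simp
          have n_ge: "real n \<ge> t * real N'" and n_le: "real n < t * real N' + 1"
            using m_le m_ge unfolding nr by (simp_all add: algebra_simps)
          have ta: "(1 - t) * real a \<le> real a" "t * real a \<le> real a"
            using t by (auto simp: mult_le_cancel_right1 mult_le_cancel_right2)
          have "real N1 + 1 \<le> real m" using elim(1) m_ge ta unfolding N by (simp add: algebra_simps)
          then have m: "m \<ge> N1" "m > 0" by linarith+
          have "real N2 + 1 \<le> real n" using elim(2) n_ge ta unfolding N by (simp add: algebra_simps)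
          then have n: "n \<ge> N2" "n > 0" by linarith+
          let ?A = "{k. \<bar>real k / real m - x\<bar> < e/3}" and ?B = "{k. \<bar>real k / real n - y\<bar> < e/3}"
          have "c * exp (- (real m * s1)) * exp (- (real n * s2)) \<le> c * ball_prob x (e/3) m * ball_prob y (e/3) n"
            using N1[OF m(1)] N2[OF n(1)] c_pos by (intro mult_mono) (auto simp: ball_prob_def)
          also have "\<dots> \<le> measure_pmf.prob (Q (m + n + a)) {k. \<exists>u\<in>?A. \<exists>v\<in>?B. \<bar>real k - (real u + real v)\<bar> \<le> C}"
            unfolding ball_prob_def by (rule superconv)
          also have "m + n + a = N" by (simp add: N mn)
          also have "measure_pmf.prob (Q N) {k. \<exists>u\<in>?A. \<exists>v\<in>?B. \<bar>real k - (real u + real v)\<bar> \<le> C} \<le> ball_prob z e N"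
            unfolding ball_prob_def
          proof (intro measure_pmf.finite_measure_mono subsetI, goal_cases)
            case (1 k)
            then obtain u v where u: "\<bar>real u / real m - x\<bar> < e/3" and v: "\<bar>real v / real n - y\<bar> < e/3"
              and k: "\<bar>real k - (real u + real v)\<bar> \<le> C" by blast
            have u': "\<bar>real u - real m * x\<bar> < real m * (e / 3)"
              using u m(2) by (simp add: field_simps abs_less_iff)
            have v': "\<bar>real v - real n * y\<bar> < real n * (e / 3)"
              using v n(2) by (simp add: field_simps abs_less_iff)
            have "real N * z = (1 - t) * real N * x + t * real N * y"
              by (simp add: z_def algebra_simps)
            then have eq: "real m * x + real n * y - real N * z
                = (real m - (1 - t) * real N) * x + (real n - t * real N) * y"
              by (simp add: algebra_simps)
            have "\<bar>real m - (1 - t) * real N\<bar> \<le> 1 + real a"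
              using m_le m_ge ta t1 unfolding N by (simp add: abs_le_iff algebra_simps)
            then have 1: "\<bar>(real m - (1 - t) * real N) * x\<bar> \<le> (1 + real a) * x"
              using x by (simp add: abs_mult mult_right_mono)
            have "t * real a \<ge> 0" using t by simp
            moreover have "t * real N = t * real N' + t * real a" by (simp add: N algebra_simps)
            ultimately have "\<bar>real n - t * real N\<bar> \<le> 1 + real a"
              using n_le n_ge ta by linarith
            then have 2: "\<bar>(real n - t * real N) * y\<bar> \<le> (1 + real a) * y"
              using y by (simp add: abs_mult mult_right_mono)
            have 3: "real m * (e/3) + real n * (e/3) \<le> real N * (e/3)"
              using e unfolding N mn by (simp add: field_simps)
            have "\<bar>real k - real N * z\<bar> \<le> \<bar>real k - (real u + real v)\<bar> + \<bar>real u - real m * x\<bar>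
                + \<bar>real v - real n * y\<bar> + \<bar>(real m - (1 - t) * real N) * x\<bar> + \<bar>(real n - t * real N) * y\<bar>"
              using eq by linarith
            also have "\<dots> < E + real N * (e/3)"
              using k u' v' 1 2 3 unfolding E_def by (simp add: algebra_simps)
            also have "\<dots> \<le> real N * e"
            proof -
              have "0 \<le> real N * e" using e by simp
              then show ?thesis using elim(4) by (simp add: field_simps)
            qed
            finally have "\<bar>real k - real N * z\<bar> < real N * e" .
            then show ?case
              using elim(5) by (simp add: field_simps abs_less_iff)
          qed simp
          finally have *: "c * exp (- (real m * s1)) * exp (- (real n * s2)) \<le> ball_prob z e N" .
          have "real m * s1 \<le> (1 - t) * real N * s1"
            using order_trans[OF m_le mult_left_mono[of "real N'" "real N" "1 - t"]] t1 nn
            by (intro mult_right_mono) (simp_all add: N)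
          moreover have "real n * s2 \<le> (t * real N + 1) * s2"
            using order_trans[OF less_imp_le[OF n_le] add_right_mono[OF mult_left_mono[of "real N'" "real N" t]]] t nn
            by (intro mult_right_mono) (simp_all add: N)
          ultimately have "- (real N * s) \<le> ln c + (- (real m * s1)) + (- (real n * s2))"
            using elim(3) nn unfolding s_def by (simp add: algebra_simps)
          then have "exp (- (real N * s)) \<le> exp (ln c + (- (real m * s1)) + (- (real n * s2)))" by simp
          also have "\<dots> = c * exp (- (real m * s1)) * exp (- (real n * s2))"
            using c_pos by (simp only: exp_add exp_ln)
          finally show ?case using * by simp
        qed
      qed
      then show "rate z \<le> ereal ((1 - t) * s1 + t * s2) + ereal \<delta>"
        using rate_le unfolding s_def by fastforce
    qed
    have "rate z \<le> ereal (1 - t) * rate x + ereal t * rate y"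
    proof (cases "rate x = \<infinity> \<or> rate y = \<infinity>")
      case True
      then show ?thesis
      proof
        assume "rate x = \<infinity>"
        then show ?thesis using t rate_nonneg[of y] by (cases "rate y") auto
      next
        assume "rate y = \<infinity>"
        then show ?thesis using t rate_nonneg[of x] by (cases "rate x") auto
      qed
    next
      case False
      then obtain rx ry where r: "rate x = ereal rx" "rate y = ereal ry"
        using rate_nonneg[of x] rate_nonneg[of y] by (cases "rate x"; cases "rate y") auto
      show ?thesis
      proof (rule ereal_le_epsilon2)
        fix e :: real assume e: "e > 0"
        obtain s1 where s1: "attained x s1" "s1 < rx + e"
          using rate_lessD[of x "ereal (rx + e)"] r e by auto
        obtain s2 where s2: "attained y s2" "s2 < ry + e"
          using rate_lessD[of y "ereal (ry + e)"] r e by auto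
        have "(1 - t) * s1 + t * s2 \<le> (1 - t) * (rx + e) + t * (ry + e)"
          using s1 s2 t by (intro add_mono mult_left_mono) auto
        then have "rate z \<le> ereal ((1 - t) * (rx + e) + t * (ry + e))"
          using z_rate[OF s1(1) s2(1)] by (meson ereal_less_eq(3) order_trans)
        then show "rate z \<le> ereal (1 - t) * rate x + ereal t * rate y + ereal e"
          using r by (simp add: algebra_simps)
      qed
    qed
    then show ?thesis by (simp add: z_def)
  qed
qed simp

section \<open>Large deviation bounds and the Legendre transform\<close>

definition scaled_prob :: "real set \<Rightarrow> nat \<Rightarrow> ennreal" where
  "scaled_prob A n = emeasure (Q n) {k. real k / real n \<in> A}"

text \<open>
  The exponential moment of \<open>k\<close> on the event that \<open>k / n\<close> lies in \<open>A\<close>. The tilt \<open>z = 0\<close> gives the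
  probability of the event, so that the upper bounds of the large deviation principle and
  the upper bound on the moment generating function are instances of the same lemmas.
\<close>

definition tilted :: "real \<Rightarrow> real set \<Rightarrow> nat \<Rightarrow> ennreal" where
  "tilted z A n = (\<integral>\<^sup>+ k. ennreal (exp (z * real k)) * indicator A (real k / real n) \<partial>Q n)"

lemma scaled_prob_eq_tilted: "scaled_prob A n = tilted 0 A n"
  unfolding scaled_prob_def tilted_def
proof -
  have "emeasure (Q n) {k. real k / real n \<in> A}
      = (\<integral>\<^sup>+ k. indicator {k. real k / real n \<in> A} k \<partial>Q n)" by simp
  also have "\<dots> = (\<integral>\<^sup>+ k. ennreal (exp (0 * real k)) * indicator A (real k / real n) \<partial>Q n)"
    by (intro nn_integral_cong) (auto split: split_indicator)
  finally show "emeasure (Q n) {k. real k / real n \<in> A}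
      = (\<integral>\<^sup>+ k. ennreal (exp (0 * real k)) * indicator A (real k / real n) \<partial>Q n)" .
qed

lemma ball_prob_eq_scaled_prob: "ennreal (ball_prob x e n) = scaled_prob (ball x e) n"
  by (simp add: ball_prob_def scaled_prob_def measure_pmf.emeasure_eq_measure dist_real_def abs_minus_commute)

lemma tilted_mono: "A \<subseteq> B \<Longrightarrow> tilted z A n \<le> tilted z B n"
  unfolding tilted_def by (intro nn_integral_mono mult_left_mono) (auto split: split_indicator)

lemma tilted_Un_le:
  assumes "finite Y" "K \<subseteq> (\<Union>y\<in>Y. B y)"
  shows "tilted z K n \<le> (\<Sum>y\<in>Y. tilted z (B y) n)"
proof -
  have "tilted z K n \<le> (\<integral>\<^sup>+ k. (\<Sum>y\<in>Y. ennreal (exp (z * real k)) * indicator (B y) (real k / real n)) \<partial>Q n)"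
    unfolding tilted_def
  proof (intro nn_integral_mono)
    fix k
    show "ennreal (exp (z * real k)) * indicator K (real k / real n)
      \<le> (\<Sum>y\<in>Y. ennreal (exp (z * real k)) * indicator (B y) (real k / real n))"
    proof (cases "real k / real n \<in> K")
      case True
      then obtain y where y: "y \<in> Y" "real k / real n \<in> B y" using assms(2) by auto
      have "ennreal (exp (z * real k)) * indicator K (real k / real n)
        = ennreal (exp (z * real k)) * indicator (B y) (real k / real n)" using True y by simp
      also have "\<dots> \<le> (\<Sum>y\<in>Y. ennreal (exp (z * real k)) * indicator (B y) (real k / real n))"
        using assms(1) y(1) by (intro member_le_sum) auto
      finally show ?thesis .
    qed simp
  qed
  also have "\<dots> = (\<Sum>y\<in>Y. tilted z (B y) n)"
    unfolding tilted_def by (rule nn_integral_sum) simp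
  finally show ?thesis .
qed

lemma tilted_le_mult:
  assumes "\<And>x. x \<in> A \<Longrightarrow> z * x \<le> u" "n > 0"
  shows "tilted z A n \<le> ennreal (exp (real n * u)) * scaled_prob A n"
proof -
  have "tilted z A n \<le> (\<integral>\<^sup>+ k. ennreal (exp (real n * u)) * indicator A (real k / real n) \<partial>Q n)"
    unfolding tilted_def
  proof (intro nn_integral_mono)
    fix k
    show "ennreal (exp (z * real k)) * indicator A (real k / real n)
      \<le> ennreal (exp (real n * u)) * indicator A (real k / real n)"
      using assms(1)[of "real k / real n"] assms(2)
      by (auto split: split_indicator simp: field_simps intro!: ennreal_leI)
  qed
  also have "\<dots> = ennreal (exp (real n * u)) * scaled_prob A n"
    unfolding scaled_prob_eq_tilted tilted_def by (subst nn_integral_cmult[symmetric]) auto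
  finally show ?thesis .
qed

lemma tilted_ge_mult:
  assumes "\<And>x. x \<in> A \<Longrightarrow> u \<le> z * x" "n > 0"
  shows "ennreal (exp (real n * u)) * scaled_prob A n \<le> tilted z A n"
proof -
  have "ennreal (exp (real n * u)) * scaled_prob A n
      = (\<integral>\<^sup>+ k. ennreal (exp (real n * u)) * indicator A (real k / real n) \<partial>Q n)"
    unfolding scaled_prob_eq_tilted tilted_def by (subst nn_integral_cmult[symmetric]) auto
  also have "\<dots> \<le> tilted z A n"
    unfolding tilted_def
  proof (intro nn_integral_mono)
    fix k
    show "ennreal (exp (real n * u)) * indicator A (real k / real n)
      \<le> ennreal (exp (z * real k)) * indicator A (real k / real n)"
      using assms(1)[of "real k / real n"] assms(2)
      by (auto split: split_indicator simp: field_simps intro!: ennreal_leI)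
  qed
  finally show ?thesis .
qed

text \<open>
  Around each \<open>y\<close> in \<open>K\<close> there is a ball on which the tilt is almost \<open>z * y\<close> and whose probability
  is at most about \<open>exp (- n * rate y)\<close>, so its contribution is at most about
  \<open>exp (n * c0)\<close>. By compactness finitely many balls suffice.
\<close>

lemma tilted_compact_le:
  assumes K: "compact K" "K \<subseteq> {0..}" and le: "\<And>y. y \<in> K \<Longrightarrow> ereal (z * y - c0) \<le> rate y"
    and c: "c0 < c1"
  shows "\<exists>m\<ge>0. \<forall>\<^sub>F n in sequentially. tilted z K n \<le> ennreal (m * exp (real n * c1))"
proof -
  define \<delta> where "\<delta> = (c1 - c0) / 2"
  have \<delta>: "\<delta> > 0" using c by (simp add: \<delta>_def)
  have "\<forall>y\<in>K. \<exists>e. e > 0 \<and> (\<forall>x\<in>ball y e. z * x \<le> z * y + \<delta>) \<and>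
      (\<forall>\<^sub>F n in sequentially. ball_prob y e n < exp (- (real n * (z * y - c0 - \<delta>))))"
  proof
    fix y assume y: "y \<in> K"
    have "ereal (z * y - c0 - \<delta>) < rate y" using le[OF y] \<delta> by (auto intro: less_le_trans[rotated])
    then obtain e where e: "e > 0" "\<forall>\<^sub>F n in sequentially. ball_prob y e n < exp (- (real n * (z * y - c0 - \<delta>)))"
      using below_rate[of y] y K(2) by auto
    define e' where "e' = min e (\<delta> / (\<bar>z\<bar> + 1))"
    have e': "e' > 0" using e(1) \<delta> by (simp add: e'_def)
    have "z * x \<le> z * y + \<delta>" if "x \<in> ball y e'" for x
    proof -
      have "z * x - z * y \<le> \<bar>z\<bar> * \<bar>x - y\<bar>"
        by (metis abs_ge_self abs_mult right_diff_distrib)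
      also have "\<dots> \<le> (\<bar>z\<bar> + 1) * e'"
        using that by (intro mult_mono) (auto simp: dist_real_def)
      also have "\<dots> \<le> (\<bar>z\<bar> + 1) * (\<delta> / (\<bar>z\<bar> + 1))" by (intro mult_left_mono) (auto simp: e'_def)
      also have "\<dots> = \<delta>" by simp
      finally show ?thesis by simp
    qed
    moreover have "\<forall>\<^sub>F n in sequentially. ball_prob y e' n < exp (- (real n * (z * y - c0 - \<delta>)))"
      using e(2)
    proof eventually_elim
      case (elim n)
      have "ball_prob y e' n \<le> ball_prob y e n" by (rule ball_prob_mono) (simp add: e'_def)
      then show ?case using elim by simp
    qed
    ultimately show "\<exists>e. e > 0 \<and> (\<forall>x\<in>ball y e. z * x \<le> z * y + \<delta>) \<and>
      (\<forall>\<^sub>F n in sequentially. ball_prob y e n < exp (- (real n * (z * y - c0 - \<delta>))))"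
      using e' by blast
  qed
  from bchoice[OF this] obtain e where e: "\<And>y. y \<in> K \<Longrightarrow> e y > 0" "\<And>y x. y \<in> K \<Longrightarrow> x \<in> ball y (e y) \<Longrightarrow> z * x \<le> z * y + \<delta>"
     "\<And>y. y \<in> K \<Longrightarrow> \<forall>\<^sub>F n in sequentially. ball_prob y (e y) n < exp (- (real n * (z * y - c0 - \<delta>)))"
    by blast
  obtain Y where Y: "Y \<subseteq> K" "finite Y" "K \<subseteq> (\<Union>y\<in>Y. ball y (e y))"
  proof (rule compactE_image[OF K(1), of K "\<lambda>y. ball y (e y)"])
    show "K \<subseteq> (\<Union>c\<in>K. ball c (e c))" using e(1) by force
  qed auto
  have "\<forall>\<^sub>F n in sequentially. \<forall>y\<in>Y. ball_prob y (e y) n < exp (- (real n * (z * y - c0 - \<delta>)))"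
    using e(3) Y(1,2) by (intro eventually_ball_finite) auto
  then have "\<forall>\<^sub>F n in sequentially. tilted z K n \<le> ennreal (real (card Y) * exp (real n * c1))"
    using eventually_gt_at_top[of 0]
  proof eventually_elim
    case (elim n)
    have "tilted z K n \<le> (\<Sum>y\<in>Y. tilted z (ball y (e y)) n)" by (rule tilted_Un_le[OF Y(2,3)])
    also have "\<dots> \<le> (\<Sum>y\<in>Y. ennreal (exp (real n * c1)))"
    proof (rule sum_mono)
      fix y assume y: "y \<in> Y"
      have "tilted z (ball y (e y)) n \<le> ennreal (exp (real n * (z * y + \<delta>))) * scaled_prob (ball y (e y)) n"
        using e(2)[of y] y Y(1) elim(2) by (intro tilted_le_mult) auto
      also have "\<dots> = ennreal (exp (real n * (z * y + \<delta>)) * ball_prob y (e y) n)"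
        by (simp add: ball_prob_eq_scaled_prob[symmetric] ennreal_mult' ball_prob_def)
      also have "\<dots> \<le> ennreal (exp (real n * (z * y + \<delta>)) * exp (- (real n * (z * y - c0 - \<delta>))))"
        using elim(1) y by (intro ennreal_leI mult_left_mono) (auto intro: less_imp_le)
      also have "exp (real n * (z * y + \<delta>)) * exp (- (real n * (z * y - c0 - \<delta>))) = exp (real n * c1)"
        by (simp add: mult_exp_exp \<delta>_def field_simps)
      finally show "tilted z (ball y (e y)) n \<le> ennreal (exp (real n * c1))" .
    qed
    also have "\<dots> = ennreal (real (card Y) * exp (real n * c1))"
      by (simp add: ennreal_mult' ennreal_of_nat_eq_real_of_nat)
    finally show ?case .
  qed
  then show ?thesis by (intro exI[of _ "real (card Y)"]) auto
qed

lemma open_lower_bound: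
  assumes "openin (top_of_set {0..}) V"
  shows "- (INF x\<in>V. rate x) \<le> liminf (exp_rate (scaled_prob V))"
proof -
  have "- liminf (exp_rate (scaled_prob V)) \<le> rate x" if x: "x \<in> V" for x
  proof (rule rate_geI)
    fix s assume s: "attained x s"
    obtain e where e: "e > 0" "\<And>y. y \<in> {0..} \<Longrightarrow> dist y x < e \<Longrightarrow> y \<in> V"
      using assms x unfolding openin_euclidean_subtopology_iff by blast
    have "\<forall>\<^sub>F n in sequentially. ennreal (exp (real n * (- s))) \<le> scaled_prob V n"
    proof -
      have "\<forall>\<^sub>F n in sequentially. exp (- (real n * s)) \<le> ball_prob x e n"
        using s e(1) unfolding attained_def by blast
      then show ?thesis
      proof eventually_elim
        case (elim n)
        have "ball_prob x e n \<le> measure_pmf.prob (Q n) {k. real k / real n \<in> V}"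
          unfolding ball_prob_def
          using e(2) by (intro measure_pmf.finite_measure_mono) (auto simp: dist_real_def)
        then show ?case using elim
          by (simp add: scaled_prob_def measure_pmf.emeasure_eq_measure)
      qed
    qed
    then have "ereal (- s) \<le> liminf (exp_rate (scaled_prob V))" by (rule liminf_exp_rate_ge)
    then show "- liminf (exp_rate (scaled_prob V)) \<le> ereal s"
      by (metis ereal_uminus_le_reorder uminus_ereal.simps(1))
  qed
  then have "- liminf (exp_rate (scaled_prob V)) \<le> (INF x\<in>V. rate x)" by (rule INF_greatest)
  then show ?thesis by (metis ereal_uminus_le_reorder)
qed

text \<open>
  It is enough to compare with real numbers below the infimum, which also covers the cases
  of an infinite infimum and of an empty set.
\<close>

lemma limsup_le_uminus_INF:
  assumes "\<And>s. ereal s < (INF x\<in>F. rate x) \<Longrightarrow> limsup X \<le> ereal (- s)"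
  shows "limsup X \<le> - (INF x\<in>F. rate x)"
proof -
  have "(INF x\<in>F. rate x) \<le> - limsup X"
  proof (rule ccontr)
    assume "\<not> ?thesis"
    then obtain s where s: "- limsup X < ereal s" "ereal s < (INF x\<in>F. rate x)"
      using ereal_dense2 not_le by metis
    have "limsup X \<le> - ereal s" using assms[OF s(2)] by simp
    then have "ereal s \<le> - limsup X" by (metis ereal_minus_le_minus ereal_uminus_uminus)
    then show False using s(1) by simp
  qed
  then show ?thesis by (metis ereal_uminus_le_reorder ereal_uminus_uminus)
qed

lemma compact_upper_bound:
  assumes "compact K" "K \<subseteq> {0..}"
  shows "limsup (exp_rate (scaled_prob K)) \<le> - (INF x\<in>K. rate x)"
proof (rule limsup_le_uminus_INF)
  fix s assume s: "ereal s < (INF x\<in>K. rate x)"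
  show "limsup (exp_rate (scaled_prob K)) \<le> ereal (- s)"
  proof (rule ereal_le_epsilon2)
    fix e :: real assume "e > 0"
    then have "\<exists>m\<ge>0. \<forall>\<^sub>F n in sequentially. tilted 0 K n \<le> ennreal (m * exp (real n * (- s + e)))"
    proof (intro tilted_compact_le[where ?c0.0 = "- s"] assms)
      fix y assume "y \<in> K"
      then have "(INF x\<in>K. rate x) \<le> rate y" by (rule INF_lower)
      then show "ereal (0 * y - - s) \<le> rate y" using s by auto
    qed auto
    then obtain m where "\<forall>\<^sub>F n in sequentially. scaled_prob K n \<le> ennreal (m * exp (real n * (- s + e)))"
      unfolding scaled_prob_eq_tilted by blast
    from limsup_exp_rate_le[OF this]
    show "limsup (exp_rate (scaled_prob K)) \<le> ereal (- s) + ereal e" by simp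
  qed
qed

text \<open>
  Chernoff's bound: beyond \<open>R\<close> the stronger tilt \<open>\<tau>\<close> exceeds the tilt \<open>z\<close> by the factor
  \<open>exp (n * R * (\<tau> - z))\<close>.
\<close>

lemma tilted_tail_le:
  assumes "z \<le> \<tau>" "tilted \<tau> UNIV n \<le> ennreal (exp (real n * B))" "n > 0"
  shows "tilted z {R<..} n \<le> ennreal (exp (real n * (B - R * (\<tau> - z))))"
proof -
  let ?u = "- (R * (\<tau> - z))"
  have "tilted z {R<..} n \<le> (\<integral>\<^sup>+ k. ennreal (exp (real n * ?u)) *
      (ennreal (exp (\<tau> * real k)) * indicator UNIV (real k / real n)) \<partial>Q n)"
    unfolding tilted_def
  proof (intro nn_integral_mono)
    fix k
    have "exp (z * real k) \<le> exp (real n * ?u) * exp (\<tau> * real k)" if "R < real k / real n"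
    proof -
      have "R * real n \<le> real k" using that assms(3) by (simp add: field_simps)
      then have "(R * real n) * (\<tau> - z) \<le> real k * (\<tau> - z)" using assms(1) by (intro mult_right_mono) auto
      then show ?thesis by (simp add: mult_exp_exp algebra_simps)
    qed
    then show "ennreal (exp (z * real k)) * indicator {R<..} (real k / real n)
      \<le> ennreal (exp (real n * ?u)) * (ennreal (exp (\<tau> * real k)) * indicator UNIV (real k / real n))"
      by (auto split: split_indicator simp: ennreal_mult'[symmetric] intro!: ennreal_leI)
  qed
  also have "\<dots> = ennreal (exp (real n * ?u)) * tilted \<tau> UNIV n"
    unfolding tilted_def by (rule nn_integral_cmult) simp
  also have "\<dots> \<le> ennreal (exp (real n * ?u)) * ennreal (exp (real n * B))"
    by (intro mult_left_mono assms(2)) simp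
  also have "\<dots> = ennreal (exp (real n * (B - R * (\<tau> - z))))"
    by (simp add: ennreal_mult'[symmetric] mult_exp_exp algebra_simps)
  finally show ?thesis .
qed

definition log_mgf :: "real \<Rightarrow> ereal" where
  "log_mgf z = limsup (exp_rate (tilted z UNIV))"

lemma log_mgf_ge:
  assumes "attained x s"
  shows "ereal (z * x - s) \<le> log_mgf z"
proof (rule ereal_le_epsilon2)
  fix d :: real assume d: "d > 0"
  define e where "e = d / (\<bar>z\<bar> + 1)"
  have e: "e > 0" using d by (simp add: e_def)
  have near: "z * x - d \<le> z * y" if "y \<in> ball x e" for y
  proof -
    have "z * x - z * y \<le> \<bar>z\<bar> * \<bar>x - y\<bar>"
      by (metis abs_ge_self abs_mult right_diff_distrib)
    also have "\<dots> \<le> (\<bar>z\<bar> + 1) * e"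
      using that by (intro mult_mono) (auto simp: dist_real_def)
    also have "\<dots> = d" by (simp add: e_def)
    finally show ?thesis by simp
  qed
  have "\<forall>\<^sub>F n in sequentially. exp (- (real n * s)) \<le> ball_prob x e n"
    using assms e unfolding attained_def by blast
  then have "\<forall>\<^sub>F n in sequentially. ennreal (exp (real n * (z * x - d - s))) \<le> tilted z UNIV n"
    using eventually_gt_at_top[of 0]
  proof eventually_elim
    case (elim n)
    have "ennreal (exp (real n * (z * x - d - s)))
        = ennreal (exp (real n * (z * x - d))) * ennreal (exp (- (real n * s)))"
      by (simp add: ennreal_mult'[symmetric] mult_exp_exp algebra_simps)
    also have "\<dots> \<le> ennreal (exp (real n * (z * x - d))) * scaled_prob (ball x e) n"
      unfolding ball_prob_eq_scaled_prob[symmetric] using elim(1) by (intro mult_left_mono ennreal_leI) auto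
    also have "\<dots> \<le> tilted z (ball x e) n" using near elim(2) by (rule tilted_ge_mult)
    also have "\<dots> \<le> tilted z UNIV n" by (rule tilted_mono) simp
    finally show ?case .
  qed
  then have "ereal (z * x - d - s) \<le> liminf (exp_rate (tilted z UNIV))" by (rule liminf_exp_rate_ge)
  also have "\<dots> \<le> log_mgf z" unfolding log_mgf_def by (rule Liminf_le_Limsup) simp
  finally have "ereal (z * x - s) \<le> ereal d + log_mgf z"
    by (cases "log_mgf z") auto
  then show "ereal (z * x - s) \<le> log_mgf z + ereal d" by (simp add: add.commute)
qed

text \<open>
  An exponential moment of order \<open>z > 0\<close> makes the rate grow at least linearly, which bounds
  its sublevel sets.
\<close>

lemma rate_ge_linear:
  assumes "log_mgf z \<le> ereal B"
  shows "ereal (z * x - B) \<le> rate x"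
proof (rule rate_geI)
  fix s assume "attained x s"
  then have "ereal (z * x - s) \<le> ereal B" using log_mgf_ge assms order_trans by blast
  then show "ereal (z * x - B) \<le> ereal s" by simp
qed

lemma log_mgf_le:
  assumes "\<And>n. n > 0 \<Longrightarrow> tilted z UNIV n \<le> ennreal (exp (real n * B))"
  shows "log_mgf z \<le> ereal B"
  unfolding log_mgf_def
proof (rule limsup_exp_rate_le[where m = 1])
  show "\<forall>\<^sub>F n in sequentially. tilted z UNIV n \<le> ennreal (1 * exp (real n * B))"
    using eventually_gt_at_top[of 0] by eventually_elim (simp add: assms)
qed

lemma proper_rate:
  assumes \<tau>: "\<tau> > 0" and B: "\<And>n. n > 0 \<Longrightarrow> tilted \<tau> UNIV n \<le> ennreal (exp (real n * B))"
  shows "proper_rate_function (top_of_set {0..}) rate"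
  unfolding proper_rate_function_def
proof (intro allI impI)
  fix \<alpha> :: real
  let ?L = "{x \<in> {0..}. rate x \<le> ereal \<alpha>}"
  have "openin (top_of_set {0..}) {x \<in> {0..}. ereal \<alpha> < rate x}"
    using rate_function_rate by (simp add: rate_function_def)
  then have "closedin (top_of_set {0..}) ({0..} - {x \<in> {0..}. ereal \<alpha> < rate x})"
    by (metis closedin_def openin_diff closedin_diff closedin_topspace topspace_euclidean_subtopology)
  moreover have "{0..} - {x \<in> {0..}. ereal \<alpha> < rate x} = ?L" by auto
  ultimately have cl: "closed ?L"
    using closedin_closed_trans[of "{0::real..}"] by simp
  have "?L \<subseteq> {0..(\<alpha> + B) / \<tau>}"
  proof
    fix x assume x: "x \<in> ?L"
    have "ereal (\<tau> * x - B) \<le> ereal \<alpha>"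
      by (rule order_trans[OF rate_ge_linear[OF log_mgf_le[OF B]]]) (use x in auto)
    then show "x \<in> {0..(\<alpha> + B) / \<tau>}" using x \<tau> by (simp add: field_simps)
  qed
  then have "bounded ?L" using bounded_subset bounded_closed_interval by blast
  then have "compact ?L" using cl compact_eq_bounded_closed by blast
  then show "compactin (top_of_set {0..}) {x \<in> topspace (top_of_set {0..}). rate x \<le> ereal \<alpha>}"
    by (auto simp: compactin_subtopology)
qed

text \<open>
  A finite exponential moment of order larger than \<open>z\<close> controls what happens far out, and
  reduces the case of a closed set to the compact one.
\<close>

lemma tilted_closed_le:
  assumes F: "closed F" "F \<subseteq> {0..}" and le: "\<And>y. y \<in> F \<Longrightarrow> ereal (z * y - c0) \<le> rate y"
    and c: "c0 < c1"
    and \<tau>: "z < \<tau>" and B: "\<And>n. n > 0 \<Longrightarrow> tilted \<tau> UNIV n \<le> ennreal (exp (real n * B))"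
  shows "limsup (exp_rate (tilted z F)) \<le> ereal c1"
proof -
  \<comment> \<open>The radius at which the bound on the tail equals the bound that is to be proved.\<close>
  define R where "R = (B - c1) / (\<tau> - z)"
  have R: "B - R * (\<tau> - z) = c1" using \<tau> by (simp add: R_def)
  have "compact (F \<inter> {0..R})" using F(1) by (intro closed_Int_compact) auto
  from tilted_compact_le[OF this _ _ c, of z] le F(2)
  obtain m where m: "m \<ge> 0" "\<forall>\<^sub>F n in sequentially. tilted z (F \<inter> {0..R}) n \<le> ennreal (m * exp (real n * c1))"
    by blast
  have "\<forall>\<^sub>F n in sequentially. tilted z F n \<le> ennreal ((m + 1) * exp (real n * c1))"
    using m(2) eventually_gt_at_top[of 0]
  proof eventually_elim
    case (elim n)
    have "tilted z F n \<le> (\<Sum>y\<in>{False, True}. tilted z (if y then F \<inter> {0..R} else {R<..}) n)"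
      by (rule tilted_Un_le) (use F(2) in auto)
    also have "\<dots> = tilted z {R<..} n + tilted z (F \<inter> {0..R}) n" by simp
    also have "\<dots> \<le> ennreal (exp (real n * c1)) + ennreal (m * exp (real n * c1))"
      using tilted_tail_le[OF less_imp_le[OF \<tau>] B[OF elim(2)] elim(2), of R] elim(1) R
      by (intro add_mono) auto
    also have "\<dots> = ennreal ((m + 1) * exp (real n * c1))"
      using m(1) by (simp add: ennreal_plus[symmetric] algebra_simps del: ennreal_plus)
    finally show ?case .
  qed
  then show ?thesis by (rule limsup_exp_rate_le)
qed

lemma closed_upper_bound:
  assumes F: "closed F" "F \<subseteq> {0..}"
    and \<tau>: "\<tau> > 0" and B: "\<And>n. n > 0 \<Longrightarrow> tilted \<tau> UNIV n \<le> ennreal (exp (real n * B))"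
  shows "limsup (exp_rate (scaled_prob F)) \<le> - (INF x\<in>F. rate x)"
proof (rule limsup_le_uminus_INF)
  fix s assume s: "ereal s < (INF x\<in>F. rate x)"
  show "limsup (exp_rate (scaled_prob F)) \<le> ereal (- s)"
  proof (rule ereal_le_epsilon2)
    fix e :: real assume "e > 0"
    then have "limsup (exp_rate (tilted 0 F)) \<le> ereal (- s + e)"
    proof (intro tilted_closed_le[where ?c0.0 = "- s", OF F _ _ \<tau> B])
      fix y assume "y \<in> F"
      then have "(INF x\<in>F. rate x) \<le> rate y" by (rule INF_lower)
      then show "ereal (0 * y - - s) \<le> rate y" using s by auto
    qed auto
    moreover have "scaled_prob F = tilted 0 F" using scaled_prob_eq_tilted by blast
    ultimately show "limsup (exp_rate (scaled_prob F)) \<le> ereal (- s) + ereal e" by simp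
  qed
qed

text \<open>
  Every point \<open>(x, s)\<close> below the graph of the rate lies on a line that stays below the graph.
  A line through the point with slope \<open>z\<close> does so if \<open>z\<close> lies between the slopes \<open>A\<close> towards
  points of the epigraph on the left and the slopes \<open>B\<close> towards those on the right. Convexity
  gives \<open>A \<le> B\<close>. Lower semicontinuity bounds \<open>A\<close> from above and \<open>B\<close> from below, so that a real
  \<open>z\<close> exists even if one of the two sets is empty, as happens at and beyond the ends of the
  interval on which the rate is finite.
\<close>

lemma rate_supporting_line:
  assumes x: "x \<ge> 0" and s: "ereal s < rate x"
  shows "\<exists>z. \<forall>y\<ge>0. ereal (s + z * (y - x)) \<le> rate y"
proof -
  obtain e where e: "e > 0" "\<And>y. \<bar>x - y\<bar> < e \<Longrightarrow> ereal s \<le> rate y"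
    using rate_ge_near[OF x s] by blast
  define D where "D = {(y, t). y \<ge> 0 \<and> rate y \<le> ereal t}"
  define A where "A = {(s - t) / (x - y) | y t. (y, t) \<in> D \<and> y < x}"
  define B where "B = {(t - s) / (y - x) | y t. (y, t) \<in> D \<and> x < y}"
  define bd where "bd = \<bar>s\<bar> / e"
  have tnn: "t \<ge> 0" if "(y, t) \<in> D" for y t
    using that rate_nonneg[of y] order_trans[of 0 "rate y" "ereal t"] by (auto simp: D_def)
  have num: "s - t \<le> bd * \<bar>x - y\<bar>" if D: "(y, t) \<in> D" for y t
  proof (cases "\<bar>x - y\<bar> < e")
    case True
    have "ereal s \<le> ereal t" using order_trans[OF e(2)[OF True], of "ereal t"] D by (simp add: D_def)
    moreover have "0 \<le> bd * \<bar>x - y\<bar>" using e(1) by (simp add: bd_def)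
    ultimately show ?thesis by simp
  next
    case False
    then have "bd * e \<le> bd * \<bar>x - y\<bar>" using e(1) by (intro mult_left_mono) (auto simp: bd_def)
    then show ?thesis using tnn[OF D] e(1) by (simp add: bd_def)
  qed
  have A_le: "q \<le> bd" if "q \<in> A" for q
    using that num by (fastforce simp: A_def divide_le_eq abs_if)
  have B_ge: "- bd \<le> q" if "q \<in> B" for q
    using that num by (fastforce simp: B_def le_divide_eq abs_if)
  have AB: "p \<le> q" if pq: "p \<in> A" "q \<in> B" for p q
  proof (rule ccontr)
    assume "\<not> p \<le> q"
    obtain y1 t1 where 1: "p = (s - t1) / (x - y1)" "(y1, t1) \<in> D" "y1 < x" using pq(1) by (auto simp: A_def)
    obtain y2 t2 where 2: "q = (t2 - s) / (y2 - x)" "(y2, t2) \<in> D" "x < y2" using pq(2) by (auto simp: B_def)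
    \<comment> \<open>Otherwise the chord between the two points of the epigraph passes below \<open>(x, s)\<close>.\<close>
    define \<theta> where "\<theta> = (x - y1) / (y2 - y1)"
    have \<theta>: "0 \<le> \<theta>" "\<theta> \<le> 1" "1 - \<theta> = (y2 - x) / (y2 - y1)"
      using 1 2 by (auto simp: \<theta>_def field_simps)
    have "(1 - \<theta>) * y1 + \<theta> * y2 = ((y2 - x) * y1 + (x - y1) * y2) / (y2 - y1)"
      unfolding \<theta>(3) by (simp add: \<theta>_def add_divide_distrib)
    also have "(y2 - x) * y1 + (x - y1) * y2 = x * (y2 - y1)" by (simp add: algebra_simps)
    also have "x * (y2 - y1) / (y2 - y1) = x" using 1(3) 2(3) by simp
    finally have x_eq: "(1 - \<theta>) * y1 + \<theta> * y2 = x" .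
    have "rate x \<le> ereal (1 - \<theta>) * rate y1 + ereal \<theta> * rate y2"
      using rate_convex \<theta>(1,2) 1(2) 2(2) x_eq unfolding ext_convex_on_def D_def by fastforce
    also have "\<dots> \<le> ereal (1 - \<theta>) * ereal t1 + ereal \<theta> * ereal t2"
      using 1(2) 2(2) \<theta>(1,2) by (intro add_mono ereal_mult_left_mono) (auto simp: D_def)
    finally have "rate x \<le> ereal ((1 - \<theta>) * t1 + \<theta> * t2)" by simp
    with s have "ereal s < ereal ((1 - \<theta>) * t1 + \<theta> * t2)" by (rule less_le_trans)
    then have "0 < (1 - \<theta>) * (t1 - s) + \<theta> * (t2 - s)" by (simp add: algebra_simps)
    also have "\<dots> = ((y2 - x) * (t1 - s) + (x - y1) * (t2 - s)) / (y2 - y1)"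
      unfolding \<theta>(3) by (simp add: \<theta>_def add_divide_distrib)
    finally have "0 < (y2 - x) * (t1 - s) + (x - y1) * (t2 - s)"
      using 1(3) 2(3) by (simp add: zero_less_divide_iff)
    then have "(y2 - x) * (s - t1) < (x - y1) * (t2 - s)" by (simp add: algebra_simps)
    moreover have "s - t1 = p * (x - y1)" "t2 - s = q * (y2 - x)" using 1 2 by auto
    ultimately have "((y2 - x) * (x - y1)) * p < ((y2 - x) * (x - y1)) * q"
      by (simp add: algebra_simps)
    then have "p < q" using 1(3) 2(3) by (simp add: mult_less_cancel_left_pos)
    then show False using \<open>\<not> p \<le> q\<close> by simp
  qed
  have "\<exists>z. (\<forall>p\<in>A. p \<le> z) \<and> (\<forall>q\<in>B. z \<le> q)"
  proof (cases "A = {}")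
    case True
    then show ?thesis using B_ge by blast
  next
    case False
    have "bdd_above A" using A_le by (auto simp: bdd_above_def)
    then show ?thesis
      using False AB by (intro exI[of _ "Sup A"]) (auto intro: cSup_upper cSup_least)
  qed
  then obtain z where z: "\<And>p. p \<in> A \<Longrightarrow> p \<le> z" "\<And>q. q \<in> B \<Longrightarrow> z \<le> q" by blast
  have "ereal (s + z * (y - x)) \<le> rate y" if y: "y \<ge> 0" for y
  proof (rule ereal_le_real)
    fix t assume t: "rate y \<le> ereal t"
    then have D: "(y, t) \<in> D" using y by (simp add: D_def)
    consider "y < x" | "y = x" | "x < y" by linarith
    then have "s + z * (y - x) \<le> t"
    proof cases
      case 1
      then have "(s - t) / (x - y) \<le> z" using D by (intro z) (auto simp: A_def)
      then show ?thesis using 1 by (simp add: field_simps)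
    next
      case 2
      have "ereal s < ereal t" using less_le_trans[OF s] t 2 by blast
      then show ?thesis using 2 by simp
    next
      case 3
      then have "z \<le> (t - s) / (y - x)" using D by (intro z) (auto simp: B_def)
      then show ?thesis using 3 by (simp add: field_simps)
    qed
    then show "ereal (s + z * (y - x)) \<le> ereal t" by simp
  qed
  then show ?thesis by blast
qed

text \<open>
  A line of slope \<open>z\<close> below the graph of the rate bounds \<open>log_mgf z\<close> from above by Laplace's
  method, and by \<open>rate_supporting_line\<close> there are such lines through \<open>(x, s)\<close> for
  every \<open>s\<close> below \<open>rate x\<close>. The converse inequality is the trivial half of Laplace's method.
\<close>

theorem rate_eq_Legendre:
  assumes B: "\<And>\<tau> n. n > 0 \<Longrightarrow> tilted \<tau> UNIV n \<le> ennreal (exp (real n * B \<tau>))"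
    and x: "x \<ge> 0"
  shows "rate x = (SUP z::real. ereal (z * x) - log_mgf z)"
proof (rule antisym)
  have nmem: "tilted z {0..} = tilted z UNIV" for z by (auto simp: tilted_def fun_eq_iff)
  show "rate x \<le> (SUP z::real. ereal (z * x) - log_mgf z)"
  proof (rule dense_le)
    fix t assume t: "t < rate x"
    show "t \<le> (SUP z::real. ereal (z * x) - log_mgf z)"
    proof (cases t)
      case (real s)
      obtain z where z: "\<And>y. y \<ge> 0 \<Longrightarrow> ereal (s + z * (y - x)) \<le> rate y"
        using rate_supporting_line[OF x] t real by blast
      have "log_mgf z \<le> ereal (z * x - s)"
      proof (rule ereal_le_epsilon2)
        fix e :: real assume e: "e > 0"
        have "limsup (exp_rate (tilted z {0..})) \<le> ereal (z * x - s + e)"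
        proof (rule tilted_closed_le[where ?c0.0 = "z * x - s"])
          show "z < z + 1" by simp
          show "tilted (z + 1) UNIV n \<le> ennreal (exp (real n * B (z + 1)))" if "n > 0" for n
            using B that by blast
          show "ereal (z * y - (z * x - s)) \<le> rate y" if "y \<in> {0..}" for y
            using z[of y] that by (simp add: algebra_simps)
        qed (use e in auto)
        then show "log_mgf z \<le> ereal (z * x - s) + ereal e" by (simp add: log_mgf_def nmem)
      qed
      then have "ereal s \<le> ereal (z * x) - log_mgf z" by (cases "log_mgf z") auto
      then show ?thesis using real by (auto intro: SUP_upper2)
    qed (use t in auto)
  qed
  show "(SUP z::real. ereal (z * x) - log_mgf z) \<le> rate x"
  proof (rule SUP_least)
    fix z
    show "ereal (z * x) - log_mgf z \<le> rate x"
    proof (rule rate_geI)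
      fix s assume "attained x s"
      then have "ereal (z * x - s) \<le> log_mgf z" by (rule log_mgf_ge)
      then show "ereal (z * x) - log_mgf z \<le> ereal s" by (cases "log_mgf z") auto
    qed
  qed
qed

end

section \<open>Word length\<close>

definition spells :: "('a, 'b) monoid_scheme \<Rightarrow> 'a set \<Rightarrow> 'a list \<Rightarrow> 'a \<Rightarrow> bool" where
  "spells G S ws g \<longleftrightarrow> set ws \<subseteq> S \<union> (\<lambda>s. inv\<^bsub>G\<^esub> s) ` S \<and> g = foldr (\<lambda>s h. s \<otimes>\<^bsub>G\<^esub> h) ws \<one>\<^bsub>G\<^esub>"

lemma word_length_le: "spells G S ws g \<Longrightarrow> word_length G S g \<le> length ws"
  unfolding word_length_def spells_def by (rule Least_le) blast

lemma spells_word_length: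
  assumes "\<exists>ws. spells G S ws g"
  shows "\<exists>us. spells G S us g \<and> length us = word_length G S g"
proof -
  have "\<exists>us. length us = word_length G S g \<and> set us \<subseteq> S \<union> (\<lambda>s. inv\<^bsub>G\<^esub> s) ` S
     \<and> g = foldr (\<lambda>s h. s \<otimes>\<^bsub>G\<^esub> h) us \<one>\<^bsub>G\<^esub>"
    unfolding word_length_def by (rule LeastI_ex) (use assms in \<open>auto simp: spells_def\<close>)
  then show ?thesis by (auto simp: spells_def)
qed

lemma word_length_one [simp]: "word_length G S \<one>\<^bsub>G\<^esub> = 0"
  using word_length_le[of G S "[]"] by (simp add: spells_def)

context group
begin

lemma letters_closed: "S \<subseteq> carrier G \<Longrightarrow> S \<union> (\<lambda>s. inv s) ` S \<subseteq> carrier G"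
  by auto

lemma foldr_mult_closed: "set ws \<subseteq> carrier G \<Longrightarrow> foldr (\<lambda>s h. s \<otimes> h) ws \<one> \<in> carrier G"
  by (induction ws) auto

lemma foldr_mult_append:
  "set us \<subseteq> carrier G \<Longrightarrow> set vs \<subseteq> carrier G \<Longrightarrow>
    foldr (\<lambda>s h. s \<otimes> h) (us @ vs) \<one> = foldr (\<lambda>s h. s \<otimes> h) us \<one> \<otimes> foldr (\<lambda>s h. s \<otimes> h) vs \<one>"
proof (induction us)
  case Nil
  then show ?case by (simp add: foldr_mult_closed)
next
  case (Cons a us)
  then show ?case by (simp add: m_assoc foldr_mult_closed del: foldr_append)
qed

lemma foldr_mult_rev_inv:
  "set ws \<subseteq> carrier G \<Longrightarrow>
    foldr (\<lambda>s h. s \<otimes> h) (map (\<lambda>s. inv s) (rev ws)) \<one> = inv (foldr (\<lambda>s h. s \<otimes> h) ws \<one>)"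
proof (induction ws)
  case (Cons a ws)
  have "foldr (\<lambda>s h. s \<otimes> h) (map (\<lambda>s. inv s) (rev (a # ws))) \<one>
      = foldr (\<lambda>s h. s \<otimes> h) (map (\<lambda>s. inv s) (rev ws)) \<one> \<otimes> foldr (\<lambda>s h. s \<otimes> h) [inv a] \<one>"
    using Cons.prems by (subst foldr_mult_append[symmetric]) auto
  then show ?case using Cons by (simp add: inv_mult_group foldr_mult_closed)
qed simp

lemma spells_append:
  assumes "S \<subseteq> carrier G" "spells G S us g" "spells G S vs h"
  shows "spells G S (us @ vs) (g \<otimes> h)"
proof -
  have "set us \<subseteq> carrier G" "set vs \<subseteq> carrier G"
    using assms letters_closed[OF assms(1)] unfolding spells_def by blast+
  then show ?thesis using assms(2,3) foldr_mult_append[of us vs]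
    by (simp add: spells_def del: foldr_append)
qed

lemma spells_inv:
  assumes S: "S \<subseteq> carrier G" and "spells G S us g"
  shows "spells G S (map (\<lambda>s. inv s) (rev us)) (inv g)"
proof -
  have us: "set us \<subseteq> S \<union> (\<lambda>s. inv s) ` S" using assms by (simp add: spells_def)
  then have "set us \<subseteq> carrier G" using letters_closed[OF S] by blast
  moreover have "(\<lambda>s. inv s) ` set us \<subseteq> S \<union> (\<lambda>s. inv s) ` S" using us S by force
  ultimately show ?thesis using assms(2) foldr_mult_rev_inv by (simp add: spells_def)
qed

lemma spells_closed: "S \<subseteq> carrier G \<Longrightarrow> spells G S ws g \<Longrightarrow> g \<in> carrier G"
  using subset_trans[OF _ letters_closed[of S], of "set ws"] foldr_mult_closed[of ws]
  by (simp add: spells_def)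

lemma generate_spells:
  assumes S: "S \<subseteq> carrier G" and g: "g \<in> generate G S"
  shows "\<exists>ws. spells G S ws g"
  using g
proof induction
  case one
  have "spells G S [] \<one>" by (simp add: spells_def)
  then show ?case by blast
next
  case (incl h)
  then have "spells G S [h] h" using S by (auto simp: spells_def)
  then show ?case by blast
next
  case (inv h)
  then have "spells G S [inv h] (inv h)" using S by (auto simp: spells_def)
  then show ?case by blast
next
  case (eng h1 h2)
  then show ?case using spells_append[OF S] by blast
qed

lemma word_length_mult_le:
  assumes "S \<subseteq> carrier G" "\<exists>us. spells G S us g" "\<exists>vs. spells G S vs h"
  shows "word_length G S (g \<otimes> h) \<le> word_length G S g + word_length G S h"
proof -
  from spells_word_length[OF assms(2)]
  obtain us where us: "spells G S us g" "length us = word_length G S g" by blast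
  from spells_word_length[OF assms(3)]
  obtain vs where vs: "spells G S vs h" "length vs = word_length G S h" by blast
  show ?thesis using word_length_le[OF spells_append[OF assms(1) us(1) vs(1)]] us vs by simp
qed

lemma word_length_inv_le:
  assumes "S \<subseteq> carrier G" "\<exists>us. spells G S us g"
  shows "word_length G S (inv g) \<le> word_length G S g"
proof -
  from spells_word_length[OF assms(2)]
  obtain us where us: "spells G S us g" "length us = word_length G S g" by blast
  show ?thesis using word_length_le[OF spells_inv[OF assms(1) us(1)]] us by simp
qed

end

section \<open>Patterns and a compactness argument\<close>

definition inverse_word :: "('i \<Rightarrow> ('a, 'b) monoid_scheme) \<Rightarrow> ('i \<times> 'a) list \<Rightarrow> ('i \<times> 'a) list" where
  "inverse_word G w = map (\<lambda>(i, a). (i, inv\<^bsub>G i\<^esub> a)) (rev w)"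

lemma inverse_word_simps [simp]:
  "inverse_word G [] = []"
  "inverse_word G (u @ v) = inverse_word G v @ inverse_word G u"
  "inverse_word G ((i, a) # w) = inverse_word G w @ [(i, inv\<^bsub>G i\<^esub> a)]"
  "length (inverse_word G w) = length w"
  by (simp_all add: inverse_word_def)

lemma take_inverse_word:
  "q \<le> length w \<Longrightarrow> take q (inverse_word G w) = inverse_word G (drop (length w - q) w)"
  by (simp add: inverse_word_def take_map take_rev)

text \<open>
  Patterns have a fixed length while group elements may be shorter. Hence patterns are
  compared with \<open>w\<close> by extending the initial segment of \<open>w\<close> to a pattern \<open>\<alpha>\<close>. If \<open>w\<close> begins with
  half of \<open>k\<close>, then \<open>starts_with\<close> looks only at letters of \<open>\<alpha>\<close> that come from \<open>w\<close>.
\<close>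

lemma prefix_take_imp_starts_with:
  assumes "prefix (take (length k div 2) k) w" "prefix (take (length \<alpha>) w) \<alpha>"
  shows "starts_with k \<alpha>"
proof -
  define q where "q = min (length \<alpha>) (length k div 2)"
  obtain r where w: "w = take (length k div 2) k @ r" using assms(1) by (auto simp: prefix_def)
  obtain r' where \<alpha>: "\<alpha> = take (length \<alpha>) w @ r'" using assms(2) by (auto simp: prefix_def)
  have "q \<le> length (take (length \<alpha>) w)" by (simp add: w q_def)
  then have "take q \<alpha> = take q (take (length \<alpha>) w)" by (subst \<alpha>) simp
  also have "\<dots> = take q w" by (simp add: q_def)
  also have "\<dots> = take q k" by (simp add: w q_def)
  finally show ?thesis by (simp add: starts_with_def q_def Let_def)
qed

text \<open>
  There may be infinitely many patterns of length \<open>D\<close>, but a finite set contains an element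
  avoiding any given one of them. The induction runs over the tree of prefixes \<open>p\<close>, from long to short ones: an element
  \<open>k0\<close> that avoids one extension of \<open>p\<close> fails for another extension only if the letter after
  \<open>p\<close> is the one that stands there in \<open>k0\<close> or in \<open>v k0\<close>. These are two letters, and the
  corresponding longer prefixes are covered by induction.
\<close>

lemma finite_escaping_subset:
  assumes len: "\<And>\<omega>. \<omega> \<in> \<Omega> \<Longrightarrow> length \<omega> = D"
    and ex: "\<And>\<omega>. \<omega> \<in> \<Omega> \<Longrightarrow> \<exists>k\<in>T. \<not> starts_with k \<omega> \<and> \<not> starts_with (v k) \<omega>"
  shows "\<exists>K\<subseteq>T. finite K \<and> (\<forall>\<omega>\<in>\<Omega>. prefix p \<omega> \<longrightarrow> (\<exists>k\<in>K. \<not> starts_with k \<omega> \<and> \<not> starts_with (v k) \<omega>))"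
proof (induction "D - length p" arbitrary: p rule: less_induct)
  case less
  show ?case
  proof (cases "\<exists>\<omega>\<in>\<Omega>. prefix p \<omega>")
    case False
    then show ?thesis by (intro exI[of _ "{}"]) auto
  next
    case True
    then obtain \<omega>0 where \<omega>0: "\<omega>0 \<in> \<Omega>" "prefix p \<omega>0" by blast
    obtain k0 where k0: "k0 \<in> T" "\<not> starts_with k0 \<omega>0" "\<not> starts_with (v k0) \<omega>0"
      using ex[OF \<omega>0(1)] by blast
    show ?thesis
    proof (cases "D \<le> length p")
      case True
      have "\<omega> = \<omega>0" if "\<omega> \<in> \<Omega>" "prefix p \<omega>" for \<omega>
        using that \<omega>0 True len[of \<omega>] len[of \<omega>0] by (auto simp: prefix_def)
      then show ?thesis using k0 by (intro exI[of _ "{k0}"]) auto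
    next
      case False
      have next_letter: "prefix (p @ [u ! length p]) \<omega>"
        if \<omega>: "\<omega> \<in> \<Omega>" "prefix p \<omega>" and sw: "starts_with u \<omega>" "\<not> starts_with u \<omega>0" for u \<omega>
      proof -
        define q where "q = min D (length u div 2)"
        have q: "take q u = take q \<omega>" "take q u \<noteq> take q \<omega>0"
          using sw len \<omega>(1) \<omega>0(1) by (auto simp: starts_with_def q_def Let_def)
        obtain r r0 where r: "\<omega> = p @ r" "\<omega>0 = p @ r0" using \<omega>(2) \<omega>0(2) by (auto simp: prefix_def)
        have "length p < q"
        proof (rule ccontr)
          assume "\<not> length p < q"
          then have "take q \<omega> = take q \<omega>0" by (simp add: r)
          then show False using q by simp
        qed
        then have "u ! length p = \<omega> ! length p" using q(1) by (metis nth_take)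
        moreover have "r \<noteq> []" using False len[OF \<omega>(1)] r(1) by auto
        ultimately show ?thesis using r(1) by (cases r) auto
      qed
      have less': "D - length (p @ [x]) < D - length p" for x using False by simp
      from less[OF less', of "k0 ! length p"] obtain K1 where K1: "K1 \<subseteq> T" "finite K1"
        "\<forall>\<omega>\<in>\<Omega>. prefix (p @ [k0 ! length p]) \<omega> \<longrightarrow> (\<exists>k\<in>K1. \<not> starts_with k \<omega> \<and> \<not> starts_with (v k) \<omega>)"
        by blast
      from less[OF less', of "v k0 ! length p"] obtain K2 where K2: "K2 \<subseteq> T" "finite K2"
        "\<forall>\<omega>\<in>\<Omega>. prefix (p @ [v k0 ! length p]) \<omega> \<longrightarrow> (\<exists>k\<in>K2. \<not> starts_with k \<omega> \<and> \<not> starts_with (v k) \<omega>)"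
        by blast
      have "\<exists>k\<in>insert k0 (K1 \<union> K2). \<not> starts_with k \<omega> \<and> \<not> starts_with (v k) \<omega>"
        if "\<omega> \<in> \<Omega>" "prefix p \<omega>" for \<omega>
        using next_letter[OF that _ k0(2)] next_letter[OF that _ k0(3)] K1(3) K2(3) that(1) by blast
      then show ?thesis using K1 K2 k0(1) by (intro exI[of _ "insert k0 (K1 \<union> K2)"]) auto
    qed
  qed
qed

section \<open>Word length in a free product\<close>

locale free_product_of_groups =
  fixes I :: "'i set" and G :: "'i \<Rightarrow> ('a, 'b) monoid_scheme" and S :: "'i \<Rightarrow> 'a set"
  assumes grp: "\<And>i. i \<in> I \<Longrightarrow> group (G i)"
    and gen: "\<And>i. i \<in> I \<Longrightarrow> finite_generating_set (G i) (S i)"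
begin

abbreviation "FP \<equiv> free_product I G"
abbreviation "gens \<equiv> \<Union>i\<in>I. factor_embed G i ` S i"
abbreviation "len \<equiv> word_length FP gens"
abbreviation "letter_len i \<equiv> word_length (G i) (S i)"

sublocale FP: group FP
  using grp by (rule group_free_product)

lemma mult_FP: "u \<otimes>\<^bsub>FP\<^esub> v = foldr (letter_mult G) u v"
  by (simp add: free_product_def)

lemma one_FP: "\<one>\<^bsub>FP\<^esub> = []"
  by (simp add: free_product_def)

lemma carrier_FP: "w \<in> carrier FP \<longleftrightarrow> reduced_word I G w"
  by (simp add: free_product_def)

lemma S_closed: "i \<in> I \<Longrightarrow> S i \<subseteq> carrier (G i)"
  using gen by (simp add: finite_generating_set_def)

lemma letter_spells: "i \<in> I \<Longrightarrow> a \<in> carrier (G i) \<Longrightarrow> \<exists>ws. spells (G i) (S i) ws a"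
  using gen[of i] by (intro group.generate_spells[OF grp]) (auto simp: finite_generating_set_def)

lemma factor_embed_mult: "factor_embed G i a \<otimes>\<^bsub>FP\<^esub> v = letter_mult G (i, a) v"
  by (simp add: mult_FP factor_embed_def letter_mult_one[where I = I and G = G, OF grp])

lemma factor_embed_closed: "i \<in> I \<Longrightarrow> a \<in> carrier (G i) \<Longrightarrow> factor_embed G i a \<in> carrier FP"
  by (auto simp: carrier_FP factor_embed_def reduced_word_Cons)

lemma gens_closed: "gens \<subseteq> carrier FP"
  using S_closed factor_embed_closed by fastforce

lemma factor_embed_inv:
  assumes "i \<in> I" "a \<in> carrier (G i)"
  shows "inv\<^bsub>FP\<^esub> (factor_embed G i a) = factor_embed G i (inv\<^bsub>G i\<^esub> a)"
proof -
  interpret group_hom "G i" FP "factor_embed G i"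
    using grp assms(1) factor_embed_hom[where I = I and G = G, OF grp] by (simp add: group_hom_def group_hom_axioms_def FP.group_axioms)
  show ?thesis using assms(2) by simp
qed

lemma gens_letter:
  assumes "s \<in> gens \<union> (\<lambda>s. inv\<^bsub>FP\<^esub> s) ` gens"
  shows "\<exists>i\<in>I. \<exists>a\<in>carrier (G i). s = factor_embed G i a \<and> letter_len i a \<le> 1"
proof -
  obtain i x where ix: "i \<in> I" "x \<in> S i"
    "s = factor_embed G i x \<or> s = inv\<^bsub>FP\<^esub> (factor_embed G i x)" using assms by auto
  interpret group "G i" using grp ix(1) .
  have x: "x \<in> carrier (G i)" using S_closed ix by auto
  have "spells (G i) (S i) [x] x" "spells (G i) (S i) [inv\<^bsub>G i\<^esub> x] (inv\<^bsub>G i\<^esub> x)"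
    using x ix by (auto simp: spells_def)
  then have "letter_len i x \<le> 1" "letter_len i (inv\<^bsub>G i\<^esub> x) \<le> 1"
    by (auto dest: word_length_le)
  then show ?thesis using ix x factor_embed_inv[OF ix(1) x] by auto
qed

text \<open>
  The word length in the free product is the sum of the word lengths of the letters of the
  reduced word (\<open>len_eq_letter_sum\<close>). Multiplying by a generator changes the sum by at most one,
  hence it is a lower bound; spelling letter by letter attains it.
\<close>

definition letter_sum :: "('i \<times> 'a) list \<Rightarrow> nat" where
  "letter_sum w = (\<Sum>(i, a)\<leftarrow>w. letter_len i a)"

lemma letter_sum_simps [simp]:
  "letter_sum [] = 0" "letter_sum ((i, a) # w) = letter_len i a + letter_sum w"
  "letter_sum (u @ v) = letter_sum u + letter_sum v"
  by (simp_all add: letter_sum_def)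

lemma letter_sum_letter_mult:
  assumes i: "i \<in> I" and a: "a \<in> carrier (G i)" and v: "reduced_word I G v"
  shows "letter_sum (letter_mult G (i, a) v) \<le> letter_len i a + letter_sum v"
proof (cases v)
  case Nil
  then show ?thesis by simp
next
  case (Cons p w)
  obtain j b where p: "p = (j, b)" by (cases p)
  have "letter_len i (a \<otimes>\<^bsub>G i\<^esub> b) \<le> letter_len i a + letter_len i b" if "i = j"
    using that Cons p v i a S_closed letter_spells
    by (intro group.word_length_mult_le[OF grp]) (auto simp: reduced_word_Cons)
  then show ?thesis using Cons p by auto
qed

lemma letter_sum_le_length: "spells FP gens ws w \<Longrightarrow> letter_sum w \<le> length ws"
proof (induction ws arbitrary: w)
  case Nil
  then show ?case by (simp add: spells_def one_FP)
next
  case (Cons s ws)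
  define v where "v = foldr (\<lambda>s h. s \<otimes>\<^bsub>FP\<^esub> h) ws \<one>\<^bsub>FP\<^esub>"
  have v: "spells FP gens ws v" using Cons.prems by (simp add: spells_def v_def)
  have w: "w = s \<otimes>\<^bsub>FP\<^esub> v" using Cons.prems by (simp add: spells_def v_def)
  obtain i a where ia: "i \<in> I" "a \<in> carrier (G i)" "s = factor_embed G i a" "letter_len i a \<le> 1"
    using gens_letter[of s] Cons.prems by (auto simp: spells_def)
  have "reduced_word I G v" using FP.spells_closed[OF gens_closed v] by (simp add: carrier_FP)
  then have "letter_sum w \<le> letter_len i a + letter_sum v"
    unfolding w ia(3) factor_embed_mult by (intro letter_sum_letter_mult ia)
  then show ?case using Cons.IH[OF v] ia(4) by simp
qed

lemma factor_embed_spells: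
  assumes i: "i \<in> I" and us: "spells (G i) (S i) us a"
  shows "spells FP gens (map (factor_embed G i) us) (factor_embed G i a)"
  using us
proof (induction us arbitrary: a)
  case Nil
  then show ?case by (simp add: spells_def one_FP factor_embed_def)
next
  case (Cons s us)
  interpret group "G i" using grp i .
  define b where "b = foldr (\<lambda>s h. s \<otimes>\<^bsub>G i\<^esub> h) us \<one>\<^bsub>G i\<^esub>"
  have b: "spells (G i) (S i) us b" "a = s \<otimes>\<^bsub>G i\<^esub> b" using Cons.prems by (simp_all add: spells_def b_def)
  have s: "s \<in> S i \<union> (\<lambda>s. inv\<^bsub>G i\<^esub> s) ` S i" using Cons.prems by (simp add: spells_def)
  have "s \<in> carrier (G i)" using s S_closed[OF i] by auto
  moreover have "b \<in> carrier (G i)" using spells_closed[OF S_closed[OF i] b(1)] .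
  ultimately have "factor_embed G i a = factor_embed G i s \<otimes>\<^bsub>FP\<^esub> factor_embed G i b"
    unfolding b(2) using factor_embed_hom[where I = I and G = G, OF grp i] by (simp add: hom_mult)
  moreover have "factor_embed G i s \<in> gens \<union> (\<lambda>s. inv\<^bsub>FP\<^esub> s) ` gens"
  proof (cases "s \<in> S i")
    case True
    then show ?thesis using i by auto
  next
    case False
    then obtain x where x: "x \<in> S i" "s = inv\<^bsub>G i\<^esub> x" using s by auto
    then have "factor_embed G i s = inv\<^bsub>FP\<^esub> (factor_embed G i x)"
      using factor_embed_inv[OF i] S_closed[OF i] by auto
    moreover have "factor_embed G i x \<in> gens" using x i by auto
    ultimately show ?thesis by auto
  qed
  ultimately show ?case using Cons.IH[OF b(1)] by (simp add: spells_def)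
qed

lemma letter_mult_reduced_Cons:
  "reduced_word I G ((i, a) # w) \<Longrightarrow> letter_mult G (i, a) w = (i, a) # w"
  by (cases w) (auto simp: reduced_word_Cons)

lemma reduced_word_spells:
  "reduced_word I G w \<Longrightarrow> \<exists>ws. spells FP gens ws w \<and> length ws = letter_sum w"
proof (induction w)
  case Nil
  show ?case by (intro exI[of _ "[]"]) (simp add: spells_def one_FP)
next
  case (Cons p w)
  obtain i a where p: "p = (i, a)" by (cases p)
  have ia: "i \<in> I" "a \<in> carrier (G i)" "a \<noteq> \<one>\<^bsub>G i\<^esub>" "reduced_word I G w"
    using Cons.prems p by (auto simp: reduced_word_Cons)
  obtain vs where vs: "spells FP gens vs w" "length vs = letter_sum w" using Cons.IH ia(4) by blast
  from spells_word_length[OF letter_spells[OF ia(1,2)]]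
  obtain us where us: "spells (G i) (S i) us a" "length us = letter_len i a" by blast
  have "factor_embed G i a \<otimes>\<^bsub>FP\<^esub> w = p # w"
    using Cons.prems by (simp add: factor_embed_mult letter_mult_reduced_Cons p)
  then have "spells FP gens (map (factor_embed G i) us @ vs) (p # w)"
    using FP.spells_append[OF gens_closed factor_embed_spells[OF ia(1) us(1)] vs(1)] by simp
  then show ?case using us vs p by (intro exI[of _ "map (factor_embed G i) us @ vs"]) simp
qed

lemma len_eq_letter_sum:
  assumes "w \<in> carrier FP"
  shows "len w = letter_sum w"
proof -
  obtain ws where ws: "spells FP gens ws w" "length ws = letter_sum w"
    using reduced_word_spells assms by (auto simp: carrier_FP)
  have "\<exists>ws. spells FP gens ws w" using ws(1) by blast
  from spells_word_length[OF this] obtain us where "spells FP gens us w" "length us = len w" by blast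
  then show ?thesis using letter_sum_le_length[of us w] word_length_le[OF ws(1)] ws(2) by simp
qed

lemma carrier_spells: "w \<in> carrier FP \<Longrightarrow> \<exists>ws. spells FP gens ws w"
  using reduced_word_spells by (auto simp: carrier_FP)

lemma len_mult_le: "g \<in> carrier FP \<Longrightarrow> h \<in> carrier FP \<Longrightarrow> len (g \<otimes>\<^bsub>FP\<^esub> h) \<le> len g + len h"
  by (intro FP.word_length_mult_le gens_closed carrier_spells)

lemma len_le_len_mult_right:
  assumes "g \<in> carrier FP" "h \<in> carrier FP"
  shows "len g \<le> len (g \<otimes>\<^bsub>FP\<^esub> h) + len h"
proof -
  have "len g = len (g \<otimes>\<^bsub>FP\<^esub> h \<otimes>\<^bsub>FP\<^esub> inv\<^bsub>FP\<^esub> h)" using assms by (simp add: FP.m_assoc)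
  also have "\<dots> \<le> len (g \<otimes>\<^bsub>FP\<^esub> h) + len (inv\<^bsub>FP\<^esub> h)" using assms by (intro len_mult_le) auto
  also have "len (inv\<^bsub>FP\<^esub> h) \<le> len h"
    using assms by (intro FP.word_length_inv_le gens_closed carrier_spells)
  finally show ?thesis by simp
qed

lemma len_le_len_mult_left:
  assumes "g \<in> carrier FP" "h \<in> carrier FP"
  shows "len h \<le> len (g \<otimes>\<^bsub>FP\<^esub> h) + len g"
proof -
  have "len h = len (inv\<^bsub>FP\<^esub> g \<otimes>\<^bsub>FP\<^esub> (g \<otimes>\<^bsub>FP\<^esub> h))" using assms by (simp add: FP.m_assoc[symmetric])
  also have "\<dots> \<le> len (inv\<^bsub>FP\<^esub> g) + len (g \<otimes>\<^bsub>FP\<^esub> h)" using assms by (intro len_mult_le) auto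
  also have "len (inv\<^bsub>FP\<^esub> g) \<le> len g"
    using assms by (intro FP.word_length_inv_le gens_closed carrier_spells)
  finally show ?thesis by simp
qed

lemma countable_carrier:
  assumes "finite I"
  shows "countable (carrier FP)"
proof -
  have "finite gens" using assms gen by (auto simp: finite_generating_set_def)
  then have "countable (lists (gens \<union> (\<lambda>s. inv\<^bsub>FP\<^esub> s) ` gens))"
    by (intro countable_lists countable_finite) auto
  then have "countable ((\<lambda>ws. foldr (\<lambda>s h. s \<otimes>\<^bsub>FP\<^esub> h) ws \<one>\<^bsub>FP\<^esub>) ` lists (gens \<union> (\<lambda>s. inv\<^bsub>FP\<^esub> s) ` gens))"
    by (rule countable_image)
  then show ?thesis
  proof (rule countable_subset[rotated], intro subsetI)
    fix w assume "w \<in> carrier FP"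
    then obtain ws where "spells FP gens ws w" using carrier_spells by blast
    then show "w \<in> (\<lambda>ws. foldr (\<lambda>s h. s \<otimes>\<^bsub>FP\<^esub> h) ws \<one>\<^bsub>FP\<^esub>) ` lists (gens \<union> (\<lambda>s. inv\<^bsub>FP\<^esub> s) ` gens)"
      by (intro image_eqI[of _ _ ws]) (auto simp: spells_def)
  qed
qed

section \<open>Separating elements\<close>

lemma reduced_word_append:
  "reduced_word I G (u @ v) \<longleftrightarrow> reduced_word I G u \<and> reduced_word I G v \<and>
     (u = [] \<or> v = [] \<or> fst (last u) \<noteq> fst (hd v))"
  by (auto simp: reduced_word_def distinct_adj_append_iff last_map hd_map)

lemma mult_reduced_append: "reduced_word I G (u @ v) \<Longrightarrow> foldr (letter_mult G) u v = u @ v"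
proof (induction u)
  case (Cons p u)
  obtain i a where "p = (i, a)" by (cases p)
  with Cons show ?case using letter_mult_reduced_Cons[of i a "u @ v"] by (simp add: reduced_word_Cons)
qed simp

lemma inverse_word_inverse_word: "reduced_word I G w \<Longrightarrow> inverse_word G (inverse_word G w) = w"
proof (induction w)
  case (Cons p w)
  obtain i a where "p = (i, a)" by (cases p)
  with Cons show ?case by (auto simp: reduced_word_Cons group.inv_inv[OF grp])
qed simp

lemma reduced_inverse_word: "reduced_word I G w \<Longrightarrow> reduced_word I G (inverse_word G w)"
proof (induction w)
  case (Cons p w)
  obtain i a where p: "p = (i, a)" by (cases p)
  have "w \<noteq> [] \<Longrightarrow> fst (last (inverse_word G w)) = fst (hd w)"
    by (cases w) (auto simp: inverse_word_def)
  then show ?case using Cons p grp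
    by (auto simp: reduced_word_Cons reduced_word_append inverse_word_def group.inv_eq_1_iff)
qed simp

text \<open>
  Cancellation between \<open>g\<close> and \<open>k\<close> stops inside \<open>k\<close> unless \<open>k\<close> is entirely absorbed by the end of
  \<open>g\<close>. Where it stops, two letters may merge, but the merged letter is non-trivial and lies in
  the same factor. So the factor of the last letter of \<open>k\<close> can still be read off the product,
  although the letter itself may have changed.
\<close>

lemma last_factor_mult:
  "reduced_word I G g \<Longrightarrow> reduced_word I G k \<Longrightarrow> \<not> prefix k (inverse_word G g) \<Longrightarrow>
    foldr (letter_mult G) g k \<noteq> [] \<and> fst (last (foldr (letter_mult G) g k)) = fst (last k)"
proof (induction g arbitrary: k rule: rev_induct)
  case Nil
  then show ?case by auto
next
  case (snoc p g)
  obtain i a where p: "p = (i, a)" by (cases p)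
  have g: "reduced_word I G g" "i \<in> I" "a \<in> carrier (G i)" "a \<noteq> \<one>\<^bsub>G i\<^esub>"
    "g = [] \<or> fst (last g) \<noteq> i"
    using snoc.prems(1) p by (auto simp: reduced_word_append reduced_word_Cons)
  interpret group "G i" using grp g(2) .
  obtain j b k' where k: "k = (j, b) # k'" using snoc.prems(3) by (cases k) auto
  have k': "reduced_word I G k'" "b \<in> carrier (G j)" "b \<noteq> \<one>\<^bsub>G j\<^esub>" "k' = [] \<or> j \<noteq> fst (hd k')"
    using snoc.prems(2) k by (auto simp: reduced_word_Cons)
  consider "i \<noteq> j" | "i = j" "a \<otimes>\<^bsub>G i\<^esub> b \<noteq> \<one>\<^bsub>G i\<^esub>" | "i = j" "a \<otimes>\<^bsub>G i\<^esub> b = \<one>\<^bsub>G i\<^esub>" by blast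
  then show ?case
  proof cases
    case 1
    have "reduced_word I G (g @ (i, a) # k)"
      using 1 g snoc.prems k by (auto simp: reduced_word_append reduced_word_Cons)
    then have "foldr (letter_mult G) g ((i, a) # k) = g @ (i, a) # k" by (rule mult_reduced_append)
    then show ?thesis using 1 p k g(4) by auto
  next
    case 2
    have "reduced_word I G (g @ (i, a \<otimes>\<^bsub>G i\<^esub> b) # k')"
      using 2 g k' m_closed[of a b] by (auto simp: reduced_word_append reduced_word_Cons)
    then have "foldr (letter_mult G) g ((i, a \<otimes>\<^bsub>G i\<^esub> b) # k') = g @ (i, a \<otimes>\<^bsub>G i\<^esub> b) # k'"
      by (rule mult_reduced_append)
    then show ?thesis using 2 p k g(4) by auto
  next
    case 3
    then have "b = inv\<^bsub>G i\<^esub> a" using g(3) k'(2) inv_equality[of b a] inv_comm[of a b] by simp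
    then have "\<not> prefix k' (inverse_word G g)" using snoc.prems(3) p k 3 by simp
    from snoc.IH[OF g(1) k'(1) this] this show ?thesis
      using 3 p k g(4) by (cases k') auto
  qed
qed

lemma mult_inverse_word_append:
  "reduced_word I G w \<Longrightarrow> foldr (letter_mult G) w (inverse_word G w @ v) = v"
proof (induction w arbitrary: v)
  case (Cons p w)
  obtain i a where p: "p = (i, a)" by (cases p)
  then have w: "reduced_word I G w" "i \<in> I" "a \<in> carrier (G i)" "a \<noteq> \<one>\<^bsub>G i\<^esub>"
    using Cons.prems by (auto simp: reduced_word_Cons)
  interpret group "G i" using grp w(2) .
  show ?case using Cons.IH[OF w(1), of "(i, inv\<^bsub>G i\<^esub> a) # v"] w p by simp
qed simp

lemma first_factor_mult:
  "reduced_word I G k \<Longrightarrow> reduced_word I G h \<Longrightarrow> \<not> prefix (inverse_word G k) h \<Longrightarrow>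
    foldr (letter_mult G) k h \<noteq> [] \<and> fst (hd (foldr (letter_mult G) k h)) = fst (hd k)"
proof (induction k)
  case Nil
  then show ?case by auto
next
  case (Cons p k)
  obtain j b where p: "p = (j, b)" by (cases p)
  have k: "reduced_word I G k" "j \<in> I" "b \<in> carrier (G j)" "b \<noteq> \<one>\<^bsub>G j\<^esub>"
    "k = [] \<or> j \<noteq> fst (hd k)"
    using Cons.prems(1) p by (auto simp: reduced_word_Cons)
  interpret group "G j" using grp k(2) .
  show ?case
  proof (cases "prefix (inverse_word G k) h")
    case False
    then have IH: "foldr (letter_mult G) k h \<noteq> []" "fst (hd (foldr (letter_mult G) k h)) = fst (hd k)"
      using Cons.IH[OF k(1) Cons.prems(2)] by auto
    have "k \<noteq> []" using False by auto
    then show ?thesis using IH k(4,5) p by (cases "foldr (letter_mult G) k h") auto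
  next
    case True
    then obtain h' where h: "h = inverse_word G k @ h'" by (auto simp: prefix_def)
    have h': "reduced_word I G h'" using Cons.prems(2) h by (simp add: reduced_word_append)
    have kh: "foldr (letter_mult G) k h = h'" unfolding h by (rule mult_inverse_word_append[OF k(1)])
    show ?thesis
    proof (cases h')
      case Nil
      then show ?thesis using kh p k(4) by simp
    next
      case (Cons p' h'')
      obtain i c where p': "p' = (i, c)" by (cases p')
      have c: "c \<in> carrier (G i)" using h' Cons p' by (simp add: reduced_word_Cons)
      have "(i, c) \<noteq> (j, inv\<^bsub>G j\<^esub> b)"
        using Cons.prems(3) unfolding h Cons p p' by auto
      then have "i = j \<Longrightarrow> b \<otimes>\<^bsub>G j\<^esub> c \<noteq> \<one>\<^bsub>G j\<^esub>"
        using c k(3) inv_equality[of c b] inv_comm[of b c] by auto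
      then show ?thesis using kh p p' Cons k(4) by auto
    qed
  qed
qed

text \<open>
  Avoiding a pattern at the end is the same as avoiding it at the start of the inverse, which
  makes the two halves of the pattern condition symmetric.
\<close>

lemma ends_with_inverse_iff:
  assumes "reduced_word I G k" "reduced_word I G \<omega>"
  shows "ends_with_inverse G k \<omega> \<longleftrightarrow> starts_with (inverse_word G k) \<omega>"
proof -
  define q where "q = min (length \<omega>) (length k div 2)"
  have red: "reduced_word I G (take q \<omega>)" "reduced_word I G (drop (length k - q) k)"
    using assms by (metis append_take_drop_id reduced_word_append)+
  have "ends_with_inverse G k \<omega> \<longleftrightarrow> drop (length k - q) k = inverse_word G (take q \<omega>)"
    by (simp add: ends_with_inverse_def inverse_word_def q_def Let_def)
  also have "\<dots> \<longleftrightarrow> inverse_word G (drop (length k - q) k) = take q \<omega>"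
    using inverse_word_inverse_word[OF red(1)] inverse_word_inverse_word[OF red(2)] by metis
  also have "inverse_word G (drop (length k - q) k) = take q (inverse_word G k)"
    by (subst take_inverse_word) (auto simp: q_def)
  finally show ?thesis by (simp add: starts_with_def q_def Let_def)
qed

lemma mult_separated:
  assumes "reduced_word I G u" "reduced_word I G v" "u \<noteq> []" "v \<noteq> []" "fst (last u) \<noteq> fst (hd v)"
  shows "u \<otimes>\<^bsub>FP\<^esub> v = u @ v" "len (u @ v) = len u + len v"
proof -
  have *: "reduced_word I G (u @ v)" using assms by (simp add: reduced_word_append)
  show "u \<otimes>\<^bsub>FP\<^esub> v = u @ v" using mult_reduced_append[OF *] by (simp add: mult_FP)
  show "len (u @ v) = len u + len v"
    using assms * by (simp add: len_eq_letter_sum carrier_FP)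
qed

lemma len_reduced_append:
  "reduced_word I G (u @ v) \<Longrightarrow> len (u @ v) = len u + len v"
  by (simp add: len_eq_letter_sum carrier_FP reduced_word_append)

lemma factor_change:
  assumes "reduced_word I G k" "k = k1 @ k2" "k1 \<noteq> []" "k2 \<noteq> []"
  shows "fst (last k1) \<noteq> fst (hd k2)"
  using assms by (simp add: reduced_word_append)

text \<open>
  Neither \<open>g\<close> nor \<open>h\<close> absorbs its half of \<open>k\<close>, so the cancellations on the two sides of the cut
  do not interact: \<open>g k1\<close> ends and \<open>k2 h\<close> begins in different factors, and word length
  is additive there. The only loss is that of \<open>len k1\<close> and \<open>len k2\<close> in the two products.
\<close>

lemma single_separator:
  assumes g: "reduced_word I G g" and h: "reduced_word I G h"
    and k: "reduced_word I G k" "k = k1 @ k2"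
    and k1: "\<not> prefix k1 (inverse_word G g)" and k2: "\<not> prefix (inverse_word G k2) h"
  shows "len g + len h \<le> len (g \<otimes>\<^bsub>FP\<^esub> k \<otimes>\<^bsub>FP\<^esub> h) + len k"
proof -
  have red: "reduced_word I G k1" "reduced_word I G k2" using k by (simp_all add: reduced_word_append)
  have ne: "k1 \<noteq> []" "k2 \<noteq> []" using k1 k2 by auto
  note car = g[folded carrier_FP] h[folded carrier_FP] red[folded carrier_FP]
  have 1: "g \<otimes>\<^bsub>FP\<^esub> k1 \<noteq> []" "fst (last (g \<otimes>\<^bsub>FP\<^esub> k1)) = fst (last k1)"
    using last_factor_mult[OF g red(1) k1] by (auto simp: mult_FP)
  have 2: "k2 \<otimes>\<^bsub>FP\<^esub> h \<noteq> []" "fst (hd (k2 \<otimes>\<^bsub>FP\<^esub> h)) = fst (hd k2)"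
    using first_factor_mult[OF red(2) h k2] by (auto simp: mult_FP)
  have r: "reduced_word I G (g \<otimes>\<^bsub>FP\<^esub> k1)" "reduced_word I G (k2 \<otimes>\<^bsub>FP\<^esub> h)"
    unfolding carrier_FP[symmetric] using car by auto
  have "k = k1 \<otimes>\<^bsub>FP\<^esub> k2" using k mult_reduced_append[of k1 k2] by (simp add: mult_FP)
  then have "g \<otimes>\<^bsub>FP\<^esub> k \<otimes>\<^bsub>FP\<^esub> h = (g \<otimes>\<^bsub>FP\<^esub> k1) \<otimes>\<^bsub>FP\<^esub> (k2 \<otimes>\<^bsub>FP\<^esub> h)"
    using car by (simp add: FP.m_assoc)
  moreover have "fst (last (g \<otimes>\<^bsub>FP\<^esub> k1)) \<noteq> fst (hd (k2 \<otimes>\<^bsub>FP\<^esub> h))"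
    using 1(2) 2(2) factor_change[OF k ne] by simp
  ultimately have "len (g \<otimes>\<^bsub>FP\<^esub> k \<otimes>\<^bsub>FP\<^esub> h) = len (g \<otimes>\<^bsub>FP\<^esub> k1) + len (k2 \<otimes>\<^bsub>FP\<^esub> h)"
    using mult_separated[OF r 1(1) 2(1)] by simp
  moreover have "len k = len k1 + len k2" using k by (simp add: len_reduced_append)
  ultimately show ?thesis
    using len_le_len_mult_right[OF car(1,3)] len_le_len_mult_left[OF car(4,2)] by simp
qed

text \<open>
  The same with two cuts, for an inserted product of two elements \<open>a\<close> and \<open>b\<close> with possible
  cancellation between them: if neither of \<open>a2\<close> and \<open>b1\<close> absorbs the other, what remains of
  \<open>a2 b1\<close> keeps the outer halves \<open>a1\<close> and \<open>b2\<close> apart.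
\<close>

lemma double_separator:
  assumes g: "reduced_word I G g" and h: "reduced_word I G h"
    and a: "reduced_word I G a" "a = a1 @ a2" and b: "reduced_word I G b" "b = b1 @ b2"
    and a1: "\<not> prefix a1 (inverse_word G g)" and b2: "\<not> prefix (inverse_word G b2) h"
    and ab: "\<not> prefix (inverse_word G a2) b1" and ba: "\<not> prefix b1 (inverse_word G a2)"
  shows "len g + len h \<le> len (g \<otimes>\<^bsub>FP\<^esub> (a \<otimes>\<^bsub>FP\<^esub> b) \<otimes>\<^bsub>FP\<^esub> h) + (len a + len b)"
proof -
  have red: "reduced_word I G a1" "reduced_word I G a2" "reduced_word I G b1" "reduced_word I G b2"
    using a b by (simp_all add: reduced_word_append)
  have ne: "a1 \<noteq> []" "a2 \<noteq> []" "b1 \<noteq> []" "b2 \<noteq> []" using a1 b2 ab ba by auto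
  note car = g[folded carrier_FP] h[folded carrier_FP] red[folded carrier_FP]
  define x y z where "x = g \<otimes>\<^bsub>FP\<^esub> a1" and "y = a2 \<otimes>\<^bsub>FP\<^esub> b1" and "z = b2 \<otimes>\<^bsub>FP\<^esub> h"
  have x: "x \<noteq> []" "fst (last x) = fst (last a1)"
    using last_factor_mult[OF g red(1) a1] by (auto simp: mult_FP x_def)
  have z: "z \<noteq> []" "fst (hd z) = fst (hd b2)"
    using first_factor_mult[OF red(4) h b2] by (auto simp: mult_FP z_def)
  have y: "y \<noteq> []" "fst (last y) = fst (last b1)" "fst (hd y) = fst (hd a2)"
    using last_factor_mult[OF red(2,3) ba] first_factor_mult[OF red(2,3) ab] by (auto simp: mult_FP y_def)
  have r: "reduced_word I G x" "reduced_word I G y" "reduced_word I G z"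
    unfolding carrier_FP[symmetric] x_def y_def z_def using car by auto
  note carx = r[folded carrier_FP]
  have "a = a1 \<otimes>\<^bsub>FP\<^esub> a2" "b = b1 \<otimes>\<^bsub>FP\<^esub> b2"
    using a b mult_reduced_append[of a1 a2] mult_reduced_append[of b1 b2] by (simp_all add: mult_FP)
  then have eq: "g \<otimes>\<^bsub>FP\<^esub> (a \<otimes>\<^bsub>FP\<^esub> b) \<otimes>\<^bsub>FP\<^esub> h = x \<otimes>\<^bsub>FP\<^esub> (y \<otimes>\<^bsub>FP\<^esub> z)"
    using car by (simp add: FP.m_assoc x_def y_def z_def)
  have "fst (last y) \<noteq> fst (hd z)" using y z factor_change[OF b ne(3,4)] by simp
  note yz = mult_separated[OF r(2,3) y(1) z(1) this]
  have "fst (last x) \<noteq> fst (hd (y @ z))" using x y factor_change[OF a ne(1,2)] by simp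
  moreover have "reduced_word I G (y @ z)"
    using carx(2,3) yz(1) FP.m_closed carrier_FP by metis
  ultimately have xyz: "x \<otimes>\<^bsub>FP\<^esub> (y @ z) = x @ y @ z" "len (x @ y @ z) = len x + len (y @ z)"
    using mult_separated[OF r(1) _ x(1)] y(1) by auto
  have "len (g \<otimes>\<^bsub>FP\<^esub> (a \<otimes>\<^bsub>FP\<^esub> b) \<otimes>\<^bsub>FP\<^esub> h) = len x + (len y + len z)"
    unfolding eq yz(1) xyz(1) xyz(2) yz(2) ..
  moreover have "len a = len a1 + len a2" "len b = len b1 + len b2"
    using a b by (simp_all add: len_reduced_append)
  ultimately show ?thesis
    using len_le_len_mult_right[OF car(1,3)] len_le_len_mult_left[OF car(6,2)]
    unfolding x_def z_def by simp
qed

lemma reduced_extension: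
  assumes ext: "\<And>w. reduced_word I G w \<Longrightarrow> \<exists>p. reduced_word I G (w @ [p])"
    and w: "reduced_word I G w"
  shows "\<exists>\<omega>. reduced_word I G \<omega> \<and> length \<omega> = D \<and> prefix (take D w) \<omega>"
proof -
  have "\<exists>r. reduced_word I G (w @ r) \<and> length r = n" for n
  proof (induction n)
    case 0
    then show ?case using w by (intro exI[of _ "[]"]) simp
  next
    case (Suc n)
    then obtain r where r: "reduced_word I G (w @ r)" "length r = n" by blast
    then obtain p where "reduced_word I G ((w @ r) @ [p])" using ext by blast
    then show ?case using r by (intro exI[of _ "r @ [p]"]) simp
  qed
  then obtain r where r: "reduced_word I G (w @ r)" "length r = D" by blast
  have "reduced_word I G (take D (w @ r))"
    using r(1) append_take_drop_id[of D "w @ r"] by (metis reduced_word_append)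
  then show ?thesis using r(2) by (intro exI[of _ "take D (w @ r)"]) (auto simp: prefix_def)
qed

text \<open>
  The inverse of \<open>g\<close> begins with some pattern \<open>\<alpha>\<close> and \<open>h\<close> begins with some pattern \<open>\<omega>\<close>. An
  element that does not start with \<open>\<alpha>\<close> and whose inverse does not start with \<open>\<omega>\<close> can be
  inserted without damage. The pattern condition provides such elements only for \<open>\<alpha> = \<omega>\<close>:
  say \<open>a\<close> for \<open>\<alpha>\<close> and \<open>b\<close> for \<open>\<omega>\<close>. If neither of them serves, then \<open>b\<close> starts with \<open>\<alpha>\<close> and the
  inverse of \<open>a\<close> starts with \<open>\<omega>\<close>. In this case \<open>a b\<close> serves: its outer halves are right by the
  choice of \<open>a\<close> and \<open>b\<close>, and in the middle the cancellation compares \<open>\<omega>\<close> with \<open>\<alpha>\<close>, which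
  differ early because \<open>b\<close> starts with \<open>\<alpha>\<close> but not with \<open>\<omega>\<close>.
\<close>

theorem finite_separating_set:
  assumes ext: "\<And>w. reduced_word I G w \<Longrightarrow> \<exists>p. reduced_word I G (w @ [p])"
    and pat: "pattern_avoiding I G T"
    and T: "\<And>a b. a \<in> T \<Longrightarrow> b \<in> T \<Longrightarrow> a \<otimes>\<^bsub>FP\<^esub> b \<in> T"
  shows "\<exists>F C. finite F \<and> F \<subseteq> T \<and> (\<forall>g\<in>carrier FP. \<forall>h\<in>carrier FP. \<exists>k\<in>F.
    len g + len h \<le> len (g \<otimes>\<^bsub>FP\<^esub> k \<otimes>\<^bsub>FP\<^esub> h) + C \<and>
    len (g \<otimes>\<^bsub>FP\<^esub> k \<otimes>\<^bsub>FP\<^esub> h) \<le> len g + len h + C)"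
proof -
  have Tc: "T \<subseteq> carrier FP" using pat by (simp add: pattern_avoiding_def)
  obtain D where D: "\<And>\<omega>. reduced_word I G \<omega> \<Longrightarrow> length \<omega> = D \<Longrightarrow>
        \<exists>g\<in>T. length g \<ge> 2 \<and> \<not> starts_with g \<omega> \<and> \<not> ends_with_inverse G g \<omega>"
    using pat unfolding pattern_avoiding_def by blast
  define \<Omega> where "\<Omega> = {\<omega>. reduced_word I G \<omega> \<and> length \<omega> = D}"
  define T2 where "T2 = {k \<in> T. length k \<ge> 2}"
  have "\<exists>k\<in>T2. \<not> starts_with k \<omega> \<and> \<not> starts_with (inverse_word G k) \<omega>" if "\<omega> \<in> \<Omega>" for \<omega>
  proof -
    have \<omega>: "reduced_word I G \<omega>" "length \<omega> = D" using that by (auto simp: \<Omega>_def)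
    from D[OF this] obtain k where k: "k \<in> T" "length k \<ge> 2" "\<not> starts_with k \<omega>"
      "\<not> ends_with_inverse G k \<omega>" by blast
    have "reduced_word I G k" using k(1) Tc carrier_FP by blast
    then show ?thesis using k ends_with_inverse_iff \<omega>(1) by (auto simp: T2_def)
  qed
  from finite_escaping_subset[of \<Omega> D T2 "inverse_word G" "[]", OF _ this]
  obtain K where K: "K \<subseteq> T2" "finite K"
    "\<And>\<omega>. \<omega> \<in> \<Omega> \<Longrightarrow> \<exists>k\<in>K. \<not> starts_with k \<omega> \<and> \<not> starts_with (inverse_word G k) \<omega>"
    by (auto simp: \<Omega>_def)
  define L where "L = Max (insert 0 (len ` K))"
  have L: "len k \<le> L" if "k \<in> K" for k using that K(2) by (auto simp: L_def)
  have KT: "k \<in> T" "reduced_word I G k" if "k \<in> K" for k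
    using that K(1) Tc carrier_FP by (auto simp: T2_def)
  define F where "F = K \<union> (\<lambda>(a, b). a \<otimes>\<^bsub>FP\<^esub> b) ` (K \<times> K)"
  have F: "finite F" "F \<subseteq> T" using K(2) KT(1) T by (auto simp: F_def)
  have FL: "len k \<le> 2 * L" if "k \<in> F" for k
  proof -
    have "len (a \<otimes>\<^bsub>FP\<^esub> b) \<le> 2 * L" if "a \<in> K" "b \<in> K" for a b
      using len_mult_le[of a b] L[OF that(1)] L[OF that(2)] KT(2)[OF that(1)] KT(2)[OF that(2)]
      by (simp add: carrier_FP)
    then show ?thesis using that L by (fastforce simp: F_def)
  qed
  have sep: "\<exists>k\<in>F. len g + len h \<le> len (g \<otimes>\<^bsub>FP\<^esub> k \<otimes>\<^bsub>FP\<^esub> h) + 2 * L"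
    if g: "reduced_word I G g" and h: "reduced_word I G h" for g h
  proof -
    from reduced_extension[OF ext reduced_inverse_word[OF g], of D]
    obtain \<alpha> where \<alpha>: "reduced_word I G \<alpha>" "length \<alpha> = D" "prefix (take D (inverse_word G g)) \<alpha>" by blast
    from reduced_extension[OF ext h, of D]
    obtain \<omega> where \<omega>: "reduced_word I G \<omega>" "length \<omega> = D" "prefix (take D h) \<omega>" by blast
    have left: "\<not> prefix (take (length k div 2) k) (inverse_word G g)" if "\<not> starts_with k \<alpha>" for k
      using prefix_take_imp_starts_with[of k "inverse_word G g" \<alpha>] that \<alpha> by auto
    have right: "\<not> prefix (inverse_word G (drop (length k div 2) k)) h"
      if "\<not> starts_with (inverse_word G k) \<omega>" for k
    proof
      assume p: "prefix (inverse_word G (drop (length k div 2) k)) h"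
      have "inverse_word G (drop (length k div 2) k) = take (length k - length k div 2) (inverse_word G k)"
        by (subst take_inverse_word) auto
      moreover have "prefix (take (length k div 2) (inverse_word G k))
          (take (length k - length k div 2) (inverse_word G k))"
      proof -
        have "length k div 2 \<le> length k - length k div 2" by linarith
        then show ?thesis
          using take_is_prefix[of "length k div 2" "take (length k - length k div 2) (inverse_word G k)"]
          by (simp add: min_absorb1)
      qed
      ultimately have "prefix (take (length (inverse_word G k) div 2) (inverse_word G k)) h"
        using p by (auto intro: prefix_order.trans)
      then show False using prefix_take_imp_starts_with[of "inverse_word G k" h \<omega>] that \<omega> by auto
    qed
    have single: "len g + len h \<le> len (g \<otimes>\<^bsub>FP\<^esub> k \<otimes>\<^bsub>FP\<^esub> h) + 2 * L"
      if "k \<in> K" "\<not> starts_with k \<alpha>" "\<not> starts_with (inverse_word G k) \<omega>" for k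
      using single_separator[OF g h KT(2)[OF that(1)] _ left[OF that(2)] right[OF that(3)]] L[OF that(1)]
      by simp
    obtain a where a: "a \<in> K" "\<not> starts_with a \<alpha>" "\<not> starts_with (inverse_word G a) \<alpha>"
      using K(3)[of \<alpha>] \<alpha> by (auto simp: \<Omega>_def)
    obtain b where b: "b \<in> K" "\<not> starts_with b \<omega>" "\<not> starts_with (inverse_word G b) \<omega>"
      using K(3)[of \<omega>] \<omega> by (auto simp: \<Omega>_def)
    consider "\<not> starts_with b \<alpha>" | "\<not> starts_with (inverse_word G a) \<omega>"
      | "starts_with b \<alpha>" "starts_with (inverse_word G a) \<omega>" by blast
    then show ?thesis
    proof cases
      case 1
      then show ?thesis using single[OF b(1)] b by (intro bexI[of _ b]) (auto simp: F_def)
    next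
      case 2
      then show ?thesis using single[OF a(1)] a by (intro bexI[of _ a]) (auto simp: F_def)
    next
      case 3
      define a1 a2 where "a1 = take (length a div 2) a" and "a2 = drop (length a div 2) a"
      define b1 b2 where "b1 = take (length b div 2) b" and "b2 = drop (length b div 2) b"
      define qa qb p where "qa = min D (length a div 2)" and "qb = min D (length b div 2)"
        and "p = min qa qb"
      have tb: "take qb b = take qb \<alpha>" "take qb b \<noteq> take qb \<omega>"
        using 3(1) b(2) \<alpha>(2) \<omega>(2) by (auto simp: starts_with_def qb_def Let_def)
      have ta: "take qa (inverse_word G a) = take qa \<omega>" "take qa (inverse_word G a) \<noteq> take qa \<alpha>"
        using 3(2) a(3) \<alpha>(2) \<omega>(2) by (auto simp: starts_with_def qa_def Let_def)
      have a2: "inverse_word G a2 = take (length a - length a div 2) (inverse_word G a)"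
        unfolding a2_def by (subst take_inverse_word) auto
      have pb: "take p b1 = take p \<alpha>"
      proof -
        have "take p b1 = take p (take qb b)" by (simp add: b1_def p_def qb_def)
        then show ?thesis by (simp add: tb(1)) (simp add: p_def)
      qed
      have pa: "take p (inverse_word G a2) = take p \<omega>"
      proof -
        have "take p (inverse_word G a2) = take p (take qa (inverse_word G a))"
          unfolding a2 by (simp add: p_def qa_def min_def)
        then show ?thesis by (simp add: ta(1)) (simp add: p_def)
      qed
      \<comment> \<open>One of \<open>qa\<close> and \<open>qb\<close> is \<open>p\<close>, and \<open>\<alpha>\<close> and \<open>\<omega>\<close> differ within both lengths.\<close>
      have diff: "take p \<alpha> \<noteq> take p \<omega>"
        using tb ta by (cases "qa \<le> qb") (auto simp: p_def min_def)
      have pl: "p \<le> length b1" "p \<le> length (inverse_word G a2)"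
        by (auto simp: p_def qa_def qb_def b1_def a2_def)
      have ab: "\<not> prefix (inverse_word G a2) b1" "\<not> prefix b1 (inverse_word G a2)"
        using diff pa pb pl by (auto simp: prefix_def)
      have "len g + len h \<le> len (g \<otimes>\<^bsub>FP\<^esub> (a \<otimes>\<^bsub>FP\<^esub> b) \<otimes>\<^bsub>FP\<^esub> h) + (len a + len b)"
        using left[OF a(2)] right[OF b(3)] ab KT(2) a(1) b(1)
        by (intro double_separator[OF g h, where ?a1.0 = a1 and ?a2.0 = a2 and ?b1.0 = b1 and ?b2.0 = b2])
          (auto simp: a1_def a2_def b1_def b2_def)
      then show ?thesis using L[OF a(1)] L[OF b(1)] a(1) b(1)
        by (intro bexI[of _ "a \<otimes>\<^bsub>FP\<^esub> b"]) (auto simp: F_def)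
    qed
  qed
  have "\<forall>g\<in>carrier FP. \<forall>h\<in>carrier FP. \<exists>k\<in>F.
    len g + len h \<le> len (g \<otimes>\<^bsub>FP\<^esub> k \<otimes>\<^bsub>FP\<^esub> h) + 2 * L \<and>
    len (g \<otimes>\<^bsub>FP\<^esub> k \<otimes>\<^bsub>FP\<^esub> h) \<le> len g + len h + 2 * L"
  proof (intro ballI)
    fix g h assume gh: "g \<in> carrier FP" "h \<in> carrier FP"
    from sep[of g h] gh obtain k where k: "k \<in> F"
      "len g + len h \<le> len (g \<otimes>\<^bsub>FP\<^esub> k \<otimes>\<^bsub>FP\<^esub> h) + 2 * L" by (auto simp: carrier_FP)
    have kc: "k \<in> carrier FP" using k(1) F(2) Tc by blast
    have "len (g \<otimes>\<^bsub>FP\<^esub> k \<otimes>\<^bsub>FP\<^esub> h) \<le> len (g \<otimes>\<^bsub>FP\<^esub> k) + len h"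
      using gh kc by (intro len_mult_le) auto
    also have "\<dots> \<le> len g + len k + len h" using len_mult_le[OF gh(1) kc] by simp
    finally show "\<exists>k\<in>F. len g + len h \<le> len (g \<otimes>\<^bsub>FP\<^esub> k \<otimes>\<^bsub>FP\<^esub> h) + 2 * L \<and>
      len (g \<otimes>\<^bsub>FP\<^esub> k \<otimes>\<^bsub>FP\<^esub> h) \<le> len g + len h + 2 * L"
      using k FL[OF k(1)] by (intro bexI[of _ k]) auto
  qed
  then show ?thesis using F by blast
qed

end

section \<open>Laws of the random walk\<close>

primrec walk_law :: "('g, 'b) monoid_scheme \<Rightarrow> 'g pmf \<Rightarrow> nat \<Rightarrow> 'g pmf" where
  "walk_law K p 0 = return_pmf \<one>\<^bsub>K\<^esub>"
| "walk_law K p (Suc n) = bind_pmf (walk_law K p n) (\<lambda>g. map_pmf (\<lambda>x. g \<otimes>\<^bsub>K\<^esub> x) p)"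

lemma prob_bind_pmf_ge:
  "pmf p x * measure_pmf.prob (f x) S \<le> measure_pmf.prob (bind_pmf p f) S"
proof -
  have "ennreal (pmf p x * measure_pmf.prob (f x) S) = emeasure (f x) S * emeasure p {x}"
    by (simp add: ennreal_mult' measure_pmf.emeasure_eq_measure measure_pmf_single mult.commute)
  also have "\<dots> = (\<integral>\<^sup>+ y. emeasure (f x) S * indicator {x} y \<partial>p)"
    by (simp add: nn_integral_cmult_indicator)
  also have "\<dots> \<le> (\<integral>\<^sup>+ y. emeasure (f y) S \<partial>p)"
    by (intro nn_integral_mono) (auto split: split_indicator)
  also have "\<dots> = emeasure (bind_pmf p f) S" by simp
  finally show ?thesis by (simp add: measure_pmf.emeasure_eq_measure)
qed

lemma prob_pair_pmf_Times:
  "measure_pmf.prob (pair_pmf p q) (A \<times> B) = measure_pmf.prob p A * measure_pmf.prob q B"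
proof -
  have "emeasure (pair_pmf p q) (A \<times> B) = (\<integral>\<^sup>+ z. indicator (A \<times> B) z \<partial>pair_pmf p q)" by simp
  also have "\<dots> = (\<integral>\<^sup>+ a. \<integral>\<^sup>+ b. indicator A a * indicator B b \<partial>q \<partial>p)"
    unfolding nn_integral_pair_pmf' by (simp add: indicator_times)
  also have "\<dots> = emeasure p A * emeasure q B"
    by (simp add: nn_integral_cmult nn_integral_multc)
  finally show ?thesis
    by (simp add: measure_pmf.emeasure_eq_measure ennreal_mult'[symmetric])
qed

context group
begin

lemma set_walk_law: "set_pmf p \<subseteq> carrier G \<Longrightarrow> set_pmf (walk_law G p n) \<subseteq> carrier G"
  by (induction n) auto

lemma walk_law_add:
  assumes p: "set_pmf p \<subseteq> carrier G"
  shows "walk_law G p (m + n) = bind_pmf (walk_law G p m) (\<lambda>g. map_pmf (\<lambda>h. g \<otimes> h) (walk_law G p n))"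
proof (induction n)
  case 0
  have "bind_pmf (walk_law G p m) (\<lambda>g. map_pmf (\<lambda>h. g \<otimes> h) (walk_law G p 0))
      = bind_pmf (walk_law G p m) (\<lambda>g. return_pmf g)"
    using set_walk_law[OF p, of m] by (intro bind_pmf_cong refl) auto
  then show ?case by (simp add: bind_return_pmf')
next
  case (Suc n)
  have "walk_law G p (m + Suc n) = bind_pmf (walk_law G p m)
      (\<lambda>g. bind_pmf (walk_law G p n) (\<lambda>h. map_pmf (\<lambda>x. (g \<otimes> h) \<otimes> x) p))"
    by (simp add: Suc.IH bind_assoc_pmf bind_map_pmf)
  also have "\<dots> = bind_pmf (walk_law G p m)
      (\<lambda>g. bind_pmf (walk_law G p n) (\<lambda>h. map_pmf (\<lambda>x. g \<otimes> (h \<otimes> x)) p))"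
    using set_walk_law[OF p, of m] set_walk_law[OF p, of n] p
    by (intro bind_pmf_cong map_pmf_cong refl m_assoc) auto
  also have "\<dots> = bind_pmf (walk_law G p m) (\<lambda>g. map_pmf (\<lambda>h. g \<otimes> h) (walk_law G p (Suc n)))"
    by (simp add: map_bind_pmf pmf.map_comp o_def)
  finally show ?case .
qed

text \<open>
  The four stretches of the walk are independent, so the two short ones, in which prescribed
  elements \<open>k\<close> and \<open>u\<close> are to be hit, can be sampled before the two long ones.
\<close>

lemma walk_law_split:
  assumes p: "set_pmf p \<subseteq> carrier G"
  shows "walk_law G p (m + (t + (n + b))) = bind_pmf (walk_law G p t) (\<lambda>k. bind_pmf (walk_law G p b)
    (\<lambda>u. map_pmf (\<lambda>(g, h). g \<otimes> (k \<otimes> (h \<otimes> u))) (pair_pmf (walk_law G p m) (walk_law G p n))))"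
proof -
  let ?W = "walk_law G p"
  have "?W (m + (t + (n + b))) = bind_pmf (?W m) (\<lambda>g. bind_pmf (?W t) (\<lambda>k. bind_pmf (?W n)
      (\<lambda>h. bind_pmf (?W b) (\<lambda>u. return_pmf (g \<otimes> (k \<otimes> (h \<otimes> u)))))))"
    unfolding walk_law_add[OF p] map_pmf_def bind_assoc_pmf bind_return_pmf ..
  also have "\<dots> = bind_pmf (?W t) (\<lambda>k. bind_pmf (?W b) (\<lambda>u. bind_pmf (?W m) (\<lambda>g. bind_pmf (?W n)
      (\<lambda>h. return_pmf (g \<otimes> (k \<otimes> (h \<otimes> u)))))))"
    by (simp only: bind_commute_pmf[of "?W m" "?W t"] bind_commute_pmf[of "?W n" "?W b"]
        bind_commute_pmf[of "?W m" "?W b"])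
  finally show ?thesis
    by (simp add: pair_pmf_def map_pmf_def bind_assoc_pmf bind_return_pmf)
qed

lemma generated_semigroup_walk_law:
  assumes p: "set_pmf p \<subseteq> carrier G" and g: "g \<in> generated_semigroup G (set_pmf p)"
  shows "\<exists>n. g \<in> set_pmf (walk_law G p n)"
  using g
proof induction
  case (incl a)
  then have "a \<in> set_pmf (walk_law G p (Suc 0))" using p by (force simp: bind_return_pmf)
  then show ?case by blast
next
  case (mult a b)
  then obtain m n where "a \<in> set_pmf (walk_law G p m)" "b \<in> set_pmf (walk_law G p n)" by blast
  then have "a \<otimes> b \<in> set_pmf (walk_law G p (m + n))" by (auto simp: walk_law_add[OF p])
  then show ?case by blast
qed

text \<open>
  Sorting the pairs \<open>(g, h)\<close> by a separating element, one \<open>k\<close> in \<open>F\<close> serves for at least a fraction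
  \<open>1 / card F\<close> of the mass, and the walk hits \<open>k\<close> between \<open>g\<close> and \<open>h\<close> with a probability that
  does not depend on the two long stretches. The time \<open>t k\<close> needed to hit \<open>k\<close> depends on \<open>k\<close>;
  to make the total delay constant, a fixed element \<open>u (a - t k)\<close> is appended at the end, which
  moves the length by a bounded amount.
\<close>

theorem walk_length_almost_superconvolutive:
  fixes len :: "'a \<Rightarrow> nat"
  assumes p: "set_pmf p \<subseteq> carrier G"
    and subadd: "\<And>g h. g \<in> carrier G \<Longrightarrow> h \<in> carrier G \<Longrightarrow> len (g \<otimes> h) \<le> len g + len h"
    and cancel: "\<And>g h. g \<in> carrier G \<Longrightarrow> h \<in> carrier G \<Longrightarrow> len g \<le> len (g \<otimes> h) + len h"
    and F: "finite F" "F \<subseteq> generated_semigroup G (set_pmf p)"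
    and sep: "\<And>g h. g \<in> carrier G \<Longrightarrow> h \<in> carrier G \<Longrightarrow> \<exists>k\<in>F.
      len g + len h \<le> len (g \<otimes> k \<otimes> h) + C \<and> len (g \<otimes> k \<otimes> h) \<le> len g + len h + C"
  shows "\<exists>a C c. almost_superconvolutive (\<lambda>n. map_pmf len (walk_law G p n)) a C c"
proof -
  let ?W = "walk_law G p"
  have "\<forall>k\<in>F. \<exists>n. k \<in> set_pmf (?W n)" using generated_semigroup_walk_law[OF p] F(2) by blast
  from bchoice[OF this] obtain t where t: "\<And>k. k \<in> F \<Longrightarrow> k \<in> set_pmf (?W (t k))" by blast
  have "\<forall>n. \<exists>u. u \<in> set_pmf (?W n)" using set_pmf_not_empty by fast
  from choice[OF this] obtain u where u: "\<And>n. u n \<in> set_pmf (?W n)" by blast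
  have Fne: "F \<noteq> {}" using sep[OF one_closed one_closed] by blast
  define a where "a = Max (t ` F)"
  have ta: "t k \<le> a" if "k \<in> F" for k using that F(1) by (simp add: a_def)
  define U where "U = Max ((\<lambda>k. len (u (a - t k))) ` F)"
  have U: "len (u (a - t k)) \<le> U" if "k \<in> F" for k using that F(1) by (simp add: U_def)
  define w where "w k = pmf (?W (t k)) k * pmf (?W (a - t k)) (u (a - t k))" for k
  have w_pos: "w k > 0" if "k \<in> F" for k
    using t[OF that] u[of "a - t k"] by (simp add: w_def pmf_positive)
  define wm where "wm = Min (w ` F)"
  have wm: "wm > 0" "\<And>k. k \<in> F \<Longrightarrow> wm \<le> w k" using F(1) Fne w_pos by (auto simp: wm_def)
  define c where "c = wm / real (card F)"
  have card: "real (card F) > 0" using F(1) Fne by (simp add: card_gt_0_iff)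
  have "almost_superconvolutive (\<lambda>n. map_pmf len (?W n)) a (real (C + U)) c"
  proof
    show "0 < c" using wm card by (simp add: c_def)
    fix m n and A B :: "nat set"
    define S where "S = {g. \<exists>u\<in>A. \<exists>v\<in>B. \<bar>real (len g) - (real u + real v)\<bar> \<le> real (C + U)}"
    define R where "R = measure_pmf.prob (?W (m + n + a)) S"
    define PQ where "PQ = pair_pmf (?W m) (?W n)"
    define E where "E k = {(g, h). g \<in> carrier G \<and> h \<in> carrier G \<and> len g \<in> A \<and> len h \<in> B \<and>
      len g + len h \<le> len (g \<otimes> k \<otimes> h) + C \<and> len (g \<otimes> k \<otimes> h) \<le> len g + len h + C}" for k
    have step: "w k * measure_pmf.prob PQ (E k) \<le> R" if k: "k \<in> F" for k
    proof -
      define x where "x = u (a - t k)"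
      have x: "x \<in> carrier G" using u set_walk_law[OF p] by (auto simp: x_def)
      have kc: "k \<in> carrier G" using t[OF k] set_walk_law[OF p] by blast
      have sub: "E k \<subseteq> (\<lambda>(g, h). g \<otimes> (k \<otimes> (h \<otimes> x))) -` S"
      proof
        fix z assume "z \<in> E k"
        then obtain g h where z: "z = (g, h)" and gh: "g \<in> carrier G" "h \<in> carrier G" "len g \<in> A" "len h \<in> B"
          and l: "len g + len h \<le> len (g \<otimes> k \<otimes> h) + C" "len (g \<otimes> k \<otimes> h) \<le> len g + len h + C"
          by (auto simp: E_def)
        have gkh: "g \<otimes> k \<otimes> h \<in> carrier G" using gh kc by auto
        have "len (g \<otimes> k \<otimes> h \<otimes> x) \<le> len (g \<otimes> k \<otimes> h) + U"
          using subadd[OF gkh x] U[OF k] by (simp add: x_def)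
        moreover have "len (g \<otimes> k \<otimes> h) \<le> len (g \<otimes> k \<otimes> h \<otimes> x) + U"
          using cancel[OF gkh x] U[OF k] by (simp add: x_def)
        ultimately have "\<bar>real (len (g \<otimes> k \<otimes> h \<otimes> x)) - (real (len g) + real (len h))\<bar> \<le> real (C + U)"
          using l by linarith
        moreover have "g \<otimes> k \<otimes> h \<otimes> x = g \<otimes> (k \<otimes> (h \<otimes> x))" using gh kc x by (simp add: m_assoc)
        ultimately show "z \<in> (\<lambda>(g, h). g \<otimes> (k \<otimes> (h \<otimes> x))) -` S"
          using gh z by (auto simp: S_def)
      qed
      have "w k * measure_pmf.prob PQ (E k)
          \<le> w k * measure_pmf.prob PQ ((\<lambda>(g, h). g \<otimes> (k \<otimes> (h \<otimes> x))) -` S)"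
        using sub w_pos[OF k] by (intro mult_left_mono measure_pmf.finite_measure_mono) auto
      also have "\<dots> = pmf (?W (t k)) k * (pmf (?W (a - t k)) x
          * measure_pmf.prob (map_pmf (\<lambda>(g, h). g \<otimes> (k \<otimes> (h \<otimes> x))) PQ) S)"
        by (simp add: w_def x_def mult.assoc)
      also have "\<dots> \<le> pmf (?W (t k)) k * measure_pmf.prob (bind_pmf (?W (a - t k))
          (\<lambda>x. map_pmf (\<lambda>(g, h). g \<otimes> (k \<otimes> (h \<otimes> x))) PQ)) S"
        by (intro mult_left_mono prob_bind_pmf_ge) auto
      also have "\<dots> \<le> measure_pmf.prob (?W (m + (t k + (n + (a - t k))))) S"
        unfolding walk_law_split[OF p] PQ_def by (rule prob_bind_pmf_ge)
      also have "m + (t k + (n + (a - t k))) = m + n + a" using ta[OF k] by simp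
      finally show ?thesis by (simp add: R_def)
    qed
    have "measure_pmf.prob (?W m) (len -` A) * measure_pmf.prob (?W n) (len -` B)
        = measure_pmf.prob PQ ((len -` A \<times> len -` B) \<inter> set_pmf PQ)"
      by (simp add: prob_pair_pmf_Times PQ_def measure_Int_set_pmf del: set_pair_pmf)
    also have "\<dots> \<le> measure_pmf.prob PQ (\<Union>k\<in>F. E k)"
    proof (intro measure_pmf.finite_measure_mono subsetI)
      fix z assume z: "z \<in> (len -` A \<times> len -` B) \<inter> set_pmf PQ"
      then obtain g h where gh: "z = (g, h)" "g \<in> carrier G" "h \<in> carrier G" "len g \<in> A" "len h \<in> B"
        using set_walk_law[OF p] by (fastforce simp: PQ_def)
      then show "z \<in> (\<Union>k\<in>F. E k)" using sep[OF gh(2,3)] by (auto simp: E_def)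
    qed simp
    also have "\<dots> \<le> (\<Sum>k\<in>F. measure_pmf.prob PQ (E k))"
      using F(1) by (intro measure_pmf.finite_measure_subadditive_finite) auto
    finally have "wm * (measure_pmf.prob (?W m) (len -` A) * measure_pmf.prob (?W n) (len -` B))
        \<le> wm * (\<Sum>k\<in>F. measure_pmf.prob PQ (E k))" using wm by simp
    also have "\<dots> = (\<Sum>k\<in>F. wm * measure_pmf.prob PQ (E k))" by (rule sum_distrib_left)
    also have "\<dots> \<le> (\<Sum>k\<in>F. R)"
    proof (rule sum_mono)
      fix k assume k: "k \<in> F"
      have "wm * measure_pmf.prob PQ (E k) \<le> w k * measure_pmf.prob PQ (E k)"
        using wm(2)[OF k] by (intro mult_right_mono) auto
      then show "wm * measure_pmf.prob PQ (E k) \<le> R" using step[OF k] by linarith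
    qed
    also have "\<dots> = real (card F) * R" by simp
    finally have "c * measure_pmf.prob (?W m) (len -` A) * measure_pmf.prob (?W n) (len -` B) \<le> R"
      using card by (simp add: c_def field_simps)
    moreover have "S = len -` {k. \<exists>u\<in>A. \<exists>v\<in>B. \<bar>real k - (real u + real v)\<bar> \<le> real (C + U)}"
      by (auto simp: S_def)
    ultimately show "c * measure_pmf.prob (map_pmf len (?W m)) A * measure_pmf.prob (map_pmf len (?W n)) B
      \<le> measure_pmf.prob (map_pmf len (?W (m + n + a)))
          {k. \<exists>u\<in>A. \<exists>v\<in>B. \<bar>real k - (real u + real v)\<bar> \<le> real (C + U)}"
      by (simp add: R_def)
  qed
  then show ?thesis by blast
qed

lemma nn_integral_exp_walk_law_le:
  fixes len :: "'a \<Rightarrow> nat"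
  assumes p: "set_pmf p \<subseteq> carrier G" and \<tau>: "\<tau> \<ge> 0" and l1: "len \<one> = 0"
    and subadd: "\<And>g h. g \<in> carrier G \<Longrightarrow> h \<in> carrier G \<Longrightarrow> len (g \<otimes> h) \<le> len g + len h"
  shows "(\<integral>\<^sup>+ g. ennreal (exp (\<tau> * real (len g))) \<partial>walk_law G p n)
    \<le> (\<integral>\<^sup>+ g. ennreal (exp (\<tau> * real (len g))) \<partial>p) ^ n"
proof (induction n)
  case 0
  show ?case using l1 by simp
next
  case (Suc n)
  let ?e = "\<lambda>g. ennreal (exp (\<tau> * real (len g)))"
  have "(\<integral>\<^sup>+ g. ?e g \<partial>walk_law G p (Suc n)) = (\<integral>\<^sup>+ g. \<integral>\<^sup>+ x. ?e (g \<otimes> x) \<partial>p \<partial>walk_law G p n)" by simp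
  also have "\<dots> \<le> (\<integral>\<^sup>+ g. \<integral>\<^sup>+ x. ?e g * ?e x \<partial>p \<partial>walk_law G p n)"
  proof (intro nn_integral_mono_AE AE_pmfI)
    fix g x assume "g \<in> set_pmf (walk_law G p n)" "x \<in> set_pmf p"
    then have "g \<in> carrier G" "x \<in> carrier G" using p set_walk_law[OF p] by auto
    then have "real (len (g \<otimes> x)) \<le> real (len g) + real (len x)" using subadd[of g x] by linarith
    then have "\<tau> * real (len (g \<otimes> x)) \<le> \<tau> * (real (len g) + real (len x))"
      using \<tau> by (intro mult_left_mono) auto
    then have "exp (\<tau> * real (len (g \<otimes> x))) \<le> exp (\<tau> * real (len g)) * exp (\<tau> * real (len x))"
      by (simp add: mult_exp_exp distrib_left)
    then show "?e (g \<otimes> x) \<le> ?e g * ?e x" by (simp add: ennreal_mult'[symmetric] ennreal_leI)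
  qed
  also have "\<dots> = (\<integral>\<^sup>+ g. ?e g \<partial>walk_law G p n) * (\<integral>\<^sup>+ x. ?e x \<partial>p)"
    by (simp add: nn_integral_cmult nn_integral_multc)
  also have "\<dots> \<le> (\<integral>\<^sup>+ x. ?e x \<partial>p) ^ n * (\<integral>\<^sup>+ x. ?e x \<partial>p)"
    by (intro mult_right_mono Suc.IH) simp
  finally show ?case by (simp add: mult.commute)
qed

end

text \<open>
  A probability measure on a countable set in which all subsets are measurable, viewed as a
  discrete distribution on the whole type.
\<close>

definition point_pmf :: "'g measure \<Rightarrow> 'g pmf" where
  "point_pmf \<mu> = Abs_pmf (distr \<mu> (count_space UNIV) (\<lambda>x. x))"

lemma measurable_from_discrete:
  "sets \<mu> = Pow C \<Longrightarrow> f \<in> C \<rightarrow> space N \<Longrightarrow> f \<in> measurable \<mu> N"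
  using sets_eq_imp_space_eq[of \<mu> "count_space C"] by (auto simp: measurable_def)

lemma measure_point_pmf:
  assumes "prob_space \<mu>" "sets \<mu> = Pow C" "countable C"
  shows "measure_pmf (point_pmf \<mu>) = distr \<mu> (count_space UNIV) (\<lambda>x. x)"
proof -
  interpret prob_space \<mu> by fact
  let ?D = "distr \<mu> (count_space UNIV) (\<lambda>x. x)"
  have meas: "(\<lambda>x. x) \<in> measurable \<mu> (count_space UNIV)"
    using assms(2) by (intro measurable_from_discrete) auto
  interpret D: prob_space ?D using meas by (rule prob_space_distr)
  have sp: "space \<mu> = C" using sets_eq_imp_space_eq[of \<mu> "count_space C"] assms(2) by simp
  have "AE x in ?D. x \<in> C" using meas by (subst AE_distr_iff) (auto simp: sp)
  then have "AE x in ?D. measure ?D {x} \<noteq> 0"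
    using D.AE_support_countable assms(3) by auto
  then show ?thesis
    unfolding point_pmf_def by (intro Abs_pmf_inverse) (auto simp: D.prob_space_axioms)
qed

lemma set_point_pmf:
  assumes "prob_space \<mu>" "sets \<mu> = Pow C" "countable C"
  shows "set_pmf (point_pmf \<mu>) = {g \<in> C. measure \<mu> {g} > 0}"
proof -
  have sp: "space \<mu> = C" using sets_eq_imp_space_eq[of \<mu> "count_space C"] assms(2) by simp
  have meas: "(\<lambda>x. x) \<in> measurable \<mu> (count_space UNIV)"
    using assms(2) by (intro measurable_from_discrete) auto
  have "measure (point_pmf \<mu>) {g} = measure \<mu> ({g} \<inter> C)" for g
    unfolding measure_point_pmf[OF assms] using meas by (subst measure_distr) (auto simp: sp vimage_def Int_def)
  then have "pmf (point_pmf \<mu>) g = measure \<mu> ({g} \<inter> C)" for g by (simp add: pmf.rep_eq)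
  moreover have "{g} \<inter> C = (if g \<in> C then {g} else {})" for g by auto
  ultimately show ?thesis by (auto simp: set_pmf_iff zero_less_measure_iff split: if_splits)
qed

text \<open>
  The walk at time \<open>n\<close> is a function of the first \<open>n\<close> increments alone; here it is the walk
  driven by the coordinates of the product space. Independence of the next increment
  follows by grouping.
\<close>

lemma right_walk_restrict:
  "right_walk K (\<lambda>i v. v i) n (restrict (\<lambda>i. \<xi> i \<omega>) {1..n}) = right_walk K \<xi> n \<omega>"
proof -
  have "right_walk K (\<lambda>i v. v i) m (restrict (\<lambda>i. \<xi> i \<omega>) {1..n}) = right_walk K \<xi> m \<omega>" if "m \<le> n" for m
    using that by (induction m) auto
  then show ?thesis by simp
qed

lemma measurable_right_walk:
  assumes K: "group K" "countable (carrier K)" and \<mu>: "sets \<mu> = Pow (carrier K)"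
    and X: "\<And>i. 1 \<le> i \<Longrightarrow> i \<le> m \<Longrightarrow> X i \<in> measurable N \<mu>"
  shows "right_walk K X m \<in> measurable N \<mu>"
proof -
  interpret K: group K by (rule K(1))
  let ?C = "carrier K"
  have sp: "space \<mu> = ?C" using sets_eq_imp_space_eq[of \<mu> "count_space ?C"] \<mu> by simp
  have to_count: "measurable N \<mu> = measurable N (count_space ?C)"
    using \<mu> by (intro measurable_cong_sets) auto
  have mult: "(\<lambda>x. f x \<otimes>\<^bsub>K\<^esub> g x) \<in> measurable N \<mu>"
    if f: "f \<in> measurable N \<mu>" and g: "g \<in> measurable N \<mu>" for f g
  proof (rule measurable_compose_countable'[where g = f and I = ?C])
    show "(\<lambda>x. i \<otimes>\<^bsub>K\<^esub> g x) \<in> measurable N \<mu>" if "i \<in> ?C" for i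
      by (rule measurable_compose[OF g measurable_from_discrete[OF \<mu>]]) (use that sp in auto)
  qed (use f K(2) to_count in auto)
  show ?thesis using X
  proof (induction m)
    case 0
    have "right_walk K X 0 = (\<lambda>_. \<one>\<^bsub>K\<^esub>)" by auto
    then show ?case using sp by simp
  next
    case (Suc m)
    have "right_walk K X (Suc m) = (\<lambda>x. right_walk K X m x \<otimes>\<^bsub>K\<^esub> X (Suc m) x)" by auto
    then show ?case using Suc by (auto intro!: mult)
  qed
qed

text \<open>
  The type of group elements may be uncountable, so measures on pairs are compared
  through their point masses on the countable carrier rather than through a product
  measure.
\<close>

theorem (in prob_space) distr_right_walk:
  assumes K: "group K" "countable (carrier K)"
    and \<mu>: "prob_space \<mu>" "sets \<mu> = Pow (carrier K)"
    and ind: "indep_vars (\<lambda>_. \<mu>) \<xi> {1..}"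
    and id: "\<And>n. n \<ge> 1 \<Longrightarrow> distr M \<mu> (\<xi> n) = \<mu>"
  shows "right_walk K \<xi> n \<in> measurable M (count_space UNIV)"
    and "distr M (count_space UNIV) (right_walk K \<xi> n) = measure_pmf (walk_law K (point_pmf \<mu>) n)"
proof -
  interpret K: group K by (rule K(1))
  let ?p = "point_pmf \<mu>"
  let ?Y = "right_walk K \<xi>"
  let ?C = "carrier K"
  have sp: "space \<mu> = ?C" using sets_eq_imp_space_eq[of \<mu> "count_space ?C"] \<mu>(2) by simp
  have p_set: "set_pmf ?p \<subseteq> ?C" using set_point_pmf[OF \<mu> K(2)] by auto
  have \<xi>: "\<xi> i \<in> measurable M \<mu>" if "i \<ge> 1" for i using ind that by (auto simp: indep_vars_def)
  have Y\<mu>: "?Y m \<in> measurable M \<mu>" for m by (rule measurable_right_walk[OF K \<mu>(2)]) (use \<xi> in auto)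
  have \<mu>U: "(\<lambda>x. x) \<in> measurable \<mu> (count_space UNIV)"
    by (rule measurable_from_discrete[OF \<mu>(2)]) auto
  have YU: "?Y m \<in> measurable M (count_space UNIV)" for m
    using measurable_compose[OF Y\<mu> \<mu>U] by simp
  then show "?Y n \<in> measurable M (count_space UNIV)" .
  have \<xi>U: "\<xi> i \<in> measurable M (count_space UNIV)" if "i \<ge> 1" for i
    using measurable_compose[OF \<xi>[OF that] \<mu>U] by simp
  have \<xi>_law: "distr M (count_space UNIV) (\<xi> i) = measure_pmf ?p" if "i \<ge> 1" for i
  proof -
    have "distr M (count_space UNIV) (\<xi> i) = distr (distr M \<mu> (\<xi> i)) (count_space UNIV) (\<lambda>x. x)"
      using distr_distr[OF \<mu>U \<xi>[OF that]] by (simp add: o_def)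
    then show ?thesis using id[OF that] measure_point_pmf[OF \<mu> K(2)] by simp
  qed
  have indep: "indep_var \<mu> (?Y m) \<mu> (\<xi> (Suc m))" for m
  proof -
    have "indep_var \<mu> ((right_walk K (\<lambda>i v. v i) m) \<circ> (\<lambda>\<omega>. restrict (\<lambda>i. \<xi> i \<omega>) {1..m}))
        \<mu> ((\<lambda>v. v (Suc m)) \<circ> (\<lambda>\<omega>. restrict (\<lambda>i. \<xi> i \<omega>) {Suc m}))"
    proof (rule indep_var_compose[OF indep_var_restrict[OF ind]])
      show "right_walk K (\<lambda>i v. v i) m \<in> measurable (Pi\<^sub>M {1..m} (\<lambda>_. \<mu>)) \<mu>"
        by (rule measurable_right_walk[OF K \<mu>(2)]) (auto intro: measurable_component_singleton)
      show "(\<lambda>v. v (Suc m)) \<in> measurable (Pi\<^sub>M {Suc m} (\<lambda>_. \<mu>)) \<mu>"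
        by (rule measurable_component_singleton) simp
    qed auto
    moreover have "(\<lambda>v. v (Suc m)) \<circ> (\<lambda>\<omega>. restrict (\<lambda>i. \<xi> i \<omega>) {Suc m}) = \<xi> (Suc m)" by auto
    moreover have "right_walk K (\<lambda>i v. v i) m \<circ> (\<lambda>\<omega>. restrict (\<lambda>i. \<xi> i \<omega>) {1..m}) = ?Y m"
      by (rule ext) (simp only: o_apply right_walk_restrict)
    ultimately show ?thesis by simp
  qed
  show "distr M (count_space UNIV) (?Y n) = measure_pmf (walk_law K ?p n)"
  proof (induction n)
    case 0
    have "?Y 0 = (\<lambda>_. \<one>\<^bsub>K\<^esub>)" by auto
    then show ?case by (simp add: return_pmf.rep_eq)
  next
    case (Suc n)
    let ?J = "\<lambda>\<omega>. (?Y n \<omega>, \<xi> (Suc n) \<omega>)"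
    let ?W = "walk_law K ?p n"
    have JC: "?J \<in> space M \<rightarrow> ?C \<times> ?C"
      using measurable_space[OF Y\<mu>[of n]] measurable_space[OF \<xi>[of "Suc n"]] sp by auto
    have J: "?J \<in> measurable M (count_space UNIV)"
    proof -
      have "?J \<in> measurable M (count_space (?C \<times> ?C))"
      proof (subst measurable_count_space_eq_countable)
        show "countable (?C \<times> ?C)" using K(2) by simp
        show "?J \<in> space M \<rightarrow> ?C \<times> ?C \<and> (\<forall>a\<in>?C \<times> ?C. ?J -` {a} \<inter> space M \<in> sets M)"
        proof (intro conjI JC ballI)
          fix a assume "a \<in> ?C \<times> ?C"
          have "?J -` {a} \<inter> space M = (?Y n -` {fst a} \<inter> space M) \<inter> (\<xi> (Suc n) -` {snd a} \<inter> space M)"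
            by (cases a) auto
          then show "?J -` {a} \<inter> space M \<in> sets M"
            using measurable_sets[OF YU, of "{fst a}" n] measurable_sets[OF \<xi>U, of "Suc n" "{snd a}"] by auto
        qed
      qed
      then show ?thesis
        using measurable_compose[of ?J M "count_space (?C \<times> ?C)" "\<lambda>x. x" "count_space UNIV"] by simp
    qed
    have "distr M (count_space UNIV) ?J = measure_pmf (pair_pmf ?W ?p)"
    proof (rule measure_eqI_countable_AE[where \<Omega> = "?C \<times> ?C"])
      show "AE x in distr M (count_space UNIV) ?J. x \<in> ?C \<times> ?C"
        using J JC by (subst AE_distr_iff) auto
      show "AE x in measure_pmf (pair_pmf ?W ?p). x \<in> ?C \<times> ?C"
        using K.set_walk_law[OF p_set, of n] p_set by (auto simp: AE_measure_pmf_iff)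
      show "countable (?C \<times> ?C)" using K(2) by simp
      fix z assume z: "z \<in> ?C \<times> ?C"
      obtain g x where gx: "z = (g, x)" by (cases z)
      have "emeasure (distr M (count_space UNIV) ?J) {z} = emeasure M (?J -` ({g} \<times> {x}) \<inter> space M)"
        using J by (subst emeasure_distr) (auto simp: gx)
      also have "\<dots> = ennreal (prob (?Y n -` {g} \<inter> space M) * prob (\<xi> (Suc n) -` {x} \<inter> space M))"
        using indep_varD[OF indep[of n], of "{g}" "{x}"] z gx \<mu>(2) by (simp add: emeasure_eq_measure)
      also have "\<dots> = ennreal (measure (distr M (count_space UNIV) (?Y n)) {g}
          * measure (distr M (count_space UNIV) (\<xi> (Suc n))) {x})"
        using YU \<xi>U[of "Suc n"] by (simp add: measure_distr)
      also have "\<dots> = ennreal (pmf (pair_pmf ?W ?p) z)"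
        by (simp add: Suc.IH \<xi>_law pmf_pair gx measure_pmf_single)
      finally show "emeasure (distr M (count_space UNIV) ?J) {z} = emeasure (measure_pmf (pair_pmf ?W ?p)) {z}"
        by (simp add: emeasure_pmf_single)
    qed auto
    then have "distr (distr M (count_space UNIV) ?J) (count_space UNIV) (\<lambda>(g, x). g \<otimes>\<^bsub>K\<^esub> x)
        = measure_pmf (map_pmf (\<lambda>(g, x). g \<otimes>\<^bsub>K\<^esub> x) (pair_pmf ?W ?p))"
      by (simp add: map_pmf_rep_eq)
    moreover have "distr (distr M (count_space UNIV) ?J) (count_space UNIV) (\<lambda>(g, x). g \<otimes>\<^bsub>K\<^esub> x)
        = distr M (count_space UNIV) (?Y (Suc n))"
    proof -
      have "(\<lambda>(g, x). g \<otimes>\<^bsub>K\<^esub> x) \<circ> ?J = ?Y (Suc n)" by auto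
      then show ?thesis using J by (simp add: distr_distr)
    qed
    moreover have "map_pmf (\<lambda>(g, x). g \<otimes>\<^bsub>K\<^esub> x) (pair_pmf ?W ?p) = walk_law K ?p (Suc n)"
      by (simp add: pair_pmf_def map_bind_pmf map_pmf_def bind_assoc_pmf bind_return_pmf)
    ultimately show ?case by metis
  qed
qed

section \<open>The large deviation principle\<close>

theorem theorem1p4:
  fixes r :: nat
    and G :: "nat \<Rightarrow> ('a, 'b) monoid_scheme"
    and S :: "nat \<Rightarrow> 'a set"
    and \<mu> :: "(nat \<times> 'a) list measure"
    and M :: "'w measure"
    and \<xi> :: "nat \<Rightarrow> 'w \<Rightarrow> (nat \<times> 'a) list"
  defines "FP \<equiv> free_product {1..r} G"
  defines "len \<equiv> word_length FP (\<Union>i\<in>{1..r}. factor_embed G i ` S i)"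
  defines "Y \<equiv> right_walk FP \<xi>"
  defines "Z \<equiv> \<lambda>n \<omega>. real (len (Y n \<omega>)) / real n"
  assumes "r \<ge> 2"
    and "\<And>i. i \<in> {1..r} \<Longrightarrow> group (G i)"
    and "\<And>i. i \<in> {1..r} \<Longrightarrow> carrier (G i) \<noteq> {\<one>\<^bsub>G i\<^esub>}"
    and "\<And>i. i \<in> {1..r} \<Longrightarrow> subexponential_growth (G i)"
    and "\<And>i. i \<in> {1..r} \<Longrightarrow> finite_generating_set (G i) (S i)"
    and "prob_space \<mu>" and "sets \<mu> = Pow (carrier FP)"
    and "pattern_avoiding {1..r} G
           (generated_semigroup FP {g \<in> carrier FP. measure \<mu> {g} > 0})"
    and "prob_space M"
    and "prob_space.indep_vars M (\<lambda>_. \<mu>) \<xi> {1..}"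
    and "\<And>n. n \<ge> 1 \<Longrightarrow> distr M \<mu> (\<xi> n) = \<mu>"
  shows "\<exists>I :: real \<Rightarrow> ereal.
     (weak_LDP M (top_of_set {0..}) Z I \<and> ext_convex_on {0..} I) \<and>
     ((\<exists>\<tau>>0. exponential_moment \<mu> len \<tau> < \<infinity>) \<longrightarrow>
        proper_rate_function (top_of_set {0..}) I \<and> full_LDP M (top_of_set {0..}) Z I) \<and>
     ((\<forall>\<tau>>0. exponential_moment \<mu> len \<tau> < \<infinity>) \<longrightarrow>
        (\<forall>x\<ge>0. I x = (SUP z::real. ereal (z * x) - limiting_log_mgf M (\<lambda>n \<omega>. len (Y n \<omega>)) z)))"
proof -
  note r = assms(5) and grp = assms(6) and nontriv = assms(7) and gen = assms(9)
    and \<mu> = assms(10,11) and pat = assms(12) and M = assms(13) and ind = assms(14) and id = assms(15)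
  interpret W: free_product_of_groups "{1..r}" G S
    by (rule free_product_of_groups.intro[OF grp gen])
  interpret K: group FP unfolding FP_def by (rule W.FP.is_group)
  interpret M: prob_space M by (rule M)
  have ctbl: "countable (carrier FP)" unfolding FP_def by (rule W.countable_carrier) simp
  have subadd: "len (g \<otimes>\<^bsub>FP\<^esub> h) \<le> len g + len h" if "g \<in> carrier FP" "h \<in> carrier FP" for g h
    using W.len_mult_le[of g h] that by (simp add: FP_def len_def)
  have cancel: "len g \<le> len (g \<otimes>\<^bsub>FP\<^esub> h) + len h" if "g \<in> carrier FP" "h \<in> carrier FP" for g h
    using W.len_le_len_mult_right[of g h] that by (simp add: FP_def len_def)
  define p where "p = point_pmf \<mu>"
  have set_p: "set_pmf p = {g \<in> carrier FP. measure \<mu> {g} > 0}"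
    unfolding p_def by (rule set_point_pmf[OF \<mu> ctbl])
  then have p: "set_pmf p \<subseteq> carrier FP" by auto
  define Q where "Q n = map_pmf len (walk_law FP p n)" for n
  \<comment> \<open>Two non-trivial factors suffice to prolong every reduced word by a letter.\<close>
  have "\<exists>q. reduced_word {1..r} G (w @ [q])" if w: "reduced_word {1..r} G w" for w
  proof -
    define i :: nat where "i = (if w \<noteq> [] \<and> fst (last w) = 1 then 2 else 1)"
    have i: "i \<in> {1..r}" "w = [] \<or> fst (last w) \<noteq> i" using r by (auto simp: i_def)
    interpret Gi: group "G i" using grp i(1) .
    obtain a where "a \<in> carrier (G i)" "a \<noteq> \<one>\<^bsub>G i\<^esub>" using nontriv[OF i(1)] Gi.one_closed by blast
    then have "reduced_word {1..r} G (w @ [(i, a)])"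
      using w i unfolding W.reduced_word_append by (auto simp: reduced_word_Cons)
    then show ?thesis by blast
  qed
  from W.finite_separating_set[OF this pat[unfolded FP_def] generated_semigroup.mult]
  obtain F C where F: "finite F" "F \<subseteq> generated_semigroup FP (set_pmf p)"
    "\<And>g h. g \<in> carrier FP \<Longrightarrow> h \<in> carrier FP \<Longrightarrow> \<exists>k\<in>F.
      len g + len h \<le> len (g \<otimes>\<^bsub>FP\<^esub> k \<otimes>\<^bsub>FP\<^esub> h) + C \<and>
      len (g \<otimes>\<^bsub>FP\<^esub> k \<otimes>\<^bsub>FP\<^esub> h) \<le> len g + len h + C"
    unfolding set_p FP_def len_def by blast
  from K.walk_length_almost_superconvolutive[OF p subadd cancel F]
  obtain a C' c where "almost_superconvolutive Q a C' c" unfolding Q_def by blast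
  then interpret A: almost_superconvolutive Q a C' c .
  have Y: "Y n \<in> measurable M (count_space UNIV)"
    and Y_law: "distr M (count_space UNIV) (Y n) = measure_pmf (walk_law FP p n)" for n
    unfolding Y_def p_def by (rule M.distr_right_walk[OF K.is_group ctbl \<mu> ind id]; simp)+
  have rate_eq: "log_rate M Z B = exp_rate (A.scaled_prob B)" for B
  proof
    fix n
    have "emeasure M {\<omega> \<in> space M. Z n \<omega> \<in> B}
        = emeasure (distr M (count_space UNIV) (Y n)) {g. real (len g) / real n \<in> B}"
      using Y by (subst emeasure_distr) (auto simp: Z_def intro!: arg_cong[where f = "emeasure M"])
    then show "log_rate M Z B n = exp_rate (A.scaled_prob B) n"
      by (simp add: log_rate_def exp_rate_def A.scaled_prob_def Y_law Q_def vimage_def)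
  qed
  have mgf_eq: "limiting_log_mgf M (\<lambda>n \<omega>. len (Y n \<omega>)) z = A.log_mgf z" for z
  proof -
    have "(\<integral>\<^sup>+ \<omega>. ennreal (exp (z * real (len (Y n \<omega>)))) \<partial>M)
        = (\<integral>\<^sup>+ g. ennreal (exp (z * real (len g))) \<partial>distr M (count_space UNIV) (Y n))" for n
      using Y by (subst nn_integral_distr) auto
    then show ?thesis
      by (simp add: limiting_log_mgf_def A.log_mgf_def exp_rate_def[abs_def] A.tilted_def Y_law Q_def)
  qed
  have moment: "\<exists>B. \<forall>n>0. A.tilted \<tau> UNIV n \<le> ennreal (exp (real n * B))"
    if \<tau>: "\<tau> > 0" "exponential_moment \<mu> len \<tau> < \<infinity>" for \<tau>
  proof -
    define E where "E = exponential_moment \<mu> len \<tau>"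
    have "(\<lambda>x. x) \<in> measurable \<mu> (count_space UNIV)" by (rule measurable_from_discrete[OF \<mu>(2)]) auto
    then have E: "E = (\<integral>\<^sup>+ g. ennreal (exp (\<tau> * real (len g))) \<partial>p)"
      unfolding E_def exponential_moment_def p_def measure_point_pmf[OF \<mu> ctbl]
      by (subst nn_integral_distr) auto
    have "(\<integral>\<^sup>+ g. 1 \<partial>p) \<le> E" unfolding E using \<tau>(1) by (intro nn_integral_mono) simp
    then have E1: "1 \<le> E" by simp
    then have "0 < E" using less_le_trans[OF zero_less_one] by blast
    then have e: "E = ennreal (enn2real E)" "0 < enn2real E"
      using \<tau>(2) unfolding E_def[symmetric] by (auto simp: enn2real_positive_iff less_top[symmetric])
    have "A.tilted \<tau> UNIV n \<le> ennreal (exp (real n * ln (enn2real E)))" for n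
    proof -
      have "A.tilted \<tau> UNIV n = (\<integral>\<^sup>+ g. ennreal (exp (\<tau> * real (len g))) \<partial>walk_law FP p n)"
        by (simp add: A.tilted_def Q_def)
      also have "\<dots> \<le> E ^ n"
        unfolding E using \<tau>(1) by (intro K.nn_integral_exp_walk_law_le[OF p _ _ subadd]) (simp_all add: len_def)
      also have "\<dots> = ennreal (enn2real E ^ n)" by (subst e(1)) (simp add: ennreal_power)
      also have "enn2real E ^ n = exp (real n * ln (enn2real E))" using e(2) by (simp add: exp_of_nat_mult)
      finally show ?thesis .
    qed
    then show ?thesis by blast
  qed
  have compactin_iff: "compactin (top_of_set {0..}) K \<longleftrightarrow> compact K \<and> K \<subseteq> {0..}" for K :: "real set"
    by (auto simp: compactin_subtopology)
  have weak: "weak_LDP M (top_of_set {0..}) Z A.rate"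
    unfolding weak_LDP_def rate_eq compactin_iff
    using A.rate_function_rate A.open_lower_bound A.compact_upper_bound by blast
  have full: "proper_rate_function (top_of_set {0..}) A.rate \<and> full_LDP M (top_of_set {0..}) Z A.rate"
    if \<tau>: "\<tau> > 0" "exponential_moment \<mu> len \<tau> < \<infinity>" for \<tau>
  proof -
    from moment[OF \<tau>] obtain B where B: "\<And>n. n > 0 \<Longrightarrow> A.tilted \<tau> UNIV n \<le> ennreal (exp (real n * B))"
      by blast
    have "limsup (exp_rate (A.scaled_prob H)) \<le> - (INF x\<in>H. A.rate x)" if "closedin (top_of_set {0..}) H" for H
    proof (rule A.closed_upper_bound[OF _ _ \<tau>(1) B])
      show "closed H" using closedin_closed_trans[OF that] by simp
      show "H \<subseteq> {0..}" using closedin_subset[OF that] by simp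
    qed
    then show ?thesis
      unfolding full_LDP_def rate_eq
      using A.proper_rate[OF \<tau>(1) B] A.rate_function_rate A.open_lower_bound by blast
  qed
  have legendre: "A.rate x = (SUP z::real. ereal (z * x) - limiting_log_mgf M (\<lambda>n \<omega>. len (Y n \<omega>)) z)"
    if all: "\<forall>\<tau>>0. exponential_moment \<mu> len \<tau> < \<infinity>" and x: "x \<ge> 0" for x
  proof -
    have "\<forall>\<tau>. \<exists>B. \<forall>n>0. A.tilted \<tau> UNIV n \<le> ennreal (exp (real n * B))"
    proof
      fix \<tau> :: real
      show "\<exists>B. \<forall>n>0. A.tilted \<tau> UNIV n \<le> ennreal (exp (real n * B))"
      proof (cases "\<tau> > 0")
        case True
        then show ?thesis using moment all by blast
      next
        case False
        have "A.tilted \<tau> UNIV n \<le> (\<integral>\<^sup>+ k. 1 \<partial>Q n)" for n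
          unfolding A.tilted_def using False by (intro nn_integral_mono) (simp add: mult_nonpos_nonneg)
        then show ?thesis by (intro exI[of _ 0]) simp
      qed
    qed
    from choice[OF this] obtain B where "\<And>\<tau> n. n > 0 \<Longrightarrow> A.tilted \<tau> UNIV n \<le> ennreal (exp (real n * B \<tau>))"
      by blast
    from A.rate_eq_Legendre[OF this x] show ?thesis by (simp add: mgf_eq)
  qed
  show ?thesis
    using weak A.rate_convex full legendre by (intro exI[of _ A.rate]) blast
qed

end
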